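(* Let $\phi,\psi\in H_2^+(\mathbb R)$. Then the detectable subspace of the Friedrichs model with data $\phi,\psi$ is $$\overline{\mathcal S}=\overline{\bigvee_{\mu\in\mathbb C_+}\frac{1}{x-\mu}+\bigvee_{\mu\in\mathbb C_-}\frac{D(\mu)+2\pi i\,\overline\phi(\mu)\psi(x)}{x-\mu}} .$$ Moreover, suppose that $\psi(x)=\sum_{j=1}^N\frac{c_j}{x-z_j}$ with $c_j\neq0$, $\mathrm{Im}\,z_j<0$ and $z_i\neq z_j$ for $i\neq j$. Then: (a) the function $D_+(\mu)=D(\mu)$, $\mu\in\mathbb C_+$, is rational, and its meromorphic continuation to $\mathbb C$ (again denoted $D_+$) is $D_+(\mu)=1+2\pi i\sum_{j=1}^Nc_j\overline\phi(z_j)(\mu-z_j)^{-1}$; (b) $\dim(\mathcal S^\perp)=N-P-M-M_0$, where - $P=\sum_kp_k$, where the $p_k$ are the orders of the poles of $\overline\phi(\mu)/D_+(\mu)$ in $\mathbb C_-\setminus\{z_1,\dots,z_N\}$; - $M=\sum_im_i$, where the $m_i$ are the "orders of the poles" of $\overline{\phi(x)}/D_+(x)$ at points $x_i\in\mathbb R$, i.e. $m_i$ is the minimal non-negative integer such that $(x-x_i)^{m_i}\overline{\phi(x)}/D_+(x)$ is square integrable near $x_i$; - $M_0=\left|\left\{j:\ \overline\phi(z_j)=0\ \text{ and }\ \lim_{\mu\to z_j}\frac{2\pi i\,\overline\phi(\mu)c_j}{D_+(\mu)(\mu-z_j)}\neq1\right\}\right|$.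
   Context: $H_2^{\pm}(\mathbb R)$: Hardy space of $L^2$ boundary values on $\mathbb R$ of functions in the Hardy class $H^2$ of the upper/lower half-plane $\mathbb C_\pm$. For $\phi\in H_2^+$, $\overline\phi(\mu)$ with $\mu\in\mathbb C_-$ denotes the analytic extension of $\overline{\phi}\in H_2^-$ to $\mathbb C_-$, i.e. $\overline\phi(\mu)=\overline{\phi(\overline\mu)}$. $\bigvee$ denotes closed linear span in $L^2(\mathbb R)$ (as functions of $x$). $D(\lambda)=1+\int_{\mathbb R}\frac{\psi(x)\overline{\phi(x)}}{x-\lambda}dx$ for $\lambda\in\mathbb C\setminus\mathbb R$. The continuation of $D_+$ to $\mathbb C_-$ is in general different from $D|_{\mathbb C_-}$. Friedrichs model with data $\phi,\psi\in L^2(\mathbb R)$: $\langle f,g\rangle=\int_{\mathbb R}f\overline g\,dx$. Let $\mathcal D=\{f\in L^2(\mathbb R):\exists c_f\in\mathbb C,\ xf(x)-c_f\mathbf 1\in L^2(\mathbb R)\}$; $c_f$ is uniquely determined. Let $(\widetilde A^*f)(x)=xf(x)-c_f+\langle f,\phi\rangle\psi(x)$ on $\mathcal D$, $\Gamma_1u=\lim_{R\to\infty}\int_{-R}^Ru\,dx$, $\Gamma_2u=c_u$. For $B\in\mathbb C$, $A_B$ is the restriction of $\widetilde A^*$ to $\{u\in\mathcal D:\Gamma_1u=B\Gamma_2u\}$, and for $\lambda\in\rho(A_B)$ the solution operator $S_{\lambda,B}:\mathbb C\to\ker(\widetilde A^*-\lambda)$ is defined by $(\widetilde A^*-\lambda)S_{\lambda,B}f=0$,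 $(\Gamma_1-B\Gamma_2)S_{\lambda,B}f=f$. The detectable subspace $\overline{\mathcal S}$ is the closed linear span in $L^2(\mathbb R)$ of all $\mathrm{Ran}(S_{\lambda,B})$, $B\in\mathbb C$, $\lambda\in\rho(A_B)$; equivalently $\mathcal S^\perp=\bigcap_{B}\bigcap_{\lambda\in\rho(A_B)}\ker(S_{\lambda,B}^* )$.
   Formalization: Part (b) additionally assumes that for each j with \overline\phi(z_j)=0 the limit in the definition of M_0 is finite; otherwise the formula fails, e.g. N=2, \overline\phi(\mu)=(\mu-z_1)/(\mu-i)^2, D_+(\mu)=(\mu-z_1)/(\mu-z_2), where \dim S^\perp=0. *)

theory Defs
  imports "HOL-Complex_Analysis.Complex_Analysis"
begin

text \<open>
  Elements of \<open>L\<^sup>2(\<real>)\<close> are represented by Borel functions on the line. Equality in \<open>L\<^sup>2\<close> is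
  equality almost everywhere, and subspaces are sets of representatives.
\<close>

definition L2 :: "(real \<Rightarrow> complex) set" where
  "L2 = {f. f \<in> borel_measurable lborel \<and> integrable lborel (\<lambda>x. (norm (f x))\<^sup>2)}"

definition L2_inner :: "(real \<Rightarrow> complex) \<Rightarrow> (real \<Rightarrow> complex) \<Rightarrow> complex" where
  "L2_inner f g = (LINT x|lborel. f x * cnj (g x))"

definition L2_norm :: "(real \<Rightarrow> complex) \<Rightarrow> real" where
  "L2_norm f = sqrt (LINT x|lborel. (norm (f x))\<^sup>2)"

definition L2_closure :: "(real \<Rightarrow> complex) set \<Rightarrow> (real \<Rightarrow> complex) set" where
  "L2_closure A = {f \<in> L2. \<forall>\<epsilon>>0. \<exists>g\<in>A. g \<in> L2 \<and> L2_norm (\<lambda>x. f x - g x) < \<epsilon>}"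

definition lin_span :: "(real \<Rightarrow> complex) set \<Rightarrow> (real \<Rightarrow> complex) set" where
  "lin_span A = {g. \<exists>(n::nat) a u. (\<forall>i<n. u i \<in> A) \<and> g = (\<lambda>x. \<Sum>i<n. a i * u i x)}"

definition closed_span :: "(real \<Rightarrow> complex) set \<Rightarrow> (real \<Rightarrow> complex) set" where
  "closed_span A = L2_closure (lin_span A)"

definition fun_set_sum ::
    "(real \<Rightarrow> complex) set \<Rightarrow> (real \<Rightarrow> complex) set \<Rightarrow> (real \<Rightarrow> complex) set" where
  "fun_set_sum A B = {\<lambda>x. f x + g x | f g. f \<in> A \<and> g \<in> B}"

definition L2_orth :: "(real \<Rightarrow> complex) set \<Rightarrow> (real \<Rightarrow> complex) set" where
  "L2_orth A = {g \<in> L2. \<forall>f\<in>A. L2_inner f g = 0}"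

text \<open>\<open>V\<close>, taken modulo functions vanishing almost everywhere, has complex dimension \<open>n\<close>;
  \<open>e\<close> is a basis.\<close>

definition has_L2_dim :: "(real \<Rightarrow> complex) set \<Rightarrow> nat \<Rightarrow> bool" where
  "has_L2_dim V n \<longleftrightarrow> (\<exists>e :: nat \<Rightarrow> real \<Rightarrow> complex.
      (\<forall>i<n. e i \<in> V) \<and>
      (\<forall>a. (AE x in lborel. (\<Sum>i<n. a i * e i x) = 0) \<longrightarrow> (\<forall>i<n. a i = 0)) \<and>
      (\<forall>f\<in>V. \<exists>a. AE x in lborel. f x = (\<Sum>i<n. a i * e i x)))"


definition hardy_class :: "(complex \<Rightarrow> complex) \<Rightarrow> bool" where
  "hardy_class F \<longleftrightarrow> F holomorphic_on {w. Im w > 0} \<and>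
     (\<forall>y>0. (\<lambda>x. F (Complex x y)) \<in> L2) \<and>
     (\<exists>K. \<forall>y>0. L2_norm (\<lambda>x. F (Complex x y)) \<le> K)"

text \<open>Boundary values are taken as limits in \<open>L\<^sup>2\<close>-norm along horizontal lines.\<close>

definition hardy_boundary :: "(complex \<Rightarrow> complex) \<Rightarrow> (real \<Rightarrow> complex) \<Rightarrow> bool" where
  "hardy_boundary F f \<longleftrightarrow>
     ((\<lambda>y. L2_norm (\<lambda>x. F (Complex x y) - f x)) \<longlongrightarrow> 0) (at_right 0)"

definition hardy2_plus :: "(real \<Rightarrow> complex) set" where
  "hardy2_plus = {f \<in> L2. \<exists>F. hardy_class F \<and> hardy_boundary F f}"

text \<open>The choice matters only outside the open upper half-plane, where the value is never used.\<close>

definition hardy_ext :: "(real \<Rightarrow> complex) \<Rightarrow> complex \<Rightarrow> complex" where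
  "hardy_ext f = (SOME F. hardy_class F \<and> hardy_boundary F f)"

text \<open>The extension of \<open>cnj \<circ> f\<close> to the lower half-plane.\<close>

definition hardy_bar :: "(real \<Rightarrow> complex) \<Rightarrow> complex \<Rightarrow> complex" where
  "hardy_bar f \<mu> = cnj (hardy_ext f (cnj \<mu>))"


definition mdom :: "(real \<Rightarrow> complex) set" where
  "mdom = {f \<in> L2. \<exists>c. (\<lambda>x. of_real x * f x - c) \<in> L2}"

definition coef :: "(real \<Rightarrow> complex) \<Rightarrow> complex" where
  "coef f = (THE c. (\<lambda>x. of_real x * f x - c) \<in> L2)"

definition Atilde ::
    "(real \<Rightarrow> complex) \<Rightarrow> (real \<Rightarrow> complex) \<Rightarrow> (real \<Rightarrow> complex) \<Rightarrow> (real \<Rightarrow> complex)" where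
  "Atilde \<phi> \<psi> f = (\<lambda>x. of_real x * f x - coef f + L2_inner f \<phi> * \<psi> x)"

definition Gamma1 :: "(real \<Rightarrow> complex) \<Rightarrow> complex" where
  "Gamma1 u = Lim at_top (\<lambda>R::real. LINT x:{-R..R}|lborel. u x)"

definition Gamma2 :: "(real \<Rightarrow> complex) \<Rightarrow> complex" where
  "Gamma2 u = coef u"

definition dom_AB :: "complex \<Rightarrow> (real \<Rightarrow> complex) set" where
  "dom_AB B = {u \<in> mdom. Gamma1 u = B * Gamma2 u}"

text \<open>\<open>A\<^sub>B - \<lambda>\<close> is onto \<open>L\<^sup>2\<close>, injective, and its inverse is bounded (all modulo null functions).\<close>

definition resolvent_set ::
    "(real \<Rightarrow> complex) \<Rightarrow> (real \<Rightarrow> complex) \<Rightarrow> complex \<Rightarrow> complex set" where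
  "resolvent_set \<phi> \<psi> B = {l.
     (\<forall>g\<in>L2. \<exists>f\<in>dom_AB B. AE x in lborel. Atilde \<phi> \<psi> f x - l * f x = g x) \<and>
     (\<forall>f\<in>dom_AB B. (AE x in lborel. Atilde \<phi> \<psi> f x - l * f x = 0) \<longrightarrow>
        (AE x in lborel. f x = 0)) \<and>
     (\<exists>C. \<forall>f\<in>dom_AB B. L2_norm f \<le> C * L2_norm (\<lambda>x. Atilde \<phi> \<psi> f x - l * f x))}"

text \<open>For \<open>l\<close> in the resolvent set the solution exists and is unique up to null functions.\<close>

definition sol_op ::
    "(real \<Rightarrow> complex) \<Rightarrow> (real \<Rightarrow> complex) \<Rightarrow> complex \<Rightarrow> complex \<Rightarrow> complex \<Rightarrow> (real \<Rightarrow> complex)" where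
  "sol_op \<phi> \<psi> l B f = (SOME u. u \<in> mdom \<and>
     (AE x in lborel. Atilde \<phi> \<psi> u x - l * u x = 0) \<and> Gamma1 u - B * Gamma2 u = f)"

definition detectable ::
    "(real \<Rightarrow> complex) \<Rightarrow> (real \<Rightarrow> complex) \<Rightarrow> (real \<Rightarrow> complex) set" where
  "detectable \<phi> \<psi> = closed_span (\<Union>B. \<Union>l\<in>resolvent_set \<phi> \<psi> B. range (sol_op \<phi> \<psi> l B))"


definition D_fun :: "(real \<Rightarrow> complex) \<Rightarrow> (real \<Rightarrow> complex) \<Rightarrow> complex \<Rightarrow> complex" where
  "D_fun \<phi> \<psi> l = 1 + (LINT x|lborel. \<psi> x * cnj (\<phi> x) / (of_real x - l))"

text \<open>Requiring \<open>nicely_meromorphic_on\<close> (removable singularities removed, value 0 at poles) makes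
  the meromorphic continuation of \<open>D\<close> from the upper half-plane unique as a total function.\<close>

definition is_D_plus ::
    "(real \<Rightarrow> complex) \<Rightarrow> (real \<Rightarrow> complex) \<Rightarrow> (complex \<Rightarrow> complex) \<Rightarrow> bool" where
  "is_D_plus \<phi> \<psi> G \<longleftrightarrow>
     G nicely_meromorphic_on UNIV \<and> (\<forall>\<mu>. Im \<mu> > 0 \<longrightarrow> G \<mu> = D_fun \<phi> \<psi> \<mu>)"

definition D_plus :: "(real \<Rightarrow> complex) \<Rightarrow> (real \<Rightarrow> complex) \<Rightarrow> complex \<Rightarrow> complex" where
  "D_plus \<phi> \<psi> = (THE G. is_D_plus \<phi> \<psi> G)"

definition lower_poles ::
    "(real \<Rightarrow> complex) \<Rightarrow> (real \<Rightarrow> complex) \<Rightarrow> complex set \<Rightarrow> complex set" where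
  "lower_poles \<phi> \<psi> Z =
     {\<mu>. Im \<mu> < 0 \<and> \<mu> \<notin> Z \<and> is_pole (\<lambda>w. hardy_bar \<phi> w / D_plus \<phi> \<psi> w) \<mu>}"

definition lower_order :: "(real \<Rightarrow> complex) \<Rightarrow> (real \<Rightarrow> complex) \<Rightarrow> complex \<Rightarrow> nat" where
  "lower_order \<phi> \<psi> \<mu> = nat (- zorder (\<lambda>w. hardy_bar \<phi> w / D_plus \<phi> \<psi> w) \<mu>)"

definition sq_integrable_near :: "(real \<Rightarrow> complex) \<Rightarrow> real \<Rightarrow> bool" where
  "sq_integrable_near f x0 \<longleftrightarrow>
     (\<exists>\<epsilon>>0. set_integrable lborel {x0 - \<epsilon><..<x0 + \<epsilon>} (\<lambda>x. (norm (f x))\<^sup>2))"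

definition real_order :: "(real \<Rightarrow> complex) \<Rightarrow> (real \<Rightarrow> complex) \<Rightarrow> real \<Rightarrow> nat" where
  "real_order \<phi> \<psi> x0 = (LEAST m. sq_integrable_near
     (\<lambda>x. (of_real (x - x0)) ^ m * cnj (\<phi> x) / D_plus \<phi> \<psi> (of_real x)) x0)"

definition real_poles :: "(real \<Rightarrow> complex) \<Rightarrow> (real \<Rightarrow> complex) \<Rightarrow> real set" where
  "real_poles \<phi> \<psi> = {x. real_order \<phi> \<psi> x \<noteq> 0}"

definition M0_quot ::
    "(real \<Rightarrow> complex) \<Rightarrow> (real \<Rightarrow> complex) \<Rightarrow> complex \<Rightarrow> complex \<Rightarrow> complex \<Rightarrow> complex" where
  "M0_quot \<phi> \<psi> c z \<mu> =
     2 * of_real pi * \<i> * hardy_bar \<phi> \<mu> * c / (D_plus \<phi> \<psi> \<mu> * (\<mu> - z))"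

text \<open>
  The number \<open>M\<^sub>0\<close> refers to the limits of \<open>M0_quot\<close> at those \<open>z j\<close> where the extension of
  \<open>cnj \<circ> \<phi>\<close> vanishes. These limits have to exist in \<open>\<complex>\<close>: if \<open>D\<^sub>+\<close> also vanishes at such a \<open>z j\<close>,
  to at least the same order, the quotient has a pole there and the dimension formula fails.
  Example: \<open>N = 2\<close>, \<open>hardy_bar \<phi> \<mu> = (\<mu> - z 1) / (\<mu> - \<i>)\<^sup>2\<close> and \<open>c 2\<close> chosen such that
  \<open>D\<^sub>+ \<mu> = (\<mu> - z 1) / (\<mu> - z 2)\<close>; then the orthogonal complement is zero, whereas
  \<open>P = M = 0\<close> and \<open>M\<^sub>0\<close> is at most 1.
\<close>

definition M0_limits_exist ::
    "(real \<Rightarrow> complex) \<Rightarrow> (real \<Rightarrow> complex) \<Rightarrow> nat \<Rightarrow> (nat \<Rightarrow> complex) \<Rightarrow> (nat \<Rightarrow> complex) \<Rightarrow> bool" where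
  "M0_limits_exist \<phi> \<psi> N c z \<longleftrightarrow>
     (\<forall>j\<in>{1..N}. hardy_bar \<phi> (z j) = 0 \<longrightarrow> (\<exists>L. (M0_quot \<phi> \<psi> (c j) (z j) \<longlongrightarrow> L) (at (z j))))"

definition M0_number ::
    "(real \<Rightarrow> complex) \<Rightarrow> (real \<Rightarrow> complex) \<Rightarrow> nat \<Rightarrow> (nat \<Rightarrow> complex) \<Rightarrow> (nat \<Rightarrow> complex) \<Rightarrow> nat" where
  "M0_number \<phi> \<psi> N c z =
     card {j \<in> {1..N}. hardy_bar \<phi> (z j) = 0 \<and> Lim (at (z j)) (M0_quot \<phi> \<psi> (c j) (z j)) \<noteq> 1}"

end

theory Submission
  imports Defs "HOL-Real_Asymp.Real_Asymp" "HOL-Computational_Algebra.Fundamental_Theorem_Algebra"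
begin

text \<open>
  For nonreal \<open>\<mu>\<close> the kernel of the model operator minus \<open>\<mu>\<close> consists of the functions
  \<open>(c - s \<psi>) / (x - \<mu>)\<close> with \<open>s D(\<mu>) = c \<integral> cnj \<phi> / (x - \<mu>)\<close>. By Cauchy's formula that integral
  is \<open>0\<close> in the upper half-plane and \<open>- 2 \<pi> \<i> hardy_bar \<phi> \<mu>\<close> in the lower one, which yields the two
  families of generators; the zeros of \<open>D\<close> are reached by continuity in \<open>\<mu>\<close>.

  For rational \<open>\<psi>\<close>, a function \<open>g\<close> is orthogonal to the generators iff \<open>w = cnj g\<close> extends to a Hardy
  function \<open>W\<close> of the lower half-plane with \<open>p W = r F\<close>. Here \<open>F\<close> extends \<open>cnj \<phi>\<close>, \<open>p\<close> is the
  numerator of \<open>D\<^sub>+\<close>, of degree \<open>N\<close>, and \<open>r\<close> is a polynomial of degree below \<open>N\<close> determined by the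
  values of \<open>W\<close> at the poles \<open>z\<^sub>j\<close>. Such a \<open>W\<close> exists iff \<open>r\<close> is divisible by the polynomial \<open>m\<close> whose
  zeros are the poles of \<open>F / D\<^sub>+\<close> (in the lower half-plane and on the line) and the \<open>z\<^sub>j\<close> counted by
  \<open>M\<^sub>0\<close>. So the dimension is \<open>N - degree m\<close>.
\<close>

section \<open>Square integrable functions\<close>

text \<open>For rational \<open>\<psi>\<close> the function \<open>D\<close> on the lower
  half-plane, away from the poles of \<open>\<psi>\<close>, equals \<open>D_plus\<close> minus
  \<open>2 pi i F \<psi>\<close>, with \<open>F\<close> the extension of \<open>cnj \<phi>\<close>.
  In the orthogonality condition this extra term cancels against one coming from the Cauchy integral
  of \<open>\<psi> w\<close>. This is why the continuation from above governs the count although the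
  condition is posed below. The polynomial \<open>r\<close> in \<open>p W = r F\<close> is itself
  computed from \<open>W\<close>, so a solution counts only if it reproduces its own
  \<open>r\<close>. Letting the point tend to \<open>z j\<close> shows that the polynomial computed
  from \<open>W\<close> takes there the value of \<open>r\<close> times the limit of
  \<open>M0_quot\<close>. Both have degree below \<open>N\<close>, so consistency is a condition at
  the \<open>N\<close> points \<open>z j\<close>: it holds automatically where the limit is 1 and
  otherwise says that \<open>r\<close> vanishes there. This is the origin of
  \<open>M0_number\<close>. No pointwise boundary values are used. Membership in a Hardy class is
  the vanishing of a Cauchy integral, and division by a polynomial is done one linear factor at a
  time, each division being balanced by a factor \<open>x - \<i>\<close>.\<close>

lemma L2_I:
  assumes "f \<in> borel_measurable borel" "integrable lborel (\<lambda>x. (norm (f x))\<^sup>2)"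
  shows "f \<in> L2"
  using assms by (simp add: L2_def)

lemma L2_measurable [measurable_dest]: "f \<in> L2 \<Longrightarrow> f \<in> borel_measurable borel"
  by (simp add: L2_def)

lemma L2_integrable: "f \<in> L2 \<Longrightarrow> integrable lborel (\<lambda>x. (norm (f x))\<^sup>2)"
  by (simp add: L2_def)

lemma L2_bound:
  assumes "f \<in> borel_measurable borel" "g \<in> L2" "AE x in lborel. norm (f x) \<le> K * norm (g x)"
  shows "f \<in> L2"
proof (rule L2_I)
  have [measurable]: "f \<in> borel_measurable borel" "g \<in> borel_measurable borel"
    using assms by (auto intro: L2_measurable)
  show "integrable lborel (\<lambda>x. (norm (f x))\<^sup>2)"
  proof (rule Bochner_Integration.integrable_bound)
    show "integrable lborel (\<lambda>x. K\<^sup>2 * (norm (g x))\<^sup>2)"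
      using L2_integrable[OF assms(2)] by simp
    have "AE x in lborel. norm (f x) ^ 2 \<le> (K * norm (g x)) ^ 2"
      using assms(3) by eventually_elim (intro power_mono, auto)
    then show "AE x in lborel. norm ((norm (f x))\<^sup>2) \<le> norm (K\<^sup>2 * (norm (g x))\<^sup>2)"
      by (simp add: power_mult_distrib)
  qed measurable
qed (fact assms)

lemma L2_cmult [intro]: "f \<in> L2 \<Longrightarrow> (\<lambda>x. a * f x) \<in> L2"
  by (rule L2_bound[where g=f and K="norm a"]) (auto simp: norm_mult)

lemma L2_cnj [intro]: "f \<in> L2 \<Longrightarrow> (\<lambda>x. cnj (f x)) \<in> L2"
proof (rule L2_bound[where g=f and K=1])
  assume [measurable]: "f \<in> L2"
  have "cnj \<in> borel_measurable borel"
    by (intro borel_measurable_continuous_onI continuous_intros)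
  from measurable_compose[OF L2_measurable this]
  show "(\<lambda>x. cnj (f x)) \<in> borel_measurable borel" by simp
qed auto

lemma L2_add [intro]:
  assumes "f \<in> L2" "g \<in> L2" shows "(\<lambda>x. f x + g x) \<in> L2"
proof (rule L2_I)
  have [measurable]: "f \<in> borel_measurable borel" "g \<in> borel_measurable borel"
    using assms by (auto intro: L2_measurable)
  show "integrable lborel (\<lambda>x. (norm (f x + g x))\<^sup>2)"
  proof (rule Bochner_Integration.integrable_bound)
    show "integrable lborel (\<lambda>x. 2 * (norm (f x))\<^sup>2 + 2 * (norm (g x))\<^sup>2)"
      using assms by (intro Bochner_Integration.integrable_add integrable_mult_right L2_integrable)
    show "AE x in lborel. norm ((norm (f x + g x))\<^sup>2)
        \<le> norm (2 * (norm (f x))\<^sup>2 + 2 * (norm (g x))\<^sup>2)"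
    proof (intro AE_I2)
      fix x
      have "(norm (f x + g x))\<^sup>2 \<le> (norm (f x) + norm (g x))\<^sup>2"
        by (intro power_mono norm_triangle_ineq) auto
      also have "\<dots> \<le> 2 * (norm (f x))\<^sup>2 + 2 * (norm (g x))\<^sup>2"
        using sum_squares_bound[of "norm (f x)" "norm (g x)"] by (simp add: power2_sum)
      finally show "norm ((norm (f x + g x))\<^sup>2)
          \<le> norm (2 * (norm (f x))\<^sup>2 + 2 * (norm (g x))\<^sup>2)" by simp
    qed
  qed measurable
  show "(\<lambda>x. f x + g x) \<in> borel_measurable borel" by measurable
qed

lemma L2_zero [intro, simp]: "(\<lambda>x. 0) \<in> L2"
  by (rule L2_I) auto

lemma L2_uminus [intro]: "f \<in> L2 \<Longrightarrow> (\<lambda>x. - f x) \<in> L2"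
  using L2_cmult[of f "-1"] by simp

lemma L2_diff [intro]: "f \<in> L2 \<Longrightarrow> g \<in> L2 \<Longrightarrow> (\<lambda>x. f x - g x) \<in> L2"
  using L2_add[of f "\<lambda>x. - g x"] L2_uminus[of g] by simp

lemma L2_AE_cong:
  assumes "f \<in> L2" "g \<in> borel_measurable borel" "AE x in lborel. f x = g x"
  shows "g \<in> L2"
  using assms by (intro L2_bound[where f=g and g=f and K=1]) auto

lemma L2_mult_bounded:
  assumes "f \<in> L2" "g \<in> borel_measurable borel" "\<And>x. norm (g x) \<le> K"
  shows "(\<lambda>x. g x * f x) \<in> L2"
proof (rule L2_bound[where K=K and g=f])
  have [measurable]: "f \<in> borel_measurable borel" "g \<in> borel_measurable borel"
    using assms by (auto intro: L2_measurable)
  show "(\<lambda>x. g x * f x) \<in> borel_measurable borel" by measurable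
  show "AE x in lborel. norm (g x * f x) \<le> K * norm (f x)"
    using assms by (auto simp: norm_mult intro!: mult_right_mono)
qed (fact assms)

lemma L2_mult_integrable:
  assumes "f \<in> L2" "g \<in> L2"
  shows "integrable lborel (\<lambda>x. f x * g x)"
proof (rule Bochner_Integration.integrable_bound)
  have [measurable]: "f \<in> borel_measurable borel" "g \<in> borel_measurable borel"
    using assms by (auto intro: L2_measurable)
  show "integrable lborel (\<lambda>x. (norm (f x))\<^sup>2 + (norm (g x))\<^sup>2)"
    using assms by (intro Bochner_Integration.integrable_add L2_integrable)
  show "(\<lambda>x. f x * g x) \<in> borel_measurable lborel" by measurable
  show "AE x in lborel. norm (f x * g x) \<le> norm ((norm (f x))\<^sup>2 + (norm (g x))\<^sup>2)"
  proof (intro AE_I2)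
    fix x
    show "norm (f x * g x) \<le> norm ((norm (f x))\<^sup>2 + (norm (g x))\<^sup>2)"
      using sum_squares_bound[of "norm (f x)" "norm (g x)"]
        mult_nonneg_nonneg[OF norm_ge_zero norm_ge_zero, of "f x" "g x"]
      unfolding norm_mult real_norm_def by linarith
  qed
qed

section \<open>Norm, Cauchy-Schwarz inequality and inner product\<close>

lemma L2_norm_nonneg [simp]: "L2_norm f \<ge> 0"
  by (simp add: L2_norm_def)

lemma L2_norm_power2: "(L2_norm f)\<^sup>2 = (LINT x|lborel. (norm (f x))\<^sup>2)"
  by (simp add: L2_norm_def)

lemma L2_Cauchy_Schwarz:
  assumes "f \<in> L2" "g \<in> L2"
  shows "(LINT x|lborel. norm (f x * g x)) \<le> L2_norm f * L2_norm g"
proof -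
  have [measurable]: "f \<in> borel_measurable borel" "g \<in> borel_measurable borel"
    using assms by (auto intro: L2_measurable)
  have "ennreal (LINT x|lborel. norm (f x * g x)) = (\<integral>\<^sup>+x. ennreal (norm (f x * g x)) \<partial>lborel)"
    using L2_mult_integrable[OF assms] by (intro nn_integral_eq_integral[symmetric]) auto
  also have "\<dots> = (\<integral>\<^sup>+x. ennreal (norm (f x)) * ennreal (norm (g x)) \<partial>lborel)"
    by (simp add: norm_mult ennreal_mult)
  finally have "ennreal ((LINT x|lborel. norm (f x * g x))\<^sup>2)
      = (\<integral>\<^sup>+x. ennreal (norm (f x)) * ennreal (norm (g x)) \<partial>lborel)\<^sup>2"
    by (subst ennreal_power[symmetric]) simp_all
  also have "\<dots> \<le> (\<integral>\<^sup>+x. ennreal (norm (f x)) ^ 2 \<partial>lborel) * (\<integral>\<^sup>+x. ennreal (norm (g x)) ^ 2 \<partial>lborel)"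
    by (intro Cauchy_Schwarz_nn_integral) measurable
  also have "(\<integral>\<^sup>+x. ennreal (norm (f x)) ^ 2 \<partial>lborel) = ennreal ((L2_norm f)\<^sup>2)"
    unfolding L2_norm_power2
    by (subst nn_integral_eq_integral[symmetric]) (use assms in \<open>auto simp: ennreal_power L2_integrable\<close>)
  also have "(\<integral>\<^sup>+x. ennreal (norm (g x)) ^ 2 \<partial>lborel) = ennreal ((L2_norm g)\<^sup>2)"
    unfolding L2_norm_power2
    by (subst nn_integral_eq_integral[symmetric]) (use assms in \<open>auto simp: ennreal_power L2_integrable\<close>)
  finally have "(LINT x|lborel. norm (f x * g x))\<^sup>2 \<le> (L2_norm f * L2_norm g)\<^sup>2"
    by (simp add: ennreal_mult[symmetric] power_mult_distrib)
  then show ?thesis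
    by (rule power2_le_imp_le) simp
qed

lemma L2_norm_integral_le:
  assumes "f \<in> L2" "g \<in> L2"
  shows "norm (LINT x|lborel. f x * g x) \<le> L2_norm f * L2_norm g"
  using integral_norm_bound[of lborel "\<lambda>x. f x * g x"] L2_Cauchy_Schwarz[OF assms] by linarith

lemma L2_norm_cmult: "L2_norm (\<lambda>x. a * f x) = norm a * L2_norm f"
  by (simp add: L2_norm_def norm_mult power_mult_distrib real_sqrt_mult)

lemma L2_norm_triangle:
  assumes "f \<in> L2" "g \<in> L2"
  shows "L2_norm (\<lambda>x. f x + g x) \<le> L2_norm f + L2_norm g"
proof (rule power2_le_imp_le)
  have [measurable]: "f \<in> borel_measurable borel" "g \<in> borel_measurable borel"
    using assms by (auto intro: L2_measurable)
  have "(L2_norm (\<lambda>x. f x + g x))\<^sup>2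
      \<le> (LINT x|lborel. (norm (f x))\<^sup>2 + (norm (g x))\<^sup>2 + 2 * norm (f x * g x))"
    unfolding L2_norm_power2
  proof (rule integral_mono)
    show "integrable lborel (\<lambda>x. (norm (f x + g x))\<^sup>2)"
      using assms by (intro L2_integrable L2_add)
    show "integrable lborel (\<lambda>x. (norm (f x))\<^sup>2 + (norm (g x))\<^sup>2 + 2 * norm (f x * g x))"
      using assms by (intro Bochner_Integration.integrable_add L2_integrable integrable_mult_right
          integrable_norm L2_mult_integrable)
    show "(norm (f x + g x))\<^sup>2 \<le> (norm (f x))\<^sup>2 + (norm (g x))\<^sup>2 + 2 * norm (f x * g x)" for x
      using power_mono[OF norm_triangle_ineq norm_ge_zero, of "f x" "g x" 2]
      by (simp add: power2_sum norm_mult)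
  qed
  also have "\<dots> = (L2_norm f)\<^sup>2 + (L2_norm g)\<^sup>2 + 2 * (LINT x|lborel. norm (f x * g x))"
    using assms unfolding L2_norm_power2
    by (simp add: L2_integrable L2_mult_integrable)
  also have "\<dots> \<le> (L2_norm f + L2_norm g)\<^sup>2"
    using L2_Cauchy_Schwarz[OF assms] by (simp add: power2_sum)
  finally show "(L2_norm (\<lambda>x. f x + g x))\<^sup>2 \<le> (L2_norm f + L2_norm g)\<^sup>2" .
qed simp

lemma L2_norm_mono:
  assumes "f \<in> borel_measurable borel" "g \<in> L2" "0 \<le> K" "AE x in lborel. norm (f x) \<le> K * norm (g x)"
  shows "L2_norm f \<le> K * L2_norm g"
proof (rule power2_le_imp_le)
  have f: "f \<in> L2" using assms by (intro L2_bound[of f g K])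
  have "(L2_norm f)\<^sup>2 \<le> (LINT x|lborel. K\<^sup>2 * (norm (g x))\<^sup>2)"
    unfolding L2_norm_power2
  proof (rule integral_mono_AE)
    have "AE x in lborel. norm (f x) ^ 2 \<le> (K * norm (g x)) ^ 2"
      using assms(4) by eventually_elim (intro power_mono, auto)
    then show "AE x in lborel. (norm (f x))\<^sup>2 \<le> K\<^sup>2 * (norm (g x))\<^sup>2"
      by (simp add: power_mult_distrib)
  qed (use f assms in \<open>auto simp: L2_integrable\<close>)
  also have "\<dots> = (K * L2_norm g)\<^sup>2"
    by (simp add: L2_norm_power2 power_mult_distrib)
  finally show "(L2_norm f)\<^sup>2 \<le> (K * L2_norm g)\<^sup>2" .
qed (use assms in simp)

lemma L2_norm_AE_cong:
  assumes "f \<in> borel_measurable borel" "g \<in> borel_measurable borel" "AE x in lborel. f x = g x"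
  shows "L2_norm f = L2_norm g"
proof -
  have [measurable]: "f \<in> borel_measurable borel" "g \<in> borel_measurable borel" using assms by auto
  show ?thesis
    unfolding L2_norm_def
    by (intro arg_cong[of _ _ sqrt] integral_cong_AE) (use assms in auto)
qed

lemma L2_norm_eq_0_iff:
  assumes "f \<in> L2"
  shows "L2_norm f = 0 \<longleftrightarrow> (AE x in lborel. f x = 0)"
  using integral_nonneg_eq_0_iff_AE[OF L2_integrable[OF assms]] by (simp add: L2_norm_def)

lemma L2_inner_integrable: "f \<in> L2 \<Longrightarrow> g \<in> L2 \<Longrightarrow> integrable lborel (\<lambda>x. f x * cnj (g x))"
  by (intro L2_mult_integrable L2_cnj)

lemma L2_norm_cnj [simp]: "L2_norm (\<lambda>x. cnj (f x)) = L2_norm f"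
  by (simp add: L2_norm_def)

lemma L2_norm_minus_commute: "L2_norm (\<lambda>x. f x - g x) = L2_norm (\<lambda>x. g x - f x)"
  by (simp add: L2_norm_def norm_minus_commute)

lemma L2_inner_bound: "f \<in> L2 \<Longrightarrow> g \<in> L2 \<Longrightarrow> norm (L2_inner f g) \<le> L2_norm f * L2_norm g"
  unfolding L2_inner_def using L2_norm_integral_le[of f "\<lambda>x. cnj (g x)"] by (simp add: L2_cnj)

lemma L2_inner_diff_left:
  assumes "f \<in> L2" "g \<in> L2" "h \<in> L2"
  shows "L2_inner (\<lambda>x. f x - g x) h = L2_inner f h - L2_inner g h"
  using assms by (simp add: L2_inner_def algebra_simps L2_inner_integrable)

lemma L2_inner_cong_AE:
  assumes "f \<in> L2" "g \<in> L2" "h \<in> L2" "AE x in lborel. f x = g x"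
  shows "L2_inner f h = L2_inner g h"
proof -
  have [measurable]: "f \<in> borel_measurable borel" "g \<in> borel_measurable borel"
    "(\<lambda>x. cnj (h x)) \<in> borel_measurable borel"
    using assms by (auto intro: L2_measurable)
  show ?thesis
    unfolding L2_inner_def by (intro integral_cong_AE) (use assms in auto)
qed

text \<open>The line has infinite measure. This makes \<open>coef\<close> well defined, and it later
  excludes that a multiple of \<open>\<psi>\<close> agrees almost everywhere with a nonzero
  constant.\<close>

lemma const_in_L2_iff: "(\<lambda>x. c) \<in> L2 \<longleftrightarrow> c = 0"
proof
  assume "(\<lambda>x. c) \<in> L2"
  from L2_integrable[OF this] have int: "integrable lborel (\<lambda>x::real. (norm c)\<^sup>2)" .
  show "c = 0"
  proof (rule ccontr)
    assume "c \<noteq> 0"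
    with integrable_mult_right[OF int, of "1 / (norm c)\<^sup>2"]
    have "integrable lborel (indicator UNIV :: real \<Rightarrow> real)" by (simp add: indicator_def)
    then show False unfolding integrable_indicator_iff by simp
  qed
qed auto

subsection \<open>Closed subspaces\<close>

definition L2_subspace :: "(real \<Rightarrow> complex) set \<Rightarrow> bool" where
  "L2_subspace S \<longleftrightarrow> S \<subseteq> L2 \<and> (\<lambda>x. 0) \<in> S \<and>
     (\<forall>f\<in>S. \<forall>g\<in>S. (\<lambda>x. f x + g x) \<in> S) \<and> (\<forall>a. \<forall>f\<in>S. (\<lambda>x. a * f x) \<in> S)"

text \<open>The other inclusion between a subspace and its closure is automatic. Functions at
  distance zero lie in each other's closure, so such a set is stable under measurable changes on
  null sets.\<close>

definition L2_closed_subspace :: "(real \<Rightarrow> complex) set \<Rightarrow> bool" where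
  "L2_closed_subspace S \<longleftrightarrow> L2_subspace S \<and> L2_closure S \<subseteq> S"

lemma L2_closure_superset: "S \<subseteq> L2 \<Longrightarrow> S \<subseteq> L2_closure S"
  by (auto simp: L2_closure_def L2_norm_def)

lemma L2_closure_mono: "A \<subseteq> B \<Longrightarrow> L2_closure A \<subseteq> L2_closure B"
  unfolding L2_closure_def by blast

lemma L2_closure_Int_L2: "L2_closure A = L2_closure (A \<inter> L2)"
  unfolding L2_closure_def by blast

lemma L2_subspace_closure:
  assumes "L2_subspace S"
  shows "L2_closed_subspace (L2_closure S)"
proof -
  have S: "S \<subseteq> L2" "(\<lambda>x. 0) \<in> S"
    "\<And>f g. f \<in> S \<Longrightarrow> g \<in> S \<Longrightarrow> (\<lambda>x. f x + g x) \<in> S" "\<And>a f. f \<in> S \<Longrightarrow> (\<lambda>x. a * f x) \<in> S"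
    using assms by (auto simp: L2_subspace_def)
  have add: "(\<lambda>x. f x + g x) \<in> L2_closure S" if mem: "f \<in> L2_closure S" "g \<in> L2_closure S" for f g
    unfolding L2_closure_def
  proof (intro CollectI conjI allI impI)
    have fg: "f \<in> L2" "g \<in> L2" using mem by (auto simp: L2_closure_def)
    then show "(\<lambda>x. f x + g x) \<in> L2" by blast
    fix e :: real assume "e > 0"
    then have "e/2 > 0" by simp
    then obtain f' where f': "f' \<in> S" "f' \<in> L2" "L2_norm (\<lambda>x. f x - f' x) < e/2"
      using mem(1) unfolding L2_closure_def by blast
    from \<open>e/2 > 0\<close> obtain g' where g': "g' \<in> S" "g' \<in> L2" "L2_norm (\<lambda>x. g x - g' x) < e/2"
      using mem(2) unfolding L2_closure_def by blast
    have "L2_norm (\<lambda>x. (f x + g x) - (f' x + g' x)) = L2_norm (\<lambda>x. (f x - f' x) + (g x - g' x))"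
      by (simp add: algebra_simps)
    also have "\<dots> \<le> L2_norm (\<lambda>x. f x - f' x) + L2_norm (\<lambda>x. g x - g' x)"
      using fg f' g' by (intro L2_norm_triangle L2_diff)
    also have "\<dots> < e" using f' g' by simp
    finally show "\<exists>h\<in>S. h \<in> L2 \<and> L2_norm (\<lambda>x. (f x + g x) - h x) < e"
      using S f' g' by (intro bexI[of _ "\<lambda>x. f' x + g' x"]) auto
  qed
  have scale: "(\<lambda>x. a * f x) \<in> L2_closure S" if mem: "f \<in> L2_closure S" for f a
    unfolding L2_closure_def
  proof (intro CollectI conjI allI impI)
    have f: "f \<in> L2" using mem by (auto simp: L2_closure_def)
    then show "(\<lambda>x. a * f x) \<in> L2" by blast
    fix e :: real assume "e > 0"
    then have "e / (norm a + 1) > 0" by (intro divide_pos_pos) (auto simp: add_nonneg_pos)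
    then obtain f' where f': "f' \<in> S" "f' \<in> L2" "L2_norm (\<lambda>x. f x - f' x) < e / (norm a + 1)"
      using mem unfolding L2_closure_def by blast
    have "L2_norm (\<lambda>x. a * f x - a * f' x) = norm a * L2_norm (\<lambda>x. f x - f' x)"
      by (simp add: L2_norm_cmult[symmetric] algebra_simps)
    also have "\<dots> \<le> (norm a + 1) * L2_norm (\<lambda>x. f x - f' x)"
      by (intro mult_right_mono) auto
    also have "\<dots> < e" using f'(3)
      by (subst (asm) pos_less_divide_eq) (auto simp: add_nonneg_pos mult.commute)
    finally show "\<exists>h\<in>S. h \<in> L2 \<and> L2_norm (\<lambda>x. a * f x - h x) < e"
      using S f' by (intro bexI[of _ "\<lambda>x. a * f' x"]) auto
  qed
  have clos: "L2_closure (L2_closure S) \<subseteq> L2_closure S"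
  proof
    fix f assume f: "f \<in> L2_closure (L2_closure S)"
    show "f \<in> L2_closure S" unfolding L2_closure_def
    proof (intro CollectI conjI allI impI)
      show fL: "f \<in> L2" using f by (auto simp: L2_closure_def)
      fix e :: real assume "e > 0"
      then have e: "e/2 > 0" by simp
      then obtain g where g: "g \<in> L2_closure S" "g \<in> L2" "L2_norm (\<lambda>x. f x - g x) < e/2"
        using f unfolding L2_closure_def[of "L2_closure S"] by blast
      from g(1) e obtain h where h: "h \<in> S" "h \<in> L2" "L2_norm (\<lambda>x. g x - h x) < e/2"
        unfolding L2_closure_def by blast
      have "L2_norm (\<lambda>x. f x - h x) = L2_norm (\<lambda>x. (f x - g x) + (g x - h x))" by simp
      also have "\<dots> \<le> L2_norm (\<lambda>x. f x - g x) + L2_norm (\<lambda>x. g x - h x)"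
        using fL g h by (intro L2_norm_triangle L2_diff)
      finally show "\<exists>h\<in>S. h \<in> L2 \<and> L2_norm (\<lambda>x. f x - h x) < e"
        using g h by (intro bexI[of _ h]) auto
    qed
  qed
  show ?thesis
    unfolding L2_closed_subspace_def L2_subspace_def
    using add scale clos L2_closure_superset[OF S(1)] S(2) by (auto simp: L2_closure_def)
qed

lemma L2_subspace_lincomb:
  assumes "L2_subspace S" "\<And>i. i < (n::nat) \<Longrightarrow> u i \<in> S"
  shows "(\<lambda>x. \<Sum>i<n. a i * u i x) \<in> S"
  using assms(2)
proof (induction n)
  case 0
  then show ?case using assms(1) by (simp add: L2_subspace_def)
next
  case (Suc n)
  then have "(\<lambda>x. \<Sum>i<n. a i * u i x) \<in> S" "(\<lambda>x. a n * u n x) \<in> S"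
    using assms(1) by (auto simp: L2_subspace_def)
  then show ?case using assms(1) by (auto simp: L2_subspace_def)
qed

text \<open>The elements of \<open>A\<close> need not be square integrable, hence the intersection;
  \<open>L2_closure\<close> only sees the square integrable members of its argument, so nothing is
  lost in \<open>closed_span\<close>.\<close>

lemma L2_subspace_lin_span: "L2_subspace (lin_span A \<inter> L2)"
proof -
  have add: "(\<lambda>x. f x + g x) \<in> lin_span A" if f: "f \<in> lin_span A" and g: "g \<in> lin_span A" for f g
  proof -
    obtain n a u where f: "\<forall>i<(n::nat). u i \<in> A" "f = (\<lambda>x. \<Sum>i<n. a i * u i x)"
      using f by (auto simp: lin_span_def)
    obtain m b v where g: "\<forall>i<(m::nat). v i \<in> A" "g = (\<lambda>x. \<Sum>i<m. b i * v i x)"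
      using g by (auto simp: lin_span_def)
    \<comment> \<open>Concatenation of the two combinations: indices below \<open>n\<close> belong
      to \<open>f\<close>, the later ones, shifted by \<open>n\<close>, to \<open>g\<close>.\<close>
    define c where "c i = (if i < n then a i else b (i - n))" for i
    define w where "w i = (if i < n then u i else v (i - n))" for i
    have "(\<Sum>i<n + m. c i * w i x) = f x + g x" for x
    proof -
      have "(\<Sum>i<n + m. c i * w i x) = (\<Sum>i<n. c i * w i x) + (\<Sum>i\<in>{n..<n+m}. c i * w i x)"
        by (subst sum.union_disjoint[symmetric]) (auto intro!: sum.cong)
      also have "(\<Sum>i\<in>{n..<n+m}. c i * w i x) = (\<Sum>i<m. c (i+n) * w (i+n) x)"
        using sum.shift_bounds_nat_ivl[of "\<lambda>i. c i * w i x" 0 n m]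
        by (simp add: atLeast0LessThan add.commute)
      finally show ?thesis by (simp add: c_def w_def f g)
    qed
    moreover have "\<forall>i<n+m. w i \<in> A" using f g by (auto simp: w_def)
    ultimately show ?thesis unfolding lin_span_def
      by (intro CollectI exI[of _ "n+m"] exI[of _ c] exI[of _ w]) (auto simp: fun_eq_iff)
  qed
  have scale: "(\<lambda>x. s * f x) \<in> lin_span A" if f: "f \<in> lin_span A" for f s
  proof -
    obtain n a u where f: "\<forall>i<(n::nat). u i \<in> A" "f = (\<lambda>x. \<Sum>i<n. a i * u i x)"
      using f by (auto simp: lin_span_def)
    then show ?thesis unfolding lin_span_def
      by (intro CollectI exI[of _ n] exI[of _ "\<lambda>i. s * a i"] exI[of _ u])
        (auto simp: fun_eq_iff sum_distrib_left mult.assoc)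
  qed
  have "(\<lambda>x. 0) \<in> lin_span A"
    unfolding lin_span_def by (intro CollectI exI[of _ 0]) auto
  then show ?thesis using add scale by (auto simp: L2_subspace_def)
qed

lemma L2_closed_subspace_closed_span: "L2_closed_subspace (closed_span A)"
  unfolding closed_span_def
  by (subst L2_closure_Int_L2) (intro L2_subspace_closure L2_subspace_lin_span)

lemma lin_span_superset: "A \<subseteq> lin_span A"
proof
  fix f assume "f \<in> A"
  then show "f \<in> lin_span A" unfolding lin_span_def
    by (intro CollectI exI[of _ 1] exI[of _ "\<lambda>_. 1"] exI[of _ "\<lambda>_. f"]) auto
qed

lemma closed_span_superset: "f \<in> A \<Longrightarrow> f \<in> L2 \<Longrightarrow> f \<in> closed_span A"
  unfolding closed_span_def
  using L2_closure_superset[of "lin_span A \<inter> L2"] lin_span_superset[of A]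
  by (subst L2_closure_Int_L2) auto

lemma closed_span_subset:
  assumes "L2_closed_subspace S" "A \<subseteq> S"
  shows "closed_span A \<subseteq> S"
proof -
  have "lin_span A \<subseteq> S"
    unfolding lin_span_def using assms by (auto simp: L2_closed_subspace_def intro!: L2_subspace_lincomb)
  from L2_closure_mono[OF this] show ?thesis
    using assms(1) by (auto simp: closed_span_def L2_closed_subspace_def)
qed

lemma L2_subspace_sum:
  assumes "L2_subspace A" "L2_subspace B"
  shows "L2_subspace (fun_set_sum A B)"
proof -
  have add: "(\<lambda>x. f x + g x) \<in> fun_set_sum A B" if mem: "f \<in> fun_set_sum A B" "g \<in> fun_set_sum A B" for f g
  proof -
    obtain a b where f: "a \<in> A" "b \<in> B" "f = (\<lambda>x. a x + b x)" using mem(1) by (auto simp: fun_set_sum_def)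
    obtain c d where g: "c \<in> A" "d \<in> B" "g = (\<lambda>x. c x + d x)" using mem(2) by (auto simp: fun_set_sum_def)
    show ?thesis unfolding fun_set_sum_def
      by (intro CollectI exI[of _ "\<lambda>x. a x + c x"] exI[of _ "\<lambda>x. b x + d x"])
        (use assms f g in \<open>auto simp: L2_subspace_def algebra_simps\<close>)
  qed
  have scale: "(\<lambda>x. s * f x) \<in> fun_set_sum A B" if mem: "f \<in> fun_set_sum A B" for f s
  proof -
    obtain a b where f: "a \<in> A" "b \<in> B" "f = (\<lambda>x. a x + b x)" using mem by (auto simp: fun_set_sum_def)
    show ?thesis unfolding fun_set_sum_def
      by (intro CollectI exI[of _ "\<lambda>x. s * a x"] exI[of _ "\<lambda>x. s * b x"])
        (use assms f in \<open>auto simp: L2_subspace_def algebra_simps\<close>)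
  qed
  have "(\<lambda>x. 0) \<in> fun_set_sum A B"
    unfolding fun_set_sum_def
    by (intro CollectI exI[of _ "\<lambda>x. 0"]) (use assms in \<open>auto simp: L2_subspace_def\<close>)
  moreover have "fun_set_sum A B \<subseteq> L2"
    using assms by (auto simp: fun_set_sum_def L2_subspace_def)
  ultimately show ?thesis using add scale by (auto simp: L2_subspace_def)
qed

lemma closed_subspace_sum_superset:
  assumes "L2_subspace A" "L2_subspace B"
  shows "A \<subseteq> L2_closure (fun_set_sum A B)" "B \<subseteq> L2_closure (fun_set_sum A B)"
proof -
  have 1: "fun_set_sum A B \<subseteq> L2_closure (fun_set_sum A B)"
    using L2_subspace_sum[OF assms] by (intro L2_closure_superset) (auto simp: L2_subspace_def)
  have "A \<subseteq> fun_set_sum A B"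
  proof
    fix f assume "f \<in> A"
    then show "f \<in> fun_set_sum A B" unfolding fun_set_sum_def using assms
      by (intro CollectI exI[of _ f] exI[of _ "\<lambda>x. 0"]) (auto simp: L2_subspace_def)
  qed
  with 1 show "A \<subseteq> L2_closure (fun_set_sum A B)" by blast
  have "B \<subseteq> fun_set_sum A B"
  proof
    fix f assume "f \<in> B"
    then show "f \<in> fun_set_sum A B" unfolding fun_set_sum_def using assms
      by (intro CollectI exI[of _ "\<lambda>x. 0"] exI[of _ f]) (auto simp: L2_subspace_def)
  qed
  with 1 show "B \<subseteq> L2_closure (fun_set_sum A B)" by blast
qed

section \<open>Cauchy integrals\<close>

lemma norm_real_minus_ge: "norm (of_real x - \<mu>) \<ge> \<bar>Im \<mu>\<bar>"
  using abs_Im_le_cmod[of "of_real x - \<mu>"] by simp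

lemma real_minus_nonzero: "Im \<mu> \<noteq> 0 \<Longrightarrow> of_real x - \<mu> \<noteq> 0"
  using norm_real_minus_ge[of \<mu> x] by auto

lemma norm_inverse_real_minus_le: "Im \<mu> \<noteq> 0 \<Longrightarrow> norm (1 / (of_real x - \<mu>)) \<le> 1 / \<bar>Im \<mu>\<bar>"
  using norm_real_minus_ge[of \<mu> x] by (auto simp: norm_divide divide_simps)

text \<open>The integrand is the squared modulus of the resolvent kernel
  \<open>1 / (x - \<mu>)\<close> for \<open>\<mu> = a + \<i> b\<close>, so this gives its norm. A
  rescaled arctangent is a primitive with finite limits at both ends.\<close>

lemma integral_inverse_quadratic:
  fixes a b :: real
  assumes "b > 0"
  shows "integrable lborel (\<lambda>x. 1 / ((x - a)\<^sup>2 + b\<^sup>2))"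
    and "(LINT x|lborel. 1 / ((x - a)\<^sup>2 + b\<^sup>2)) = pi / b"
proof -
  define F where "F x = arctan ((x - a) / b) / b" for x
  have nz: "(x - a)\<^sup>2 + b\<^sup>2 \<noteq> 0" for x
    using assms by (smt (verit) zero_le_power2 zero_less_power)
  have deriv: "(F has_real_derivative 1 / ((x - a)\<^sup>2 + b\<^sup>2)) (at x)" for x
  proof -
    have "(F has_real_derivative (inverse (1 + ((x - a) / b)\<^sup>2) * (1 / b)) / b) (at x)"
      unfolding F_def using assms by (auto intro!: derivative_eq_intros)
    also have "(inverse (1 + ((x - a) / b)\<^sup>2) * (1 / b)) / b = 1 / ((x - a)\<^sup>2 + b\<^sup>2)"
    proof -
      have "1 + ((x - a) / b)\<^sup>2 = ((x - a)\<^sup>2 + b\<^sup>2) / b\<^sup>2"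
        using assms by (simp add: power_divide add_divide_distrib)
      then show ?thesis using assms nz[of x] by (simp add: power2_eq_square)
    qed
    finally show ?thesis .
  qed
  have cont: "isCont (\<lambda>x. 1 / ((x - a)\<^sup>2 + b\<^sup>2)) x" for x
    using nz[of x] by (intro continuous_intros) auto
  have lin: "filterlim (\<lambda>x. (x - a) / b) at_top at_top" "filterlim (\<lambda>x. (x - a) / b) at_bot at_bot"
    using assms by real_asymp+
  have top: "(F \<longlongrightarrow> (pi / 2) / b) at_top"
    unfolding F_def using assms
    by (intro tendsto_divide tendsto_const filterlim_compose[OF tendsto_arctan_at_top lin(1)]) auto
  have bot: "(F \<longlongrightarrow> (- pi / 2) / b) at_bot"
    unfolding F_def using assms
    by (intro tendsto_divide tendsto_const filterlim_compose[OF _ lin(2)])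
       (use tendsto_arctan_at_bot in auto)
  have *: "set_integrable lborel (einterval (-\<infinity>) \<infinity>) (\<lambda>x. 1 / ((x - a)\<^sup>2 + b\<^sup>2))"
    "(LBINT x=-\<infinity>..\<infinity>. 1 / ((x - a)\<^sup>2 + b\<^sup>2)) = (pi / 2) / b - (- pi / 2) / b"
    by (rule interval_integral_FTC_nonneg[where F=F and A="(- pi / 2) / b" and B = "(pi / 2) / b"];
        use deriv cont top bot in \<open>simp add: ereal_tendsto_simps\<close>)+
  show "integrable lborel (\<lambda>x. 1 / ((x - a)\<^sup>2 + b\<^sup>2))"
    using *(1) by (simp add: set_integrable_def einterval_eq)
  show "(LINT x|lborel. 1 / ((x - a)\<^sup>2 + b\<^sup>2)) = pi / b"
    using *(2) by (simp add: interval_lebesgue_integral_def set_lebesgue_integral_def einterval_eq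
        field_simps)
qed

lemma norm_resolvent_power2:
  "(norm (1 / (of_real x - \<mu>)))\<^sup>2 = 1 / ((x - Re \<mu>)\<^sup>2 + \<bar>Im \<mu>\<bar>\<^sup>2)"
  by (simp add: norm_divide power_divide cmod_power2)

lemma resolvent_L2 [intro]:
  assumes "Im \<mu> \<noteq> 0"
  shows "(\<lambda>x. 1 / (of_real x - \<mu>)) \<in> L2"
proof (rule L2_I)
  show "(\<lambda>x. 1 / (of_real x - \<mu>)) \<in> borel_measurable borel" by measurable
  show "integrable lborel (\<lambda>x. (norm (1 / (of_real x - \<mu>)))\<^sup>2)"
    unfolding norm_resolvent_power2 using assms by (intro integral_inverse_quadratic) auto
qed

lemma L2_norm_resolvent:
  assumes "Im \<mu> \<noteq> 0"
  shows "L2_norm (\<lambda>x. 1 / (of_real x - \<mu>)) = sqrt (pi / \<bar>Im \<mu>\<bar>)"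
  unfolding L2_norm_def norm_resolvent_power2 using assms
  by (subst integral_inverse_quadratic) auto

lemma L2_divide_resolvent [intro]:
  assumes "f \<in> L2" "Im \<mu> \<noteq> 0"
  shows "(\<lambda>x. f x / (of_real x - \<mu>)) \<in> L2"
  using L2_mult_bounded[OF assms(1), of "\<lambda>x. 1 / (of_real x - \<mu>)" "1 / \<bar>Im \<mu>\<bar>"]
    norm_inverse_real_minus_le[OF assms(2)] by simp

lemma L2_norm_divide_resolvent:
  assumes "f \<in> L2" "Im \<mu> \<noteq> 0"
  shows "L2_norm (\<lambda>x. f x / (of_real x - \<mu>)) \<le> 1 / \<bar>Im \<mu>\<bar> * L2_norm f"
proof (rule L2_norm_mono)
  show "(\<lambda>x. f x / (of_real x - \<mu>)) \<in> borel_measurable borel"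
    using L2_divide_resolvent[OF assms] by (rule L2_measurable)
  have "norm (f x) * norm (1 / (of_real x - \<mu>)) \<le> norm (f x) * (1 / \<bar>Im \<mu>\<bar>)" for x
    using norm_inverse_real_minus_le[OF assms(2)] by (intro mult_left_mono) auto
  then show "AE x in lborel. norm (f x / (of_real x - \<mu>)) \<le> 1 / \<bar>Im \<mu>\<bar> * norm (f x)"
    by (simp add: norm_divide)
qed (use assms in auto)

lemma L2_divide_resolvent_integrable:
  assumes "f \<in> L2" "Im \<mu> \<noteq> 0"
  shows "integrable lborel (\<lambda>x. f x / (of_real x - \<mu>))"
  using L2_mult_integrable[OF assms(1) resolvent_L2[OF assms(2)]] by simp

section \<open>Cauchy integrals: bounds, resolvent identity, holomorphy\<close>

definition cauchy_int :: "(real \<Rightarrow> complex) \<Rightarrow> complex \<Rightarrow> complex" where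
  "cauchy_int h \<mu> = (LINT x|lborel. h x / (of_real x - \<mu>))"

text \<open>Common ground for two kinds of densities: square integrable ones, and products such as
  \<open>\<psi> x * cnj (\<phi> x)\<close>, which are only integrable.\<close>

definition cauchy_integrable :: "(real \<Rightarrow> complex) \<Rightarrow> bool" where
  "cauchy_integrable h \<longleftrightarrow> (\<forall>\<mu>. Im \<mu> \<noteq> 0 \<longrightarrow> integrable lborel (\<lambda>x. h x / (of_real x - \<mu>)))"

lemma cauchy_integrable_L2 [intro]: "f \<in> L2 \<Longrightarrow> cauchy_integrable f"
  unfolding cauchy_integrable_def using L2_divide_resolvent_integrable by blast

lemma integrable_divide_resolvent:
  fixes f :: "real \<Rightarrow> complex"
  assumes "integrable lborel f" "Im \<mu> \<noteq> 0"
  shows "integrable lborel (\<lambda>x. f x / (of_real x - \<mu>))"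
    and "(LINT x|lborel. norm (f x / (of_real x - \<mu>))) \<le> (LINT x|lborel. norm (f x)) / \<bar>Im \<mu>\<bar>"
proof -
  have [measurable]: "f \<in> borel_measurable borel" using assms by auto
  have le: "norm (f x / (of_real x - \<mu>)) \<le> norm (f x) / \<bar>Im \<mu>\<bar>" for x
  proof -
    have "norm (f x) * norm (1 / (of_real x - \<mu>)) \<le> norm (f x) * (1 / \<bar>Im \<mu>\<bar>)" for x
      using norm_inverse_real_minus_le[OF assms(2)] by (intro mult_left_mono) auto
    then show ?thesis by (simp add: norm_divide)
  qed
  show int: "integrable lborel (\<lambda>x. f x / (of_real x - \<mu>))"
    by (rule Bochner_Integration.integrable_bound[where f="\<lambda>x. norm (f x) / \<bar>Im \<mu>\<bar>"])
       (use assms le in auto)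
  have "(LINT x|lborel. norm (f x / (of_real x - \<mu>))) \<le> (LINT x|lborel. norm (f x) / \<bar>Im \<mu>\<bar>)"
    by (rule integral_mono) (use int assms le in auto)
  then show "(LINT x|lborel. norm (f x / (of_real x - \<mu>))) \<le> (LINT x|lborel. norm (f x)) / \<bar>Im \<mu>\<bar>"
    by simp
qed

lemma cauchy_integrable_L1 [intro]: "integrable lborel h \<Longrightarrow> cauchy_integrable h"
  unfolding cauchy_integrable_def using integrable_divide_resolvent by blast

lemma cauchy_int_bound_L1:
  assumes "integrable lborel f" "Im \<mu> \<noteq> 0"
  shows "norm (cauchy_int f \<mu>) \<le> (LINT x|lborel. norm (f x)) / \<bar>Im \<mu>\<bar>"
  unfolding cauchy_int_def
  using integral_norm_bound[of lborel "\<lambda>x. f x / (of_real x - \<mu>)"]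
    integrable_divide_resolvent(2)[OF assms] by linarith

lemma cauchy_int_bound_L2:
  assumes "f \<in> L2" "Im \<mu> \<noteq> 0"
  shows "norm (cauchy_int f \<mu>) \<le> L2_norm f * sqrt (pi / \<bar>Im \<mu>\<bar>)"
  using L2_norm_integral_le[OF assms(1) resolvent_L2[OF assms(2)]] L2_norm_resolvent[OF assms(2)]
  by (simp add: cauchy_int_def)

lemma cauchy_int_cong_AE:
  assumes "f \<in> borel_measurable borel" "g \<in> borel_measurable borel" "AE x in lborel. f x = g x"
  shows "cauchy_int f \<mu> = cauchy_int g \<mu>"
proof -
  have [measurable]: "f \<in> borel_measurable borel" "g \<in> borel_measurable borel" using assms by auto
  show ?thesis unfolding cauchy_int_def by (intro integral_cong_AE) (use assms in auto)
qed

lemma cauchy_int_cmult: "cauchy_int (\<lambda>x. a * f x) \<mu> = a * cauchy_int f \<mu>"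
  unfolding cauchy_int_def times_divide_eq_right[symmetric] by (rule integral_mult_right_zero)

lemma cauchy_int_add:
  assumes "cauchy_integrable f" "cauchy_integrable g" "Im \<mu> \<noteq> 0"
  shows "cauchy_int (\<lambda>x. f x + g x) \<mu> = cauchy_int f \<mu> + cauchy_int g \<mu>"
  using assms by (simp add: cauchy_int_def cauchy_integrable_def add_divide_distrib)

lemma cauchy_int_diff:
  assumes "cauchy_integrable f" "cauchy_integrable g" "Im \<mu> \<noteq> 0"
  shows "cauchy_int (\<lambda>x. f x - g x) \<mu> = cauchy_int f \<mu> - cauchy_int g \<mu>"
  using assms by (simp add: cauchy_int_def cauchy_integrable_def diff_divide_distrib)

lemma cauchy_int_sum:
  assumes "\<And>i. i \<in> I \<Longrightarrow> cauchy_integrable (f i)" "Im \<mu> \<noteq> 0"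
  shows "cauchy_int (\<lambda>x. \<Sum>i\<in>I. f i x) \<mu> = (\<Sum>i\<in>I. cauchy_int (f i) \<mu>)"
  using assms by (simp add: cauchy_int_def cauchy_integrable_def sum_divide_distrib)

lemma resolvent_identity:
  assumes "Im \<mu> \<noteq> 0" "Im \<nu> \<noteq> 0"
  shows "y / (of_real x - \<nu>) - y / (of_real x - \<mu>)
    = (\<nu> - \<mu>) * ((y / (of_real x - \<mu>)) / (of_real x - \<nu>))"
  using real_minus_nonzero[OF assms(1), of x] real_minus_nonzero[OF assms(2), of x]
  by (simp add: field_simps)

text \<open>The difference of two values of a Cauchy integral is again a Cauchy integral.
  Continuity, the derivative and all divisions by linear factors below rest on this
  identity.\<close>

lemma cauchy_int_resolvent_identity:
  assumes "cauchy_integrable h" "Im \<mu> \<noteq> 0" "Im \<nu> \<noteq> 0"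
  shows "cauchy_int h \<nu> - cauchy_int h \<mu> = (\<nu> - \<mu>) * cauchy_int (\<lambda>x. h x / (of_real x - \<mu>)) \<nu>"
proof -
  have "cauchy_int h \<nu> - cauchy_int h \<mu>
      = (LINT x|lborel. h x / (of_real x - \<nu>) - h x / (of_real x - \<mu>))"
    using assms by (simp add: cauchy_int_def cauchy_integrable_def)
  also have "\<dots> = (\<nu> - \<mu>) * cauchy_int (\<lambda>x. h x / (of_real x - \<mu>)) \<nu>"
    unfolding resolvent_identity[OF assms(2,3)] cauchy_int_def by (rule integral_mult_right_zero)
  finally show ?thesis .
qed

lemma cauchy_int_divide:
  assumes "cauchy_integrable h" "Im \<mu> \<noteq> 0" "Im \<nu> \<noteq> 0" "\<nu> \<noteq> \<mu>"
  shows "cauchy_int (\<lambda>x. h x / (of_real x - \<mu>)) \<nu> = (cauchy_int h \<nu> - cauchy_int h \<mu>) / (\<nu> - \<mu>)"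
  using cauchy_int_resolvent_identity[OF assms(1-3)] assms(4) by simp

lemma cauchy_integrable_divide:
  "cauchy_integrable h \<Longrightarrow> Im \<mu> \<noteq> 0 \<Longrightarrow> integrable lborel (\<lambda>x. h x / (of_real x - \<mu>))"
  by (simp add: cauchy_integrable_def)

lemma eventually_Im_ge:
  assumes "Im \<mu> \<noteq> 0"
  shows "eventually (\<lambda>\<nu>. \<bar>Im \<nu>\<bar> \<ge> \<bar>Im \<mu>\<bar> / 2) (nhds \<mu>)"
  unfolding eventually_nhds_metric
proof (intro exI[of _ "\<bar>Im \<mu>\<bar> / 2"] conjI allI impI)
  fix \<nu> assume "dist \<nu> \<mu> < \<bar>Im \<mu>\<bar> / 2"
  then show "\<bar>Im \<nu>\<bar> \<ge> \<bar>Im \<mu>\<bar> / 2"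
    using abs_Im_le_cmod[of "\<nu> - \<mu>"] by (simp add: dist_norm)
qed (use assms in auto)

lemma isCont_cauchy_int:
  assumes "cauchy_integrable h" "Im \<mu> \<noteq> 0"
  shows "isCont (cauchy_int h) \<mu>"
proof -
  \<comment> \<open>Bounds the Cauchy integral of the quotient at all points whose distance from the
    line is at least half that of \<open>\<mu>\<close>.\<close>
  define K where "K = (LINT x|lborel. norm (h x / (of_real x - \<mu>))) / (\<bar>Im \<mu>\<bar> / 2)"
  have "((\<lambda>\<nu>. cauchy_int h \<nu> - cauchy_int h \<mu>) \<longlongrightarrow> 0) (at \<mu>)"
  proof (rule Lim_null_comparison)
    show "((\<lambda>\<nu>. norm (\<nu> - \<mu>) * K) \<longlongrightarrow> 0) (at \<mu>)"
      by (intro tendsto_eq_intros | simp)+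
    have "eventually (\<lambda>\<nu>. \<bar>Im \<nu>\<bar> \<ge> \<bar>Im \<mu>\<bar> / 2) (at \<mu>)"
      using eventually_Im_ge[OF assms(2)] by (auto simp: eventually_at_filter elim: eventually_mono)
    then show "eventually (\<lambda>\<nu>. norm (cauchy_int h \<nu> - cauchy_int h \<mu>) \<le> norm (\<nu> - \<mu>) * K) (at \<mu>)"
    proof eventually_elim
      case (elim \<nu>)
      then have nz: "Im \<nu> \<noteq> 0" using assms(2) by auto
      have "norm (cauchy_int (\<lambda>x. h x / (of_real x - \<mu>)) \<nu>)
          \<le> (LINT x|lborel. norm (h x / (of_real x - \<mu>))) / \<bar>Im \<nu>\<bar>"
        using cauchy_int_bound_L1[OF cauchy_integrable_divide[OF assms] nz] .
      also have "\<dots> \<le> K"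
        unfolding K_def using elim assms(2) by (intro divide_left_mono) auto
      finally show ?case
        unfolding cauchy_int_resolvent_identity[OF assms nz] by (auto simp: norm_mult intro: mult_left_mono)
    qed
  qed
  then show ?thesis
    by (simp add: isCont_def LIM_zero_cancel)
qed

text \<open>By the resolvent identity the difference quotient is exactly the Cauchy integral of
  \<open>h / (x - \<mu>)\<close> at the moving point, and that integral is continuous.\<close>

lemma cauchy_int_has_derivative:
  assumes "cauchy_integrable h" "Im \<mu> \<noteq> 0"
  shows "(cauchy_int h has_field_derivative cauchy_int (\<lambda>x. h x / (of_real x - \<mu>)) \<mu>) (at \<mu>)"
  unfolding has_field_derivative_iff
proof (rule Lim_transform_eventually)
  show "(cauchy_int (\<lambda>x. h x / (of_real x - \<mu>)) \<longlongrightarrow> cauchy_int (\<lambda>x. h x / (of_real x - \<mu>)) \<mu>) (at \<mu>)"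
    using isCont_cauchy_int[OF cauchy_integrable_L1[OF cauchy_integrable_divide[OF assms]] assms(2)]
    by (simp add: isCont_def)
  have "eventually (\<lambda>\<nu>. \<bar>Im \<nu>\<bar> \<ge> \<bar>Im \<mu>\<bar> / 2 \<and> \<nu> \<noteq> \<mu>) (at \<mu>)"
    using eventually_Im_ge[OF assms(2)] by (auto simp: eventually_at_filter elim: eventually_mono)
  then show "eventually (\<lambda>\<nu>. cauchy_int (\<lambda>x. h x / (of_real x - \<mu>)) \<nu>
      = (cauchy_int h \<nu> - cauchy_int h \<mu>) / (\<nu> - \<mu>)) (at \<mu>)"
  proof eventually_elim
    case (elim \<nu>)
    then show ?case using assms by (intro cauchy_int_divide) auto
  qed
qed

lemma cauchy_int_holomorphic:
  assumes "cauchy_integrable h" "\<And>\<mu>. \<mu> \<in> S \<Longrightarrow> Im \<mu> \<noteq> 0"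
  shows "cauchy_int h holomorphic_on S"
  unfolding holomorphic_on_def
  using cauchy_int_has_derivative[OF assms(1) assms(2)]
  by (meson field_differentiable_at_within field_differentiable_def)

subsection \<open>Boundary values of lower Hardy functions\<close>

text \<open>A square integrable function is the boundary function of a Hardy function of the lower half-plane
  iff its Cauchy integral vanishes in the upper half-plane. This description avoids boundary limits.\<close>

definition lower_hardy :: "(real \<Rightarrow> complex) set" where
  "lower_hardy = {f \<in> L2. \<forall>\<mu>. Im \<mu> > 0 \<longrightarrow> cauchy_int f \<mu> = 0}"

definition lower_ext :: "(real \<Rightarrow> complex) \<Rightarrow> complex \<Rightarrow> complex" where
  "lower_ext f \<mu> = - cauchy_int f \<mu> / (2 * of_real pi * \<i>)"

lemma lower_hardy_L2: "f \<in> lower_hardy \<Longrightarrow> f \<in> L2"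
  by (simp add: lower_hardy_def)

lemma lower_hardy_cauchy_int: "f \<in> lower_hardy \<Longrightarrow> Im \<mu> > 0 \<Longrightarrow> cauchy_int f \<mu> = 0"
  by (simp add: lower_hardy_def)

lemma cauchy_int_lower_ext: "cauchy_int f \<mu> = - (2 * of_real pi * \<i>) * lower_ext f \<mu>"
  by (simp add: lower_ext_def)

lemma isCont_lower_ext: "f \<in> L2 \<Longrightarrow> Im \<mu> \<noteq> 0 \<Longrightarrow> isCont (lower_ext f) \<mu>"
  unfolding lower_ext_def by (intro continuous_intros isCont_cauchy_int) auto

lemma lower_ext_holomorphic: "f \<in> L2 \<Longrightarrow> lower_ext f holomorphic_on {\<mu>. Im \<mu> < 0}"
  unfolding lower_ext_def by (intro holomorphic_intros cauchy_int_holomorphic) auto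

lemma lower_hardy_add:
  assumes "f \<in> lower_hardy" "g \<in> lower_hardy" shows "(\<lambda>x. f x + g x) \<in> lower_hardy"
  using assms by (auto simp: lower_hardy_def cauchy_int_add cauchy_integrable_L2)

lemma lower_hardy_cmult: "f \<in> lower_hardy \<Longrightarrow> (\<lambda>x. a * f x) \<in> lower_hardy"
  by (auto simp: lower_hardy_def cauchy_int_cmult)

lemma lower_ext_cmult: "lower_ext (\<lambda>x. a * f x) \<mu> = a * lower_ext f \<mu>"
  by (simp add: lower_ext_def cauchy_int_cmult)

lemma lower_ext_add:
  "f \<in> L2 \<Longrightarrow> g \<in> L2 \<Longrightarrow> Im \<mu> \<noteq> 0 \<Longrightarrow>
    lower_ext (\<lambda>x. f x + g x) \<mu> = lower_ext f \<mu> + lower_ext g \<mu>"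
  by (simp add: lower_ext_def cauchy_int_add cauchy_integrable_L2 diff_divide_distrib)

text \<open>In the resolvent identity the value of the Cauchy integral of \<open>f\<close> at
  \<open>w\<close> is zero. This settles every point except \<open>w\<close> itself, which is
  reached by continuity.\<close>

lemma lower_hardy_divide_upper:
  assumes f: "f \<in> lower_hardy" and w: "Im w > 0"
  shows "(\<lambda>x. f x / (of_real x - w)) \<in> lower_hardy"
    and "Im \<mu> < 0 \<Longrightarrow> lower_ext (\<lambda>x. f x / (of_real x - w)) \<mu> = lower_ext f \<mu> / (\<mu> - w)"
proof -
  have ci: "cauchy_integrable f" using lower_hardy_L2[OF f] by auto
  let ?g = "\<lambda>x. f x / (of_real x - w)"
  have gL2: "?g \<in> L2" using lower_hardy_L2[OF f] w by auto
  have off: "cauchy_int ?g \<mu> = 0" if "Im \<mu> > 0" "\<mu> \<noteq> w" for \<mu>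
    using cauchy_int_divide[OF ci, of w \<mu>] that w f by (simp add: lower_hardy_cauchy_int)
  have "cauchy_int ?g w = 0"
  proof (rule tendsto_unique)
    show "(cauchy_int ?g \<longlongrightarrow> cauchy_int ?g w) (at w)"
      using isCont_cauchy_int[OF cauchy_integrable_L2[OF gL2], of w] w by (simp add: isCont_def)
    show "(cauchy_int ?g \<longlongrightarrow> 0) (at w)"
    proof (rule tendsto_eventually)
      have "eventually (\<lambda>\<mu>. Im \<mu> > 0) (nhds w)"
        using w by (intro eventually_nhds_in_open[of "{\<mu>. Im \<mu> > 0}", simplified] open_halfspace_Im_gt)
      then have "eventually (\<lambda>\<mu>. Im \<mu> > 0 \<and> \<mu> \<noteq> w) (at w)"
        by (auto simp: eventually_at_filter elim: eventually_mono)
      then show "eventually (\<lambda>\<mu>. cauchy_int ?g \<mu> = 0) (at w)"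
        by eventually_elim (use off in auto)
    qed
  qed auto
  with off gL2 show "?g \<in> lower_hardy" unfolding lower_hardy_def by blast
  assume mu: "Im \<mu> < 0"
  then have "\<mu> \<noteq> w" using w by auto
  with mu show "lower_ext ?g \<mu> = lower_ext f \<mu> / (\<mu> - w)"
    using cauchy_int_divide[OF ci, of w \<mu>] w f by (simp add: lower_ext_def lower_hardy_cauchy_int)
qed

text \<open>The zero of the extension at \<open>w\<close> does what membership in the class does for
  a point of the upper half-plane: the subtracted value in the resolvent identity vanishes.\<close>

lemma lower_hardy_divide_lower:
  assumes f: "f \<in> lower_hardy" and w: "Im w < 0" "lower_ext f w = 0"
  shows "(\<lambda>x. f x / (of_real x - w)) \<in> lower_hardy"
    and "Im \<mu> < 0 \<Longrightarrow> \<mu> \<noteq> w \<Longrightarrow> lower_ext (\<lambda>x. f x / (of_real x - w)) \<mu> = lower_ext f \<mu> / (\<mu> - w)"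
proof -
  have ci: "cauchy_integrable f" using lower_hardy_L2[OF f] by auto
  let ?g = "\<lambda>x. f x / (of_real x - w)"
  have gL2: "?g \<in> L2" using lower_hardy_L2[OF f] w by auto
  have 0: "cauchy_int f w = 0" using w by (simp add: lower_ext_def)
  have "cauchy_int ?g \<mu> = 0" if "Im \<mu> > 0" for \<mu>
    using cauchy_int_divide[OF ci, of w \<mu>] that w f 0
    by (cases "\<mu> = w") (auto simp: lower_hardy_cauchy_int)
  with gL2 show "?g \<in> lower_hardy" unfolding lower_hardy_def by blast
  assume mu: "Im \<mu> < 0" "\<mu> \<noteq> w"
  with mu show "lower_ext ?g \<mu> = lower_ext f \<mu> / (\<mu> - w)"
    using cauchy_int_divide[OF ci, of w \<mu>] w f 0 by (simp add: lower_ext_def lower_hardy_cauchy_int)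
qed

text \<open>Division by \<open>x - b\<close> on the line is the limit of division by \<open>x - b - \<i>\<epsilon>\<close>, which is covered by
  \<open>lower_hardy_divide_upper\<close>.\<close>

lemma lower_hardy_divide_real:
  fixes b :: real
  assumes f: "f \<in> lower_hardy" and g: "(\<lambda>x. f x / (of_real x - of_real b)) \<in> L2"
  shows "(\<lambda>x. f x / (of_real x - of_real b)) \<in> lower_hardy"
    and "Im \<mu> < 0 \<Longrightarrow> lower_ext (\<lambda>x. f x / (of_real x - of_real b)) \<mu> = lower_ext f \<mu> / (\<mu> - of_real b)"
proof -
  let ?g = "\<lambda>x. f x / (of_real x - of_real b)"
  define w where "w n = Complex b (1 / real (Suc n))" for n
  have Imw: "Im (w n) > 0" for n by (simp add: w_def)
  have wlim: "w \<longlonglongrightarrow> of_real b"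
  proof -
    have "(\<lambda>n. 1 / real (Suc n)) \<longlonglongrightarrow> 0" using LIMSEQ_Suc[OF lim_1_over_n] by simp
    then have "(\<lambda>n. Complex b (1 / real (Suc n))) \<longlonglongrightarrow> Complex b 0" by (intro tendsto_Complex tendsto_const)
    then show ?thesis unfolding w_def[abs_def] complex_of_real_def .
  qed
  have [measurable]: "f \<in> borel_measurable borel" using lower_hardy_L2[OF f] by (rule L2_measurable)
  have conv: "(\<lambda>n. cauchy_int (\<lambda>x. f x / (of_real x - w n)) \<mu>) \<longlonglongrightarrow> cauchy_int ?g \<mu>" if mu: "Im \<mu> \<noteq> 0" for \<mu>
    unfolding cauchy_int_def
  proof (rule integral_dominated_convergence[where w="\<lambda>x. norm (?g x / (of_real x - \<mu>))"])
    show "integrable lborel (\<lambda>x. norm (?g x / (of_real x - \<mu>)))"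
      using L2_divide_resolvent_integrable[OF g mu] by auto
    have ae: "AE x in lborel. x \<noteq> b" by (rule AE_lborel_singleton)
    show "AE x in lborel. (\<lambda>n. f x / (of_real x - w n) / (of_real x - \<mu>)) \<longlonglongrightarrow> ?g x / (of_real x - \<mu>)"
      using ae
    proof eventually_elim
      case (elim x)
      then have nz: "complex_of_real x - of_real b \<noteq> 0" by simp
      then show ?case using real_minus_nonzero[OF mu, of x]
        by (intro tendsto_divide tendsto_const tendsto_diff wlim) auto
    qed
    show "AE x in lborel. norm (f x / (of_real x - w n) / (of_real x - \<mu>)) \<le> norm (?g x / (of_real x - \<mu>))" for n
      using ae
    proof eventually_elim
      case (elim x)
      \<comment> \<open>The points \<open>w n\<close> have real part \<open>b\<close>, so replacing
        \<open>b\<close> by \<open>w n\<close> only increases the distance from \<open>x\<close>;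
        the limiting integrand is therefore itself the majorant.\<close>
      have "norm (complex_of_real x - of_real b) \<le> norm (of_real x - w n)"
        using abs_Re_le_cmod[of "of_real x - w n"] by (simp add: w_def flip: of_real_diff)
      moreover have "norm (complex_of_real x - of_real b) > 0" "norm (of_real x - w n) > 0"
        using elim real_minus_nonzero[of "w n" x] Imw[of n] by auto
      ultimately show ?case
        unfolding norm_divide by (intro divide_right_mono divide_left_mono mult_pos_pos) auto
    qed
  qed measurable
  have "cauchy_int ?g \<mu> = 0" if "Im \<mu> > 0" for \<mu>
  proof -
    have "(\<lambda>n. cauchy_int (\<lambda>x. f x / (of_real x - w n)) \<mu>) = (\<lambda>n. 0)"
      using lower_hardy_divide_upper(1)[OF f Imw] that by (auto simp: lower_hardy_cauchy_int)
    with conv[of \<mu>] that show ?thesis by (simp add: LIMSEQ_const_iff)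
  qed
  with g show "?g \<in> lower_hardy" unfolding lower_hardy_def by blast
  assume mu: "Im \<mu> < 0"
  have nz: "\<mu> - of_real b \<noteq> 0" using mu by (auto simp: complex_eq_iff)
  have "(\<lambda>n. lower_ext (\<lambda>x. f x / (of_real x - w n)) \<mu>) \<longlonglongrightarrow> lower_ext ?g \<mu>"
    unfolding lower_ext_def using conv[of \<mu>] mu by (intro tendsto_intros) auto
  moreover have "(\<lambda>n. lower_ext (\<lambda>x. f x / (of_real x - w n)) \<mu>) = (\<lambda>n. lower_ext f \<mu> / (\<mu> - w n))"
    using lower_hardy_divide_upper(2)[OF f Imw mu] by auto
  moreover have "(\<lambda>n. lower_ext f \<mu> / (\<mu> - w n)) \<longlonglongrightarrow> lower_ext f \<mu> / (\<mu> - of_real b)"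
    using nz by (intro tendsto_intros wlim)
  ultimately show "lower_ext ?g \<mu> = lower_ext f \<mu> / (\<mu> - of_real b)"
    using LIMSEQ_unique by metis
qed

subsection \<open>Uniqueness of the boundary function\<close>

text \<open>The Cauchy kernels at \<open>t + \<i> y\<close> and \<open>t - \<i> y\<close> differ by
  \<open>2 * \<i>\<close> times the Poisson kernel \<open>P t x\<close> (without its factor
  \<open>1 / pi\<close>). Integrating over \<open>t\<close> from \<open>a\<close> to
  \<open>b\<close> and exchanging the integrals leaves a difference of arctangents, a primitive of
  that kernel.\<close>

lemma poisson_integral_zero:
  fixes k :: "real \<Rightarrow> complex"
  assumes k: "integrable lborel k" and y: "y > 0"
    and zero: "\<And>t. cauchy_int k (Complex t y) = 0" "\<And>t. cauchy_int k (Complex t (- y)) = 0"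
    and ab: "a \<le> b"
  shows "(LINT x|lborel. k x * of_real (arctan ((b - x) / y) - arctan ((a - x) / y))) = 0"
proof -
  have [measurable]: "k \<in> borel_measurable borel" using k by auto
  define P where "P t x = y / ((t - x)\<^sup>2 + y\<^sup>2)" for t x :: real
  have den: "(t - x)\<^sup>2 + y\<^sup>2 \<ge> y\<^sup>2" "(t - x)\<^sup>2 + y\<^sup>2 > 0" for t x
    using y by (auto intro: add_nonneg_pos)
  have Pm [measurable]: "case_prod P \<in> borel_measurable (borel \<Otimes>\<^sub>M borel)"
    unfolding P_def by measurable
  have P_nonneg: "P t x \<ge> 0" for t x using y den[of t x] by (simp add: P_def)
  have P_le: "P t x \<le> 1 / y" for t x
  proof -
    have "P t x \<le> y / y\<^sup>2" unfolding P_def using y den by (intro divide_left_mono mult_pos_pos) auto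
    then show ?thesis using y by (simp add: power2_eq_square)
  qed
  have inner: "(LINT x|lborel. k x * of_real (P t x)) = 0" for t
  proof -
    have eq: "k x * of_real (P t x)
      = (k x / (of_real x - Complex t y) - k x / (of_real x - Complex t (- y))) / (2 * \<i>)" for x
    proof -
      have nz: "of_real x - Complex t y \<noteq> 0" "of_real x - Complex t (- y) \<noteq> 0"
        using y by (intro real_minus_nonzero; simp)+
      have prod: "(of_real x - Complex t y) * (of_real x - Complex t (- y)) = of_real ((t - x)\<^sup>2 + y\<^sup>2)"
        by (simp add: complex_eq_iff power2_eq_square algebra_simps)
      have "k x / (of_real x - Complex t y) - k x / (of_real x - Complex t (- y))
          = k x * (Complex t y - Complex t (- y)) / ((of_real x - Complex t y) * (of_real x - Complex t (- y)))"
        using nz by (simp add: field_simps)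
      also have "Complex t y - Complex t (- y) = 2 * \<i> * of_real y"
        by (simp add: complex_eq_iff)
      finally have e: "k x / (of_real x - Complex t y) - k x / (of_real x - Complex t (- y))
          = k x * (2 * \<i> * of_real y) / of_real ((t - x)\<^sup>2 + y\<^sup>2)"
        unfolding prod .
      have gen: "K * (2 * \<i> * Y) / Q / (2 * \<i>) = K * (Y / Q)" for K Y Q :: complex
        by (cases "Q = 0") (auto simp: field_simps)
      show ?thesis unfolding e P_def of_real_divide by (rule gen[symmetric])
    qed
    have ci: "cauchy_integrable k" using k by auto
    show ?thesis
      unfolding eq using zero[of t] y ci
      by (simp add: cauchy_int_def cauchy_integrable_def)
  qed
  define f where "f t x = indicator {a..b} t *\<^sub>R (k x * of_real (P t x))" for t x
  have fm: "case_prod f \<in> borel_measurable (lborel \<Otimes>\<^sub>M lborel)"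
    unfolding f_def by measurable
  have kP_le: "norm (k x * complex_of_real (P t x)) \<le> norm (k x) * (1 / y)" for x t
  proof -
    have "norm (k x) * \<bar>P t x\<bar> \<le> norm (k x) * (1 / y)"
      using P_nonneg[of t x] P_le[of t x] by (intro mult_left_mono) auto
    then show ?thesis by (simp add: norm_mult)
  qed
  have kP: "integrable lborel (\<lambda>x. k x * of_real (P t x))" for t
  proof (rule Bochner_Integration.integrable_bound[where f="\<lambda>x. norm (k x) * (1 / y)"])
    show "AE x in lborel. norm (k x * complex_of_real (P t x)) \<le> norm (norm (k x) * (1 / y))"
      using kP_le[of _ t] y by (intro AE_I2) (simp add: abs_mult)
  qed (use k in auto)
  have fint: "integrable (lborel \<Otimes>\<^sub>M lborel) (case_prod f)"
  proof (rule lborel_pair.Fubini_integrable[OF fm])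
    show "AE t in lborel. integrable lborel (\<lambda>x. case_prod f (t, x))"
      unfolding f_def using kP by (auto intro!: AE_I2)
    show "integrable lborel (\<lambda>t. LINT x|lborel. norm (case_prod f (t, x)))"
    proof (rule Bochner_Integration.integrable_bound)
      show "integrable lborel (\<lambda>t. indicator {a..b} t *\<^sub>R ((LINT x|lborel. norm (k x)) / y))"
        using ab by (intro integrable_scaleR_left integrable_real_indicator) auto
      show "(\<lambda>t. LINT x|lborel. norm (case_prod f (t, x))) \<in> borel_measurable lborel"
        using fm by measurable
      show "AE t in lborel. norm (LINT x|lborel. norm (case_prod f (t, x)))
        \<le> norm (indicator {a..b} t *\<^sub>R ((LINT x|lborel. norm (k x)) / y))"
      proof (intro AE_I2)
        fix t
        have "(LINT x|lborel. norm (k x * of_real (P t x))) \<le> (LINT x|lborel. norm (k x) * (1 / y))"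
        proof (rule integral_mono)
          show "norm (k x * of_real (P t x)) \<le> norm (k x) * (1 / y)" for x
            by (rule kP_le)
        qed (use kP k in auto)
        then show "norm (LINT x|lborel. norm (case_prod f (t, x)))
            \<le> norm (indicator {a..b} t *\<^sub>R ((LINT x|lborel. norm (k x)) / y))"
          using y by (auto simp: f_def indicator_def abs_mult divide_simps integral_nonneg_AE)
      qed
    qed
  qed
  have arct: "(LINT t|lborel. f t x) = k x * of_real (arctan ((b - x) / y) - arctan ((a - x) / y))" for x
  proof -
    have "has_bochner_integral lborel (\<lambda>t. P t x * indicator {a..b} t)
        (arctan ((b - x) / y) - arctan ((a - x) / y))"
    proof (rule has_bochner_integral_FTC_Icc_real[OF ab])
      fix t :: real
      have "((\<lambda>t. arctan ((t - x) / y)) has_real_derivative inverse (1 + ((t - x) / y)\<^sup>2) * (1 / y)) (at t)"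
        using y by (auto intro!: derivative_eq_intros)
      also have "inverse (1 + ((t - x) / y)\<^sup>2) * (1 / y) = P t x"
      proof -
        have "1 + ((t - x) / y)\<^sup>2 = ((t - x)\<^sup>2 + y\<^sup>2) / y\<^sup>2"
          using y by (simp add: power_divide add_divide_distrib)
        then show ?thesis using y den(2)[of t x] by (simp add: P_def power2_eq_square)
      qed
      finally show "((\<lambda>t. arctan ((t - x) / y)) has_real_derivative P t x) (at t)" .
      show "isCont (\<lambda>t. P t x) t"
        unfolding P_def using den(2)[of t x] by (intro continuous_intros) auto
    qed
    then have "has_bochner_integral lborel (\<lambda>t. k x * of_real (P t x * indicator {a..b} t))
        (k x * of_real (arctan ((b - x) / y) - arctan ((a - x) / y)))"
      by (intro has_bochner_integral_mult_right has_bochner_integral_of_real) auto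
    moreover have "(\<lambda>t. k x * of_real (P t x * indicator {a..b} t)) = (\<lambda>t. f t x)"
      by (auto simp: f_def indicator_def)
    ultimately show ?thesis using has_bochner_integral_integral_eq by metis
  qed
  have "(LINT x|lborel. LINT t|lborel. f t x) = (LINT t|lborel. LINT x|lborel. f t x)"
    by (rule lborel_pair.Fubini_integral[OF fint])
  also have "\<dots> = 0"
  proof -
    have "(LINT x|lborel. f t x) = 0" for t
      using inner[of t] by (simp add: f_def)
    then show ?thesis by simp
  qed
  finally show ?thesis unfolding arct .
qed

text \<open>Lebesgue differentiation: outside a negligible set, \<open>k x\<close> is the limit of
  its averages over short intervals starting at \<open>x\<close>, and these averages are
  zero.\<close>

lemma integral_intervals_zero_AE:
  fixes k :: "real \<Rightarrow> complex"
  assumes k: "integrable lborel k"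
    and zero: "\<And>a b. a \<le> b \<Longrightarrow> (LINT x:{a..b}|lborel. k x) = 0"
  shows "AE x in lborel. k x = 0"
proof -
  have [measurable]: "k \<in> borel_measurable borel" using k by auto
  have si: "set_integrable lborel {a..b} k" for a b
    using k by (simp add: set_integrable_def integrable_mult_indicator)
  have "k integrable_on cbox a b" for a b
    using set_borel_integral_eq_integral(1)[OF si[of a b]] by simp
  then obtain N where N: "negligible N"
    "\<And>x e. x \<notin> N \<Longrightarrow> 0 < e \<Longrightarrow> \<exists>d>0. \<forall>h. 0 < h \<and> h < d \<longrightarrow>
        norm (integral (cbox x (x + h *\<^sub>R One)) k /\<^sub>R h ^ DIM(real) - k x) < e"
    using integrable_ccontinuous_explicit[of k] by blast
  have "k x = 0" if "x \<notin> N" for x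
  proof (rule ccontr)
    assume "k x \<noteq> 0"
    with N(2)[OF that, of "norm (k x)"] obtain d where d: "d > 0"
      "\<And>h. 0 < h \<Longrightarrow> h < d \<Longrightarrow> norm (integral (cbox x (x + h *\<^sub>R One)) k /\<^sub>R h ^ DIM(real) - k x) < norm (k x)"
      by auto
    have "integral (cbox x (x + (d/2) *\<^sub>R One)) k = 0"
      using zero[of x "x + d/2"] set_borel_integral_eq_integral(2)[OF si[of x "x + d/2"]] d(1) by simp
    with d(2)[of "d/2"] d(1) show False by simp
  qed
  \<comment> \<open>Negligible sets are null sets of the completed measure; the conclusion is
    carried back to \<open>lborel\<close> afterwards.\<close>
  moreover have "AE x in lebesgue. x \<notin> N"
    using N(1) by (intro AE_not_in) (simp add: negligible_iff_null_sets)
  ultimately have "AE x in lebesgue. k x = 0" by (auto elim: eventually_mono)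
  then show ?thesis by (subst (asm) AE_completion_iff) auto
qed

text \<open>As the height tends to 0, the arctangent difference tends to \<open>pi\<close> times the
  indicator of the interval, except at its endpoints, and it is bounded by \<open>pi\<close>.
  Assuming the vanishing only at heights below 1 keeps the point \<open>\<i>\<close> out of the
  hypothesis, which matters when the density is \<open>f / (x - \<i>)\<close>.\<close>

lemma cauchy_int_zero_L1:
  fixes k :: "real \<Rightarrow> complex"
  assumes k: "integrable lborel k"
    and zero: "\<And>\<mu>. Im \<mu> \<noteq> 0 \<Longrightarrow> \<bar>Im \<mu>\<bar> < 1 \<Longrightarrow> cauchy_int k \<mu> = 0"
  shows "AE x in lborel. k x = 0"
proof (rule integral_intervals_zero_AE[OF k])
  have [measurable]: "k \<in> borel_measurable borel" using k by auto
  fix a b :: real assume ab: "a \<le> b"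
  \<comment> \<open>The offset 2 keeps every height strictly below 1, also for
    \<open>n = 0\<close>.\<close>
  define y where "y n = 1 / real (n + 2)" for n :: nat
  have y: "y n > 0" "y n < 1" for n by (auto simp: y_def)
  define A where "A n x = arctan ((b - x) / y n) - arctan ((a - x) / y n)" for n x
  have z: "(LINT x|lborel. k x * of_real (A n x)) = 0" for n
    unfolding A_def using y[of n] by (intro poisson_integral_zero k ab zero) auto
  have lim: "(\<lambda>n. A n x) \<longlonglongrightarrow> pi * indicator {a..b} x" if ne: "x \<noteq> a" "x \<noteq> b" for x
  proof -
    have inv: "c / y n = c * real (n + 2)" for c n by (simp add: y_def)
    have pos: "(\<lambda>n. arctan (c / y n)) \<longlonglongrightarrow> pi / 2" if "c > 0" for c
      unfolding inv using that
      by (intro filterlim_compose[OF tendsto_arctan_at_top]) real_asymp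
    have neg: "(\<lambda>n. arctan (c / y n)) \<longlonglongrightarrow> - (pi / 2)" if "c < 0" for c
      unfolding inv using that
      by (intro filterlim_compose[OF tendsto_arctan_at_bot]) real_asymp
    consider "x < a" | "a < x" "x < b" | "x > b" using ne by linarith
    then show ?thesis
    proof cases
      case 1
      then have "(\<lambda>n. A n x) \<longlonglongrightarrow> pi / 2 - pi / 2"
        unfolding A_def using ab by (intro tendsto_diff pos) auto
      with 1 show ?thesis by simp
    next
      case 2
      then have "(\<lambda>n. A n x) \<longlonglongrightarrow> pi / 2 - - (pi / 2)"
        unfolding A_def using ab by (intro tendsto_diff pos neg) auto
      with 2 show ?thesis by simp
    next
      case 3
      then have "(\<lambda>n. A n x) \<longlonglongrightarrow> - (pi / 2) - - (pi / 2)"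
        unfolding A_def using ab by (intro tendsto_diff neg) auto
      with 3 show ?thesis by simp
    qed
  qed
  have "(\<lambda>n. LINT x|lborel. k x * of_real (A n x)) \<longlonglongrightarrow> (LINT x|lborel. k x * of_real (pi * indicator {a..b} x))"
  proof (rule integral_dominated_convergence[where w="\<lambda>x. norm (k x) * pi"])
    have "AE x in lborel. x \<noteq> a" "AE x in lborel. x \<noteq> b" by (rule AE_lborel_singleton)+
    then show "AE x in lborel. (\<lambda>n. k x * of_real (A n x)) \<longlonglongrightarrow> k x * of_real (pi * indicator {a..b} x)"
    proof eventually_elim
      case (elim x)
      then show ?case by (intro tendsto_mult tendsto_const tendsto_of_real lim)
    qed
    show "AE x in lborel. norm (k x * of_real (A n x)) \<le> norm (k x) * pi" for n
    proof (intro AE_I2)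
      fix x
      have "\<bar>A n x\<bar> \<le> pi"
        unfolding A_def using arctan_bounded[of "(b - x) / y n"] arctan_bounded[of "(a - x) / y n"]
        by linarith
      then show "norm (k x * of_real (A n x)) \<le> norm (k x) * pi"
        by (auto simp: norm_mult intro!: mult_left_mono)
    qed
    show "(\<lambda>x. k x * of_real (A n x)) \<in> borel_measurable lborel" for n
      unfolding A_def by measurable
  qed (use k in auto)
  then have "(LINT x|lborel. k x * of_real (pi * indicator {a..b} x)) = 0"
    unfolding z by (simp add: LIMSEQ_const_iff)
  moreover have "(\<lambda>x. k x * of_real (pi * indicator {a..b} x)) = (\<lambda>x. of_real pi * (indicator {a..b} x *\<^sub>R k x))"
    by (auto simp: indicator_def)
  ultimately have "(LINT x|lborel. of_real pi * (indicator {a..b} x *\<^sub>R k x)) = 0"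
    by (simp only:)
  then show "(LINT x:{a..b}|lborel. k x) = 0"
    by (subst (asm) integral_mult_right_zero) (simp add: set_lebesgue_integral_def)
qed

text \<open>Division by \<open>x - \<i>\<close> makes the density integrable, and the resolvent
  identity transfers the vanishing to the quotient at all points other than
  \<open>\<i>\<close>.\<close>

lemma cauchy_int_zero_L2:
  assumes f: "f \<in> L2" and zero: "\<And>\<mu>. Im \<mu> \<noteq> 0 \<Longrightarrow> cauchy_int f \<mu> = 0"
  shows "AE x in lborel. f x = 0"
proof -
  have "AE x in lborel. f x / (of_real x - \<i>) = 0"
  proof (rule cauchy_int_zero_L1)
    show "integrable lborel (\<lambda>x. f x / (complex_of_real x - \<i>))"
      by (rule L2_divide_resolvent_integrable[OF f]) simp
    fix \<mu> assume mu: "Im \<mu> \<noteq> 0" "\<bar>Im \<mu>\<bar> < 1"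
    then have "\<mu> \<noteq> \<i>" by auto
    with mu show "cauchy_int (\<lambda>x. f x / (of_real x - \<i>)) \<mu> = 0"
      using cauchy_int_divide[OF cauchy_integrable_L2[OF f], of \<i> \<mu>] by (simp add: zero)
  qed
  then show ?thesis
    by eventually_elim (use real_minus_nonzero[of \<i>] in auto)
qed

lemma lower_ext_zero:
  assumes f: "f \<in> lower_hardy" and "\<And>\<mu>. Im \<mu> < 0 \<Longrightarrow> lower_ext f \<mu> = 0"
  shows "AE x in lborel. f x = 0"
proof (rule cauchy_int_zero_L2[OF lower_hardy_L2[OF f]])
  fix \<mu> assume "Im \<mu> \<noteq> 0"
  then consider "Im \<mu> > 0" | "Im \<mu> < 0" by linarith
  then show "cauchy_int f \<mu> = 0"
  proof cases
    case 1
    then show ?thesis by (rule lower_hardy_cauchy_int[OF f])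
  next
    case 2
    then show ?thesis by (simp add: cauchy_int_lower_ext assms(2))
  qed
qed

subsection \<open>Multiplication and division by polynomials\<close>

text \<open>Induction on \<open>n\<close>. Writing the polynomial as \<open>a + x * p'\<close> and
  \<open>x / (x - \<i>)\<close> as \<open>1 + \<i> / (x - \<i>)\<close>, each step only divides by
  \<open>x - \<i>\<close>, whose zero lies in the upper half-plane.\<close>

lemma poly_lower_hardy:
  assumes f: "f \<in> lower_hardy" and "degree p \<le> n"
  shows "(\<lambda>x. poly p (of_real x) * f x / (of_real x - \<i>) ^ n) \<in> lower_hardy \<and>
    (\<forall>\<mu>. Im \<mu> < 0 \<longrightarrow> lower_ext (\<lambda>x. poly p (of_real x) * f x / (of_real x - \<i>) ^ n) \<mu>
      = poly p \<mu> * lower_ext f \<mu> / (\<mu> - \<i>) ^ n)"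
  using assms(2)
proof (induction n arbitrary: p)
  case 0
  then obtain a where "p = [:a:]" using degree_eq_zeroE by (metis le_zero_eq)
  then show ?case using f by (simp add: lower_hardy_cmult lower_ext_cmult)
next
  case (Suc n)
  obtain a p' where p: "p = pCons a p'" by (cases p)
  have deg: "degree p' \<le> n" using Suc.prems p by (auto split: if_splits)
  let ?g = "\<lambda>x. poly p' (of_real x) * f x / (of_real x - \<i>) ^ n"
  let ?h = "\<lambda>x. poly [:a:] (of_real x) * f x / (of_real x - \<i>) ^ n"
  have g: "?g \<in> lower_hardy" "\<And>\<mu>. Im \<mu> < 0 \<Longrightarrow> lower_ext ?g \<mu> = poly p' \<mu> * lower_ext f \<mu> / (\<mu> - \<i>) ^ n"
    using Suc.IH[OF deg] by auto
  have h: "?h \<in> lower_hardy" "\<And>\<mu>. Im \<mu> < 0 \<Longrightarrow> lower_ext ?h \<mu> = poly [:a:] \<mu> * lower_ext f \<mu> / (\<mu> - \<i>) ^ n"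
    using Suc.IH[of "[:a:]"] by auto
  have gi: "(\<lambda>x. ?g x / (of_real x - \<i>)) \<in> lower_hardy" "(\<lambda>x. ?h x / (of_real x - \<i>)) \<in> lower_hardy"
    using lower_hardy_divide_upper(1)[OF g(1), of \<i>] lower_hardy_divide_upper(1)[OF h(1), of \<i>] by auto
  have nz: "of_real x - \<i> \<noteq> 0" for x using real_minus_nonzero[of \<i> x] by simp
  have eq: "(\<lambda>x. poly p (of_real x) * f x / (of_real x - \<i>) ^ Suc n)
      = (\<lambda>x. ?g x + (\<i> * (?g x / (of_real x - \<i>)) + ?h x / (of_real x - \<i>)))"
  proof
    fix x
    show "poly p (of_real x) * f x / (of_real x - \<i>) ^ Suc n
      = ?g x + (\<i> * (?g x / (of_real x - \<i>)) + ?h x / (of_real x - \<i>))"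
      using nz[of x] by (simp add: p divide_simps) (simp add: algebra_simps)
  qed
  have mem1: "(\<lambda>x. \<i> * (?g x / (of_real x - \<i>)) + ?h x / (of_real x - \<i>)) \<in> lower_hardy"
    by (intro lower_hardy_add lower_hardy_cmult gi)
  have "lower_ext (\<lambda>x. ?g x + (\<i> * (?g x / (of_real x - \<i>)) + ?h x / (of_real x - \<i>))) \<mu>
      = poly p \<mu> * lower_ext f \<mu> / (\<mu> - \<i>) ^ Suc n" if mu: "Im \<mu> < 0" for \<mu>
  proof -
    have nz: "\<mu> - \<i> \<noteq> 0" using mu by (auto simp: complex_eq_iff)
    have "lower_ext (\<lambda>x. ?g x + (\<i> * (?g x / (of_real x - \<i>)) + ?h x / (of_real x - \<i>))) \<mu>
      = lower_ext ?g \<mu> + (\<i> * (lower_ext ?g \<mu> / (\<mu> - \<i>)) + lower_ext ?h \<mu> / (\<mu> - \<i>))"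
    proof -
      have [simp]: "Im \<mu> \<noteq> 0" using mu by simp
      have "lower_ext (\<lambda>x. ?g x + (\<i> * (?g x / (of_real x - \<i>)) + ?h x / (of_real x - \<i>))) \<mu>
        = lower_ext ?g \<mu> + lower_ext (\<lambda>x. \<i> * (?g x / (of_real x - \<i>)) + ?h x / (of_real x - \<i>)) \<mu>"
        by (intro lower_ext_add lower_hardy_L2 g(1) mem1) simp
      also have "lower_ext (\<lambda>x. \<i> * (?g x / (of_real x - \<i>)) + ?h x / (of_real x - \<i>)) \<mu>
        = lower_ext (\<lambda>x. \<i> * (?g x / (of_real x - \<i>))) \<mu> + lower_ext (\<lambda>x. ?h x / (of_real x - \<i>)) \<mu>"
        by (intro lower_ext_add lower_hardy_L2 gi lower_hardy_cmult) simp
      also have "lower_ext (\<lambda>x. \<i> * (?g x / (of_real x - \<i>))) \<mu>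
        = \<i> * lower_ext (\<lambda>x. ?g x / (of_real x - \<i>)) \<mu>" by (rule lower_ext_cmult)
      also have "lower_ext (\<lambda>x. ?g x / (of_real x - \<i>)) \<mu> = lower_ext ?g \<mu> / (\<mu> - \<i>)"
        by (rule lower_hardy_divide_upper(2)[OF g(1) _ mu]) simp
      also have "lower_ext (\<lambda>x. ?h x / (of_real x - \<i>)) \<mu> = lower_ext ?h \<mu> / (\<mu> - \<i>)"
        by (rule lower_hardy_divide_upper(2)[OF h(1) _ mu]) simp
      finally show ?thesis .
    qed
    also have "\<dots> = poly p \<mu> * lower_ext f \<mu> / (\<mu> - \<i>) ^ Suc n"
      unfolding g(2)[OF mu] h(2)[OF mu] using nz by (simp add: p divide_simps) (simp add: algebra_simps)
    finally show ?thesis .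
  qed
  with lower_hardy_add[OF g(1) mem1] show ?case unfolding eq by blast
qed

lemma lower_hardy_AE_cong:
  assumes "f \<in> lower_hardy" "g \<in> borel_measurable borel" "AE x in lborel. f x = g x"
  shows "g \<in> lower_hardy" "lower_ext g = lower_ext f"
proof -
  have fL2: "f \<in> L2" using assms(1) by (rule lower_hardy_L2)
  have c: "cauchy_int g = cauchy_int f"
    by (intro ext cauchy_int_cong_AE[symmetric] assms L2_measurable fL2)
  have "g \<in> L2" by (rule L2_AE_cong[OF fL2 assms(2,3)])
  then show "g \<in> lower_hardy"
    using assms(1) by (simp add: lower_hardy_def c)
  show "lower_ext g = lower_ext f" by (simp add: lower_ext_def c fun_eq_iff)
qed

section \<open>Square integrability near a point of the line\<close>

lemma sq_integrable_near_bound: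
  assumes f: "sq_integrable_near f a" and g [measurable]: "g \<in> borel_measurable borel"
    and d: "d > 0" and le: "AE x in lborel. \<bar>x - a\<bar> < d \<longrightarrow> norm (g x) \<le> K * norm (f x)"
  shows "sq_integrable_near g a"
proof -
  obtain e where e: "e > 0" "set_integrable lborel {a - e<..<a + e} (\<lambda>x. (norm (f x))\<^sup>2)"
    using f by (auto simp: sq_integrable_near_def)
  let ?m = "min d e"
  have int: "set_integrable lborel {a - ?m<..<a + ?m} (\<lambda>x. (norm (f x))\<^sup>2)"
    by (rule set_integrable_subset[OF e(2)]) auto
  have "set_integrable lborel {a - ?m<..<a + ?m} (\<lambda>x. (norm (g x))\<^sup>2)"
    unfolding set_integrable_def
  proof (rule Bochner_Integration.integrable_bound)
    show "integrable lborel (\<lambda>x. K\<^sup>2 * (indicator {a - ?m<..<a + ?m} x *\<^sub>R (norm (f x))\<^sup>2))"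
      using int by (simp add: set_integrable_def)
    show "AE x in lborel. norm (indicator {a - ?m<..<a + ?m} x *\<^sub>R (norm (g x))\<^sup>2)
      \<le> norm (K\<^sup>2 * (indicator {a - ?m<..<a + ?m} x *\<^sub>R (norm (f x))\<^sup>2))"
      using le
    proof eventually_elim
      case (elim x)
      show ?case
      proof (cases "x \<in> {a - ?m<..<a + ?m}")
        case True
        then have "norm (g x) \<le> K * norm (f x)" using elim by auto
        then have "(norm (g x))\<^sup>2 \<le> (K * norm (f x))\<^sup>2" by (intro power_mono) auto
        with True show ?thesis by (simp add: power_mult_distrib)
      qed auto
    qed
  qed measurable
  then show ?thesis using d e(1) unfolding sq_integrable_near_def
    by (intro exI[of _ ?m]) auto
qed

lemma sq_integrable_near_L2: "f \<in> L2 \<Longrightarrow> sq_integrable_near f a"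
  unfolding sq_integrable_near_def
  unfolding set_integrable_def
  by (intro exI[of _ 1] conjI integrable_mult_indicator L2_integrable) auto

lemma isCont_bounded_near:
  fixes h :: "complex \<Rightarrow> complex"
  assumes "isCont h (of_real a)"
  obtains d where "d > 0" "\<And>x::real. \<bar>x - a\<bar> < d \<Longrightarrow> norm (h (of_real x)) \<le> norm (h (of_real a)) + 1"
proof -
  obtain d where d: "d > 0" "\<And>w. dist w (of_real a) < d \<Longrightarrow> dist (h w) (h (of_real a)) < 1"
    using assms unfolding continuous_at_eps_delta by (metis zero_less_one)
  show ?thesis
  proof (rule that[OF d(1)])
    fix x :: real assume "\<bar>x - a\<bar> < d"
    then have "dist (complex_of_real x) (of_real a) < d"
      by (simp add: dist_norm flip: of_real_diff)
    from d(2)[OF this] show "norm (h (of_real x)) \<le> norm (h (of_real a)) + 1"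
      using norm_triangle_ineq2[of "h (of_real x)" "h (of_real a)"] by (simp add: dist_norm)
  qed
qed

lemma sq_integrable_near_mult:
  fixes h :: "complex \<Rightarrow> complex"
  assumes "sq_integrable_near f a" "isCont h (of_real a)"
    and "(\<lambda>x. h (of_real x) * f x) \<in> borel_measurable borel"
  shows "sq_integrable_near (\<lambda>x. h (of_real x) * f x) a"
proof -
  obtain d where d: "d > 0" "\<And>x. \<bar>x - a\<bar> < d \<Longrightarrow> norm (h (of_real x)) \<le> norm (h (of_real a)) + 1"
    using isCont_bounded_near[OF assms(2)] by blast
  show ?thesis
    by (rule sq_integrable_near_bound[OF assms(1,3) d(1), of "norm (h (of_real a)) + 1"])
       (use d in \<open>auto simp: norm_mult intro!: mult_right_mono\<close>)
qed

text \<open>At distance at least \<open>e\<close> from \<open>b\<close> the factor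
  \<open>1 / (x - b)\<close> is at most \<open>1 / e\<close>, so only the behaviour near
  \<open>b\<close> is in question.\<close>

lemma L2_divide_near:
  fixes b :: real
  assumes f: "f \<in> L2" and near: "sq_integrable_near (\<lambda>x. f x / (of_real x - of_real b)) b"
  shows "(\<lambda>x. f x / (of_real x - of_real b)) \<in> L2"
proof (rule L2_I)
  have [measurable]: "f \<in> borel_measurable borel" using f by (rule L2_measurable)
  let ?g = "\<lambda>x. f x / (of_real x - of_real b)"
  show "?g \<in> borel_measurable borel" by measurable
  obtain e where e: "e > 0" "set_integrable lborel {b - e<..<b + e} (\<lambda>x. (norm (?g x))\<^sup>2)"
    using near by (auto simp: sq_integrable_near_def)
  let ?I = "{b - e<..<b + e}"
  show "integrable lborel (\<lambda>x. (norm (?g x))\<^sup>2)"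
  proof (rule Bochner_Integration.integrable_bound)
    show "integrable lborel (\<lambda>x. indicator ?I x *\<^sub>R (norm (?g x))\<^sup>2 + (1 / e)\<^sup>2 * (norm (f x))\<^sup>2)"
      using e(2) L2_integrable[OF f]
      by (intro Bochner_Integration.integrable_add integrable_mult_right) (auto simp: set_integrable_def)
    show "AE x in lborel. norm ((norm (?g x))\<^sup>2)
        \<le> norm (indicator ?I x *\<^sub>R (norm (?g x))\<^sup>2 + (1 / e)\<^sup>2 * (norm (f x))\<^sup>2)"
    proof (intro AE_I2)
      fix x
      show "norm ((norm (?g x))\<^sup>2)
        \<le> norm (indicator ?I x *\<^sub>R (norm (?g x))\<^sup>2 + (1 / e)\<^sup>2 * (norm (f x))\<^sup>2)"
      proof (cases "x \<in> ?I")
        case False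
        then have "\<bar>x - b\<bar> \<ge> e" by auto
        then have "norm (?g x) \<le> 1 / e * norm (f x)"
          using e(1) by (auto simp: norm_divide simp flip: of_real_diff intro!: divide_left_mono)
        then have "(norm (?g x))\<^sup>2 \<le> (1 / e * norm (f x))\<^sup>2" by (intro power_mono) auto
        with False show ?thesis by (simp add: power_mult_distrib power_divide)
      qed auto
    qed
  qed measurable
qed

lemma measurable_poly_of_real [measurable]:
  "(\<lambda>x::real. poly p (complex_of_real x)) \<in> borel_measurable borel"
  by (intro borel_measurable_continuous_onI continuous_intros)

lemma AE_poly_nonzero:
  assumes "p \<noteq> 0"
  shows "AE x::real in lborel. poly p (complex_of_real x) \<noteq> 0"
proof -
  have "finite (complex_of_real -` {z. poly p z = 0})"
    by (rule finite_vimageI[OF poly_roots_finite[OF assms]]) (auto intro: injI)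
  then have "complex_of_real -` {z. poly p z = 0} \<in> null_sets lborel"
    by (rule finite_imp_null_set_lborel)
  from AE_not_in[OF this] show ?thesis by simp
qed

text \<open>The roots \<open>b\<close> of \<open>t\<close> are removed one at a time, the sign of
  \<open>Im b\<close> deciding which division result applies. The bound \<open>low\<close> produces
  the zero of the extension required for roots in the lower half-plane, and \<open>near\<close> the
  integrability required for real roots; both pass to the remaining factor. The numerator
  \<open>(x - \<i>) ^ degree t\<close> compensates the decay at infinity and is later exchanged for
  any numerator of at most that degree.\<close>

lemma lower_hardy_poly_divide:
  assumes f: "f \<in> lower_hardy" and t: "t \<noteq> 0"
    and low: "\<And>a. Im a < 0 \<Longrightarrow> \<exists>K. eventually (\<lambda>w. norm (lower_ext f w) \<le> K * norm (poly t w)) (at a)"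
    and near: "\<And>a::real. sq_integrable_near (\<lambda>x. f x / poly t (of_real x)) a"
  shows "(\<lambda>x. (of_real x - \<i>) ^ degree t * f x / poly t (of_real x)) \<in> lower_hardy \<and>
    (\<forall>\<mu>. Im \<mu> < 0 \<longrightarrow> poly t \<mu> * lower_ext (\<lambda>x. (of_real x - \<i>) ^ degree t * f x / poly t (of_real x)) \<mu>
      = (\<mu> - \<i>) ^ degree t * lower_ext f \<mu>)"
  using assms
proof (induction "degree t" arbitrary: f t)
  case 0
  then obtain a where t: "t = [:a:]" "a \<noteq> 0" using degree_eq_zeroE by (metis pCons_0_0)
  have eq: "(\<lambda>x. (of_real x - \<i>) ^ degree t * f x / poly t (of_real x)) = (\<lambda>x. (1 / a) * f x)"
    using t by auto
  show ?case unfolding eq lower_ext_cmult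
    using lower_hardy_cmult[OF "0.prems"(1), of "1 / a"] t by auto
next
  case (Suc n)
  have fL2: "f \<in> L2" using Suc.prems(1) by (rule lower_hardy_L2)
  have [measurable]: "f \<in> borel_measurable borel" using fL2 by (rule L2_measurable)
  obtain b where b: "poly t b = 0" using alg_closed_imp_poly_has_root[of t] Suc.hyps(2) by auto
  then obtain t' where t': "t = [:- b, 1:] * t'" by (auto simp: poly_eq_0_iff_dvd elim: dvdE)
  have t'0: "t' \<noteq> 0" using t' Suc.prems(2) by auto
  have deg: "degree t' = n" using Suc.hyps(2) t'0 unfolding t' by (subst (asm) degree_mult_eq) auto
  have tx: "poly t w = (w - b) * poly t' w" for w by (simp add: t' algebra_simps)
  let ?F = "lower_ext f"
  \<comment> \<open>Near \<open>b\<close> the extension is dominated by \<open>t\<close>, so its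
    limit there is zero, and by continuity so is its value.\<close>
  have Fb: "?F b = 0" if bneg: "Im b < 0"
  proof -
    obtain K where K: "eventually (\<lambda>w. norm (?F w) \<le> K * norm (poly t w)) (at b)"
      using Suc.prems(3)[OF bneg] by blast
    have "(?F \<longlongrightarrow> 0) (at b)"
    proof (rule Lim_null_comparison[OF K])
      have "((\<lambda>w. K * norm (poly t w)) \<longlongrightarrow> K * norm (poly t b)) (at b)"
        by (intro tendsto_intros)
      then show "((\<lambda>w. K * norm (poly t w)) \<longlongrightarrow> 0) (at b)" using b by simp
    qed
    moreover have "(?F \<longlongrightarrow> ?F b) (at b)" using isCont_lower_ext[OF fL2, of b] bneg by (simp add: isCont_def)
    ultimately show ?thesis using tendsto_unique[OF trivial_limit_at] by blast
  qed
  let ?g = "\<lambda>x. f x / (of_real x - b)"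
  have g: "?g \<in> lower_hardy \<and> (\<forall>\<mu>. Im \<mu> < 0 \<longrightarrow> \<mu> \<noteq> b \<longrightarrow> lower_ext ?g \<mu> = ?F \<mu> / (\<mu> - b))"
  proof (cases "Im b = 0")
    case True
    define r where "r = Re b"
    have br: "b = of_real r" using True by (simp add: r_def complex_eq_iff)
    obtain d where d: "d > 0"
      "\<And>x. \<bar>x - r\<bar> < d \<Longrightarrow> norm (poly t' (of_real x)) \<le> norm (poly t' (of_real r)) + 1"
      using isCont_bounded_near[where h="poly t'" and a=r] by (auto intro: poly_isCont)
    \<comment> \<open>Up to a null set \<open>f / (x - b)\<close> is \<open>f / t\<close> times the
      cofactor \<open>t'\<close>, which is bounded near \<open>r\<close>.\<close>
    have "sq_integrable_near ?g r"
    proof (rule sq_integrable_near_bound[OF Suc.prems(4)[of r] _ d(1)])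
      show "?g \<in> borel_measurable borel" by measurable
      show "AE x in lborel. \<bar>x - r\<bar> < d \<longrightarrow>
          norm (?g x) \<le> (norm (poly t' (of_real r)) + 1) * norm (f x / poly t (of_real x))"
        using AE_poly_nonzero[OF Suc.prems(2)]
      proof (eventually_elim, intro impI)
        fix x :: real
        assume nz: "poly t (complex_of_real x) \<noteq> 0" and x: "\<bar>x - r\<bar> < d"
        have "?g x = poly t' (of_real x) * (f x / poly t (of_real x))"
          using nz by (simp add: tx)
        then show "norm (?g x) \<le> (norm (poly t' (of_real r)) + 1) * norm (f x / poly t (of_real x))"
          using d(2)[OF x] by (simp only: norm_mult) (intro mult_right_mono, auto)
      qed
    qed
    then have "?g \<in> L2" unfolding br by (rule L2_divide_near[OF fL2])
    then show ?thesis
      using lower_hardy_divide_real[OF Suc.prems(1), of r] unfolding br by blast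
  next
    case False
    then consider "Im b > 0" | "Im b < 0" by linarith
    then show ?thesis
    proof cases
      case 1
      with lower_hardy_divide_upper[OF Suc.prems(1) 1] show ?thesis by blast
    next
      case 2
      with lower_hardy_divide_lower[OF Suc.prems(1) 2 Fb[OF 2]] show ?thesis by blast
    qed
  qed
  let ?f1 = "\<lambda>x. (of_real x - \<i>) * f x / (of_real x - b)"
  \<comment> \<open>From \<open>(x - \<i>) / (x - b) = 1 + (b - \<i>) / (x - b)\<close>. The two
    forms can differ at \<open>x = b\<close>, where division by zero gives 0, hence equality almost
    everywhere only.\<close>
  let ?f2 = "\<lambda>x. f x + (b - \<i>) * ?g x"
  have f2: "?f2 \<in> lower_hardy" using g Suc.prems(1) by (intro lower_hardy_add lower_hardy_cmult) auto
  have ae: "AE x in lborel. ?f2 x = ?f1 x"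
    using AE_poly_nonzero[of "[:- b, 1:]", simplified]
  proof eventually_elim
    case (elim x)
    then have "of_real x - b \<noteq> 0" by auto
    then show ?case by (simp add: divide_simps) (simp add: algebra_simps)
  qed
  have f1m: "?f1 \<in> borel_measurable borel" by measurable
  have f1: "?f1 \<in> lower_hardy" "lower_ext ?f1 = lower_ext ?f2"
    using lower_hardy_AE_cong[OF f2 f1m ae] by auto
  have ext1: "lower_ext ?f1 \<mu> = (\<mu> - \<i>) * ?F \<mu> / (\<mu> - b)" if mu: "Im \<mu> < 0" "\<mu> \<noteq> b" for \<mu>
  proof -
    have "lower_ext ?f1 \<mu> = ?F \<mu> + lower_ext (\<lambda>x. (b - \<i>) * ?g x) \<mu>"
      unfolding f1(2) using mu g fL2 by (intro lower_ext_add lower_hardy_L2 lower_hardy_cmult Suc.prems) auto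
    also have "\<dots> = ?F \<mu> + (b - \<i>) * (?F \<mu> / (\<mu> - b))"
      unfolding lower_ext_cmult using g mu by simp
    also have "\<dots> = (\<mu> - \<i>) * ?F \<mu> / (\<mu> - b)"
      using mu by (simp add: divide_simps) (simp add: algebra_simps)
    finally show ?thesis .
  qed
  have low1: "\<exists>K. eventually (\<lambda>w. norm (lower_ext ?f1 w) \<le> K * norm (poly t' w)) (at a)" if a: "Im a < 0" for a
  proof -
    obtain K where K: "eventually (\<lambda>w. norm (?F w) \<le> K * norm (poly t w)) (at a)"
      using Suc.prems(3)[OF a] by blast
    have ev1: "eventually (\<lambda>w. Im w < 0) (at a)"
      using a eventually_nhds_in_open[of "{w. Im w < 0}" a] open_halfspace_Im_lt[of 0]
      by (auto simp: eventually_at_filter elim: eventually_mono)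
    have ev2: "eventually (\<lambda>w. w \<noteq> b) (at a)" by (rule eventually_neq_at_within)
    have "((\<lambda>w. norm (w - \<i>)) \<longlongrightarrow> norm (a - \<i>)) (at a)" by (intro tendsto_intros)
    then have ev3: "eventually (\<lambda>w. norm (w - \<i>) < norm (a - \<i>) + 1) (at a)"
      by (rule order_tendstoD) simp
    have "eventually (\<lambda>w. norm (lower_ext ?f1 w) \<le> ((norm (a - \<i>) + 1) * \<bar>K\<bar>) * norm (poly t' w)) (at a)"
      using K ev1 ev2 ev3
    proof eventually_elim
      case (elim w)
      have "norm (?F w) \<le> \<bar>K\<bar> * (norm (w - b) * norm (poly t' w))"
        using order_trans[OF elim(1) mult_right_mono[OF abs_ge_self norm_ge_zero]]
        by (simp only: tx norm_mult)
      then have "norm (?F w) / norm (w - b) \<le> \<bar>K\<bar> * norm (poly t' w)"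
        using elim(3) by (simp add: divide_simps mult_ac)
      then have "norm (w - \<i>) * (norm (?F w) / norm (w - b)) \<le> (norm (a - \<i>) + 1) * (\<bar>K\<bar> * norm (poly t' w))"
        using elim(4) by (intro mult_mono) auto
      then show ?case using ext1[of w] elim by (simp add: norm_mult norm_divide mult_ac)
    qed
    then show ?thesis by blast
  qed
  have near1: "sq_integrable_near (\<lambda>x. ?f1 x / poly t' (of_real x)) a" for a :: real
  proof -
    have "sq_integrable_near (\<lambda>x. (of_real x - \<i>) * (f x / poly t (of_real x))) a"
      by (rule sq_integrable_near_mult[OF Suc.prems(4), where h="\<lambda>w. w - \<i>"]) (auto intro!: continuous_intros)
    moreover have "(\<lambda>x. (of_real x - \<i>) * (f x / poly t (of_real x))) = (\<lambda>x. ?f1 x / poly t' (of_real x))"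
      by (simp add: tx)
    ultimately show ?thesis by (simp only:)
  qed
  let ?G = "\<lambda>x. (of_real x - \<i>) ^ degree t * f x / poly t (of_real x)"
  have eqG: "(\<lambda>x. (of_real x - \<i>) ^ degree t' * ?f1 x / poly t' (of_real x)) = ?G"
    unfolding Suc.hyps(2)[symmetric] deg by (simp add: tx mult_ac)
  have IH: "?G \<in> lower_hardy" "\<And>\<mu>. Im \<mu> < 0 \<Longrightarrow> poly t' \<mu> * lower_ext ?G \<mu> = (\<mu> - \<i>) ^ n * lower_ext ?f1 \<mu>"
    using Suc.hyps(1)[OF deg[symmetric] f1(1) t'0 low1 near1, unfolded eqG] unfolding deg by blast+
  have "poly t \<mu> * lower_ext ?G \<mu> = (\<mu> - \<i>) ^ degree t * ?F \<mu>" if mu: "Im \<mu> < 0" for \<mu>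
  proof (cases "\<mu> = b")
    case True
    then show ?thesis using b Fb mu by simp
  next
    case False
    have "poly t \<mu> * lower_ext ?G \<mu> = (\<mu> - b) * ((\<mu> - \<i>) ^ n * lower_ext ?f1 \<mu>)"
      using IH(2)[OF mu] by (simp add: tx mult.assoc)
    also have "\<dots> = (\<mu> - \<i>) ^ degree t * ?F \<mu>"
      unfolding ext1[OF mu False] Suc.hyps(2)[symmetric] using False by simp
    finally show ?thesis .
  qed
  with IH(1) show ?case by blast
qed

text \<open>Dividing the difference by \<open>(x - \<i>)\<^sup>n\<close> makes it square integrable; its extension vanishes.\<close>

lemma boundary_identity:
  assumes f: "f \<in> lower_hardy" and g: "g \<in> lower_hardy"
    and eq: "\<And>\<mu>. Im \<mu> < 0 \<Longrightarrow> poly p \<mu> * lower_ext g \<mu> = poly r \<mu> * lower_ext f \<mu>"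
  shows "AE x in lborel. poly p (of_real x) * g x = poly r (of_real x) * f x"
proof -
  define n where "n = max (degree p) (degree r)"
  let ?u = "\<lambda>x. poly p (of_real x) * g x / (of_real x - \<i>) ^ n"
  let ?v = "\<lambda>x. poly r (of_real x) * f x / (of_real x - \<i>) ^ n"
  have u: "?u \<in> lower_hardy" "\<And>\<mu>. Im \<mu> < 0 \<Longrightarrow> lower_ext ?u \<mu> = poly p \<mu> * lower_ext g \<mu> / (\<mu> - \<i>) ^ n"
    using poly_lower_hardy[OF g, of p n] by (auto simp: n_def)
  have v: "?v \<in> lower_hardy" "\<And>\<mu>. Im \<mu> < 0 \<Longrightarrow> lower_ext ?v \<mu> = poly r \<mu> * lower_ext f \<mu> / (\<mu> - \<i>) ^ n"
    using poly_lower_hardy[OF f, of r n] by (auto simp: n_def)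
  have mv: "(\<lambda>x. (-1) * ?v x) \<in> lower_hardy" using v(1) by (rule lower_hardy_cmult)
  have "AE x in lborel. ?u x + (-1) * ?v x = 0"
  proof (rule lower_ext_zero)
    show "(\<lambda>x. ?u x + (-1) * ?v x) \<in> lower_hardy" using u(1) mv by (rule lower_hardy_add)
    fix \<mu> assume mu: "Im \<mu> < 0"
    have "lower_ext (\<lambda>x. ?u x + (-1) * ?v x) \<mu> = lower_ext ?u \<mu> + lower_ext (\<lambda>x. (-1) * ?v x) \<mu>"
      using mu by (intro lower_ext_add lower_hardy_L2 u mv) auto
    also have "lower_ext (\<lambda>x. (-1) * ?v x) \<mu> = (-1) * lower_ext ?v \<mu>" by (rule lower_ext_cmult)
    finally show "lower_ext (\<lambda>x. ?u x + (-1) * ?v x) \<mu> = 0"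
      using u(2)[OF mu] v(2)[OF mu] eq[OF mu] by simp
  qed
  then show ?thesis
  proof eventually_elim
    case (elim x)
    then show ?case using real_minus_nonzero[of \<i> x] by (simp add: divide_simps)
  qed
qed

subsection \<open>The Cauchy formula for Hardy functions\<close>

lemma contour_integral_linepath_same_Im:
  assumes "a < b"
  shows "contour_integral (linepath (Complex a c) (Complex b c)) f = integral {a..b} (\<lambda>x. f (Complex x c))"
proof -
  let ?z = "Complex a c" and ?z' = "Complex b c"
  have "contour_integral (linepath ?z ?z') f = (?z' - ?z) * integral {0..1} (\<lambda>x. f (linepath ?z ?z' x))"
    by (simp add: contour_integral_integral)
  also have "?z' - ?z = of_real (b - a)"
    by (simp add: complex_eq_iff)
  also have "integral {0..1} (\<lambda>x. f (linepath ?z ?z' x)) =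
             integral {0..(b - a) / (b - a)} (\<lambda>x. f (Complex (a + (b - a) * x) c))"
  proof -
    have "linepath ?z ?z' x = Complex (a + (b - a) * x) c" for x
      by (simp add: linepath_def complex_eq_iff algebra_simps)
    then show ?thesis using assms by simp
  qed
  also have "{0..(b - a) / (b - a)} = (\<lambda>x. x / (b - a)) ` {0..b - a}"
    using assms by simp
  also have "integral \<dots> (\<lambda>x. f (Complex (a + (b - a) * x) c)) =
             integral {a-a..b-a} (\<lambda>x. f (Complex (x + a) c)) / of_real (b - a)"
    using assms by (subst integral_stretch_real) (auto simp: scaleR_conv_of_real add_ac)
  also have "\<dots> = integral {a..b} (\<lambda>x. f (Complex x c)) / of_real (b - a)"
    by (subst integral_shift_real_ivl) (rule refl)
  finally show ?thesis using assms by simp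
qed

lemma contour_integral_rectpath:
  assumes cont: "continuous_on (path_image (rectpath (Complex a c) (Complex b d))) g" and "a < b" "c < d"
  shows "contour_integral (rectpath (Complex a c) (Complex b d)) g =
    integral {a..b} (\<lambda>x. g (Complex x c)) + \<i> * integral {c..d} (\<lambda>y. g (Complex b y))
    - integral {a..b} (\<lambda>x. g (Complex x d)) - \<i> * integral {c..d} (\<lambda>y. g (Complex a y))"
proof -
  let ?p1 = "Complex a c" and ?p2 = "Complex b c" and ?p3 = "Complex b d" and ?p4 = "Complex a d"
  have img: "path_image (rectpath ?p1 ?p3)
      = closed_segment ?p1 ?p2 \<union> closed_segment ?p2 ?p3 \<union> closed_segment ?p3 ?p4 \<union> closed_segment ?p4 ?p1"
    by (simp add: rectpath_def Let_def path_image_join Un_assoc)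
  have "g contour_integrable_on linepath ?p1 ?p2" "g contour_integrable_on linepath ?p2 ?p3"
    "g contour_integrable_on linepath ?p3 ?p4" "g contour_integrable_on linepath ?p4 ?p1"
    by (rule contour_integrable_continuous_linepath, rule continuous_on_subset[OF cont],
        use img in blast)+
  then have "contour_integral (rectpath ?p1 ?p3) g
    = contour_integral (linepath ?p1 ?p2) g + contour_integral (linepath ?p2 ?p3) g
      + contour_integral (linepath ?p3 ?p4) g + contour_integral (linepath ?p4 ?p1) g"
    by (simp add: rectpath_def Let_def)
  also have "contour_integral (linepath ?p3 ?p4) g = - contour_integral (linepath ?p4 ?p3) g"
    by (rule contour_integral_reverse_linepath, rule continuous_on_subset[OF cont])
       (use img closed_segment_commute in blast)
  also have "contour_integral (linepath ?p4 ?p1) g = - contour_integral (linepath ?p1 ?p4) g"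
    by (rule contour_integral_reverse_linepath, rule continuous_on_subset[OF cont])
       (use img closed_segment_commute in blast)
  also have "contour_integral (linepath ?p2 ?p3) g = \<i> * integral {c..d} (\<lambda>y. g (Complex b y))"
    by (rule contour_integral_linepath_same_Re) (use assms in auto)
  also have "contour_integral (linepath ?p1 ?p4) g = \<i> * integral {c..d} (\<lambda>y. g (Complex a y))"
    by (rule contour_integral_linepath_same_Re) (use assms in auto)
  finally show ?thesis
    using assms by (simp add: contour_integral_linepath_same_Im)
qed

lemma rectpath_in_upper:
  assumes "a \<le> b" "0 < c" "c \<le> d"
  shows "path_image (rectpath (Complex a c) (Complex b d)) \<subseteq> {w. Im w > 0}"
proof -
  have "path_image (rectpath (Complex a c) (Complex b d)) \<subseteq> cbox (Complex a c) (Complex b d)"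
    using assms by (intro path_image_rectpath_subset_cbox) auto
  then show ?thesis using assms by (auto simp: in_cbox_complex_iff)
qed

text \<open>Cauchy's theorem when \<open>\<zeta>\<close> lies below the real line, and Cauchy's
  integral formula when it lies inside the rectangle.\<close>

lemma hardy_rectangle:
  assumes hol: "F holomorphic_on {w. Im w > 0}" and R: "R > \<bar>Re \<zeta>\<bar>" and d: "0 < d" "d < T"
    and lam: "Im \<zeta> < 0 \<or> d < Im \<zeta> \<and> Im \<zeta> < T"
  shows "integral {-R..R} (\<lambda>x. F (Complex x d) / (Complex x d - \<zeta>))
      + \<i> * integral {d..T} (\<lambda>y. F (Complex R y) / (Complex R y - \<zeta>))
      - integral {-R..R} (\<lambda>x. F (Complex x T) / (Complex x T - \<zeta>))
      - \<i> * integral {d..T} (\<lambda>y. F (Complex (-R) y) / (Complex (-R) y - \<zeta>))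
    = (if Im \<zeta> < 0 then 0 else 2 * of_real pi * \<i> * F \<zeta>)"
proof -
  let ?S = "{w. Im w > 0}"
  let ?p = "rectpath (Complex (-R) d) (Complex R T)"
  have Rpos: "R > 0" using R by linarith
  have sub: "path_image ?p \<subseteq> ?S" using Rpos d by (intro rectpath_in_upper) auto
  have notin: "\<zeta> \<notin> path_image ?p"
  proof (cases "Im \<zeta> < 0")
    case False
    then have "\<zeta> \<in> box (Complex (-R) d) (Complex R T)"
      using lam R by (auto simp: in_box_complex_iff)
    then show ?thesis
      using path_image_rectpath_inter_box[of "Complex (-R) d" "Complex R T"] Rpos d by auto
  qed (use sub in auto)
  have conv: "convex ?S" by (rule convex_halfspace_Im_gt)
  have cont: "continuous_on (path_image ?p) (\<lambda>w. F w / (w - \<zeta>))"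
    using notin by (intro continuous_intros continuous_on_subset[OF holomorphic_on_imp_continuous_on[OF hol] sub]) auto
  have "contour_integral ?p (\<lambda>w. F w / (w - \<zeta>)) = (if Im \<zeta> < 0 then 0 else 2 * of_real pi * \<i> * F \<zeta>)"
  proof (cases "Im \<zeta> < 0")
    case True
    have "((\<lambda>w. F w / (w - \<zeta>)) has_contour_integral 0) ?p"
      by (rule Cauchy_theorem_convex_simple[OF _ conv])
         (use True sub in \<open>auto intro!: holomorphic_intros hol\<close>)
    then show ?thesis using True by (simp add: contour_integral_unique)
  next
    case False
    then have box: "\<zeta> \<in> box (Complex (-R) d) (Complex R T)"
      using lam R by (auto simp: in_box_complex_iff)
    have "((\<lambda>w. F w / (w - \<zeta>)) has_contour_integral (2 * pi * \<i> * winding_number ?p \<zeta> * F \<zeta>)) ?p"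
    proof (rule Cauchy_integral_formula_convex_simple[OF conv hol])
      show "\<zeta> \<in> interior ?S" using False lam d by (simp add: interior_open open_halfspace_Im_gt)
    qed (use sub notin in auto)
    then show ?thesis using False winding_number_rectpath[OF box] by (simp add: contour_integral_unique)
  qed
  then show ?thesis
    using contour_integral_rectpath[OF cont] Rpos d by simp
qed

lemma integral_symmetric_tendsto:
  fixes h :: "real \<Rightarrow> complex"
  assumes h: "integrable lborel h"
  shows "((\<lambda>R. LINT x:{-R..R}|lborel. h x) \<longlongrightarrow> (LINT x|lborel. h x)) at_top"
  unfolding set_lebesgue_integral_def
proof (rule integral_dominated_convergence_at_top[where w="\<lambda>x. norm (h x)"])
  have [measurable]: "h \<in> borel_measurable borel" using h by auto
  show "(\<lambda>x. indicator {-R..R} x *\<^sub>R h x) \<in> borel_measurable lborel" for R by measurable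
  show "AE x in lborel. ((\<lambda>R. indicator {-R..R} x *\<^sub>R h x) \<longlongrightarrow> h x) at_top"
  proof (intro AE_I2)
    fix x
    have "eventually (\<lambda>R. indicator {-R..R} x *\<^sub>R h x = h x) at_top"
      using eventually_ge_at_top[of "\<bar>x\<bar>"] by eventually_elim (auto simp: indicator_def)
    then show "((\<lambda>R. indicator {-R..R} x *\<^sub>R h x) \<longlongrightarrow> h x) at_top" by (rule tendsto_eventually)
  qed
  show "\<forall>\<^sub>F R in at_top. AE x in lborel. norm (indicator {-R..R} x *\<^sub>R h x) \<le> norm (h x)"
    by (intro always_eventually allI AE_I2) (auto simp: indicator_def)
qed (use h in auto)

text \<open>By Tonelli \<open>F\<close> is square integrable over the strip \<open>d \<le> Im w \<le> T\<close>, so the vertical sides of the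
  rectangle can be placed where their contribution to the contour integral is \<open>O(1/R)\<close>.\<close>

lemma hardy_good_verticals:
  assumes F: "hardy_class F" and d: "0 < d" "d \<le> T"
  obtains R where "R \<ge> R0"
    "integral {d..T} (\<lambda>y. (norm (F (Complex R y)))\<^sup>2) \<le> 1"
    "integral {d..T} (\<lambda>y. (norm (F (Complex (-R) y)))\<^sup>2) \<le> 1"
proof -
  have hol: "F holomorphic_on {w. Im w > 0}" using F by (simp add: hardy_class_def)
  obtain K where K: "\<And>y. y > 0 \<Longrightarrow> L2_norm (\<lambda>x. F (Complex x y)) \<le> K"
    using F by (auto simp: hardy_class_def)
  have FL2: "(\<lambda>x. F (Complex x y)) \<in> L2" if "y > 0" for y using F that by (simp add: hardy_class_def)
  have contF: "continuous_on {w. Im w > 0} F" by (rule holomorphic_on_imp_continuous_on[OF hol])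
  \<comment> \<open>Cutting \<open>F\<close> off outside its domain gives a Borel function on the
    whole plane, to which Tonelli's theorem applies.\<close>
  define G where "G w = indicator {w. Im w > 0} w *\<^sub>R F w" for w
  have Gm: "G \<in> borel_measurable borel"
    unfolding G_def
    by (intro borel_measurable_continuous_on_indicator contF) (simp add: open_halfspace_Im_gt)
  have cm: "(\<lambda>(x, y). Complex x y) \<in> borel_measurable (borel \<Otimes>\<^sub>M borel)"
  proof -
    have "continuous_on UNIV (\<lambda>p. Complex (fst p) (snd p))" by (intro continuous_intros)
    then show ?thesis unfolding borel_prod case_prod_beta by (rule borel_measurable_continuous_onI)
  qed
  define H where "H x y = indicator {d..T} y * ennreal ((norm (G (Complex x y)))\<^sup>2)" for x y
  have GC: "(\<lambda>p. G (case p of (x, y) \<Rightarrow> Complex x y)) \<in> borel_measurable (borel \<Otimes>\<^sub>M borel)"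
    by (rule measurable_compose[OF cm Gm])
  have Hm: "case_prod H \<in> borel_measurable (borel \<Otimes>\<^sub>M borel)"
    using GC unfolding H_def case_prod_beta by measurable
  have Hm' [measurable]: "case_prod H \<in> borel_measurable (lborel \<Otimes>\<^sub>M lborel)" using Hm by simp
  define A where "A x = (\<integral>\<^sup>+y. H x y \<partial>lborel)" for x
  have Am [measurable]: "A \<in> borel_measurable borel" unfolding A_def using Hm' by measurable
  have A_eq: "A x = ennreal (integral {d..T} (\<lambda>y. (norm (F (Complex x y)))\<^sup>2))" for x
  proof -
    have c: "continuous_on {d..T} (\<lambda>y. (norm (F (Complex x y)))\<^sup>2)"
      using d by (intro continuous_intros continuous_on_compose2[OF contF]) auto
    have "A x = (\<integral>\<^sup>+y. ennreal ((norm (F (Complex x y)))\<^sup>2) * indicator {d..T} y \<partial>lborel)"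
      unfolding A_def H_def G_def using d by (intro nn_integral_cong) (auto simp: indicator_def)
    also have "\<dots> = ennreal (integral {d..T} (\<lambda>y. (norm (F (Complex x y)))\<^sup>2))"
      by (rule nn_integral_has_integral_lebesgue')
         (use integrable_integral[OF integrable_continuous_real[OF c]] in auto)
    finally show ?thesis .
  qed
  have "(\<integral>\<^sup>+x. A x \<partial>lborel) = (\<integral>\<^sup>+y. \<integral>\<^sup>+x. H x y \<partial>lborel \<partial>lborel)"
    unfolding A_def by (rule lborel_pair.Fubini'[symmetric, OF Hm'])
  also have "\<dots> \<le> (\<integral>\<^sup>+y. ennreal (K\<^sup>2) * indicator {d..T} y \<partial>lborel)"
  proof (rule nn_integral_mono)
    fix y :: real
    show "(\<integral>\<^sup>+x. H x y \<partial>lborel) \<le> ennreal (K\<^sup>2) * indicator {d..T} y"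
    proof (cases "y \<in> {d..T}")
      case True
      then have y: "y > 0" using d by auto
      have "(\<integral>\<^sup>+x. H x y \<partial>lborel) = (\<integral>\<^sup>+x. ennreal ((norm (F (Complex x y)))\<^sup>2) \<partial>lborel)"
        using True y by (simp add: H_def G_def)
      also have "\<dots> = ennreal ((L2_norm (\<lambda>x. F (Complex x y)))\<^sup>2)"
        unfolding L2_norm_power2 by (rule nn_integral_eq_integral) (use L2_integrable[OF FL2[OF y]] in auto)
      also have "\<dots> \<le> ennreal (K\<^sup>2)"
        using K[OF y] by (intro ennreal_leI power_mono) auto
      finally show ?thesis using True by simp
    qed (simp add: H_def)
  qed
  also have "\<dots> < \<infinity>"
    using d by (simp add: nn_integral_cmult_indicator ennreal_mult_less_top)
  finally have fin: "(\<integral>\<^sup>+x. A x \<partial>lborel) < \<infinity>" .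
  have fin': "(\<integral>\<^sup>+x. A x + A (-x) \<partial>lborel) < \<infinity>"
  proof -
    have "(\<integral>\<^sup>+x. A (-x) \<partial>lborel) = (\<integral>\<^sup>+x. A x \<partial>lborel)"
      using nn_integral_real_affine[OF Am, of "-1" 0] by simp
    then show ?thesis using fin by (simp add: nn_integral_add)
  qed
  \<comment> \<open>Otherwise the integrand is at least 1 on an interval of length \<open>n\<close>
    beyond \<open>R0\<close>, for every \<open>n\<close>, contradicting the finite total
    integral.\<close>
  have "\<exists>R\<ge>R0. A R + A (-R) < 1"
  proof (rule ccontr)
    assume "\<not> (\<exists>R\<ge>R0. A R + A (-R) < 1)"
    then have ge: "A R + A (-R) \<ge> 1" if "R \<ge> R0" for R using that by (auto simp: not_less)
    obtain n :: nat where n: "(\<integral>\<^sup>+x. A x + A (-x) \<partial>lborel) < of_nat n"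
      using ennreal_Ex_less_of_nat fin' by auto
    have "of_nat n = emeasure lborel {R0..R0 + real n}"
      by (simp add: ennreal_of_nat_eq_real_of_nat)
    also have "\<dots> = (\<integral>\<^sup>+x. indicator {R0..R0 + real n} x \<partial>lborel)" by simp
    also have "\<dots> \<le> (\<integral>\<^sup>+x. A x + A (-x) \<partial>lborel)"
      by (rule nn_integral_mono) (auto simp: indicator_def intro: ge)
    finally show False using n by simp
  qed
  then obtain R where R: "R \<ge> R0" "A R + A (-R) < 1" by blast
  have "A R \<le> 1" "A (-R) \<le> 1" using R(2)
    by (meson add_increasing add_increasing2 order.trans order_refl zero_le less_imp_le)+
  then show ?thesis using that[OF R(1)] by (simp add: A_eq flip: ennreal_1)
qed

text \<open>Once the vertical sides have been pushed to infinity, the Cauchy integrals along the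
  lines of heights \<open>d\<close> and \<open>T\<close> differ by the residue term. The one at
  height \<open>T\<close> is bounded by a constant times \<open>1 / sqrt (T - Im \<zeta>)\<close>,
  since the norms along horizontal lines are uniformly bounded, and disappears as \<open>T\<close>
  grows. Subtracting \<open>\<i> d\<close> from \<open>\<zeta>\<close> turns an integral along a
  shifted line into one along the real line.\<close>

lemma hardy_shift_cauchy:
  assumes F: "hardy_class F" and d: "0 < d"
    and lam: "Im \<zeta> < 0 \<or> d < Im \<zeta>"
  shows "cauchy_int (\<lambda>x. F (Complex x d)) (\<zeta> - of_real d * \<i>)
    = (if Im \<zeta> < 0 then 0 else 2 * of_real pi * \<i> * F \<zeta>)" (is "?C d = ?v")
proof -
  have hol: "F holomorphic_on {w. Im w > 0}" using F by (simp add: hardy_class_def)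
  have contF: "continuous_on {w. Im w > 0} F" by (rule holomorphic_on_imp_continuous_on[OF hol])
  obtain K where K: "\<And>y. y > 0 \<Longrightarrow> L2_norm (\<lambda>x. F (Complex x y)) \<le> K"
    using F by (auto simp: hardy_class_def)
  have FL2: "(\<lambda>x. F (Complex x y)) \<in> L2" if "y > 0" for y using F that by (simp add: hardy_class_def)
  have shift: "Complex x y - \<zeta> = of_real x - (\<zeta> - of_real y * \<i>)" for x y
    by (simp add: complex_eq_iff)
  have line: "((\<lambda>R. integral {-R..R} (\<lambda>x. F (Complex x y) / (Complex x y - \<zeta>))) \<longlongrightarrow> ?C y) at_top"
    if y: "y > 0" "y \<noteq> Im \<zeta>" for y
  proof -
    have int: "integrable lborel (\<lambda>x. F (Complex x y) / (Complex x y - \<zeta>))"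
      unfolding shift using y by (intro L2_divide_resolvent_integrable FL2) auto
    have "set_integrable lborel {-R..R} (\<lambda>x. F (Complex x y) / (Complex x y - \<zeta>))" for R
      using int by (simp add: set_integrable_def integrable_mult_indicator)
    from set_borel_integral_eq_integral(2)[OF this]
    show ?thesis
      using integral_symmetric_tendsto[OF int] by (simp add: cauchy_int_def shift)
  qed
  have rect: "?C d - ?C T = ?v" if T: "d < T" "Im \<zeta> < T" for T
  proof -
    define B where "B R y = F (Complex R y) / (Complex R y - \<zeta>)" for R y
    have ex: "\<exists>R. R \<ge> \<bar>Re \<zeta>\<bar> + 1 + real n \<and> integral {d..T} (\<lambda>y. (norm (F (Complex R y)))\<^sup>2) \<le> 1 \<and>
        integral {d..T} (\<lambda>y. (norm (F (Complex (-R) y)))\<^sup>2) \<le> 1" for n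
      using hardy_good_verticals[OF F d, of T "\<bar>Re \<zeta>\<bar> + 1 + real n"] T by (metis less_imp_le)
    obtain R where R: "\<And>n. R n \<ge> \<bar>Re \<zeta>\<bar> + 1 + real n"
      "\<And>n. integral {d..T} (\<lambda>y. (norm (F (Complex (R n) y)))\<^sup>2) \<le> 1"
      "\<And>n. integral {d..T} (\<lambda>y. (norm (F (Complex (- R n) y)))\<^sup>2) \<le> 1"
      using ex by metis
    have Rtop: "filterlim R at_top sequentially"
    proof (rule filterlim_at_top_mono[OF filterlim_real_sequentially], intro always_eventually allI)
      show "real n \<le> R n" for n using R(1)[of n] by linarith
    qed
    have vert: "norm (integral {d..T} (B r)) \<le> (T - d + 1) * (1 / real (Suc n))"
      if r: "\<bar>r\<bar> \<ge> \<bar>Re \<zeta>\<bar> + 1 + real n" and i: "integral {d..T} (\<lambda>y. (norm (F (Complex r y)))\<^sup>2) \<le> 1" for r n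
    proof -
      have ge: "norm (Complex r y - \<zeta>) \<ge> real (Suc n)" for y
        using abs_Re_le_cmod[of "Complex r y - \<zeta>"] r by (simp add: abs_if split: if_splits)
      then have nz: "Complex r y - \<zeta> \<noteq> 0" for y by (metis norm_zero not_less of_nat_0_less_iff zero_less_Suc)
      have c: "continuous_on {d..T} (\<lambda>y. F (Complex r y))"
        using d by (intro continuous_on_compose2[OF contF] continuous_intros) auto
      \<comment> \<open>\<open>s \<le> 1 + s^2\<close> turns the bound on the integral of the
        squared modulus into a bound on the integral of the modulus.\<close>
      have le: "norm (B r y) \<le> (1 + (norm (F (Complex r y)))\<^sup>2) * (1 / real (Suc n))" for y
      proof -
        have "norm (F (Complex r y)) \<le> 1 + (norm (F (Complex r y)))\<^sup>2"
          using sum_squares_bound[of 1 "norm (F (Complex r y))"] norm_ge_zero[of "F (Complex r y)"]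
          unfolding power_one mult_1_right by linarith
        moreover have "1 / norm (Complex r y - \<zeta>) \<le> 1 / real (Suc n)"
          using ge[of y] by (intro divide_left_mono) (auto intro!: mult_pos_pos simp: nz)
        ultimately have "norm (F (Complex r y)) * (1 / norm (Complex r y - \<zeta>))
            \<le> (1 + (norm (F (Complex r y)))\<^sup>2) * (1 / real (Suc n))"
          by (intro mult_mono) (auto simp: add_nonneg_nonneg)
        then show ?thesis by (simp add: B_def norm_divide)
      qed
      have "norm (integral {d..T} (B r))
          \<le> integral {d..T} (\<lambda>y. (1 + (norm (F (Complex r y)))\<^sup>2) * (1 / real (Suc n)))"
      proof (rule integral_norm_bound_integral)
        show "B r integrable_on {d..T}"
          unfolding B_def by (intro integrable_continuous_real continuous_intros c) (use nz in auto)
        show "(\<lambda>y. (1 + (norm (F (Complex r y)))\<^sup>2) * (1 / real (Suc n))) integrable_on {d..T}"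
          by (intro integrable_continuous_real continuous_intros c)
      qed (use le in auto)
      also have "\<dots> = (integral {d..T} (\<lambda>y. 1) + integral {d..T} (\<lambda>y. (norm (F (Complex r y)))\<^sup>2)) * (1 / real (Suc n))"
      proof -
        have "(\<lambda>y. (norm (F (Complex r y)))\<^sup>2) integrable_on {d..T}"
          by (intro integrable_continuous_real continuous_intros c)
        then have "integral {d..T} (\<lambda>y. 1 + (norm (F (Complex r y)))\<^sup>2)
            = integral {d..T} (\<lambda>y. 1) + integral {d..T} (\<lambda>y. (norm (F (Complex r y)))\<^sup>2)"
          by (intro Henstock_Kurzweil_Integration.integral_add) auto
        then show ?thesis by (subst integral_mult_left) simp
      qed
      also have "\<dots> \<le> (T - d + 1) * (1 / real (Suc n))"
        using T i by (intro mult_right_mono) auto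
      finally show ?thesis .
    qed
    have lim0: "(\<lambda>n. (T - d + 1) * (1 / real (Suc n))) \<longlonglongrightarrow> 0"
      using tendsto_mult_right_zero[OF LIMSEQ_Suc[OF lim_1_over_n]] by simp
    have V1: "(\<lambda>n. integral {d..T} (B (R n))) \<longlonglongrightarrow> 0"
      by (rule Lim_null_comparison[OF _ lim0])
         (use vert R in \<open>auto intro!: always_eventually simp del: of_nat_Suc dest: order_trans[OF _ abs_ge_self]\<close>)
    have V2: "(\<lambda>n. integral {d..T} (B (- R n))) \<longlonglongrightarrow> 0"
    proof (rule Lim_null_comparison[OF _ lim0], intro always_eventually allI)
      fix n
      show "norm (integral {d..T} (B (- R n))) \<le> (T - d + 1) * (1 / real (Suc n))"
        by (rule vert) (use R(1)[of n] R(3)[of n] in auto)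
    qed
    have "(\<lambda>n. integral {-R n..R n} (\<lambda>x. F (Complex x d) / (Complex x d - \<zeta>))
      + \<i> * integral {d..T} (B (R n))
      - integral {-R n..R n} (\<lambda>x. F (Complex x T) / (Complex x T - \<zeta>))
      - \<i> * integral {d..T} (B (- R n))) \<longlonglongrightarrow> ?C d + \<i> * 0 - ?C T - \<i> * 0"
      using T d lam
      by (intro tendsto_diff tendsto_add tendsto_mult tendsto_const V1 V2
            filterlim_compose[OF line Rtop]) auto
    moreover have "integral {-R n..R n} (\<lambda>x. F (Complex x d) / (Complex x d - \<zeta>))
      + \<i> * integral {d..T} (B (R n))
      - integral {-R n..R n} (\<lambda>x. F (Complex x T) / (Complex x T - \<zeta>))
      - \<i> * integral {d..T} (B (- R n)) = ?v" for n
    proof -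
      have "R n > \<bar>Re \<zeta>\<bar>" using R(1)[of n] by linarith
      then show ?thesis
        unfolding B_def using hardy_rectangle[OF hol, of \<zeta> "R n" d T] d T lam by auto
    qed
    ultimately show ?thesis by (simp add: LIMSEQ_const_iff)
  qed
  have "(?C \<longlongrightarrow> 0) at_top"
  proof (rule Lim_null_comparison)
    show "((\<lambda>T. K * sqrt (pi / (T - Im \<zeta>))) \<longlongrightarrow> 0) at_top" by real_asymp
    show "eventually (\<lambda>T. norm (?C T) \<le> K * sqrt (pi / (T - Im \<zeta>))) at_top"
      using eventually_gt_at_top[of "max 0 (Im \<zeta>)"]
    proof eventually_elim
      case (elim T)
      then have T: "T > 0" "T > Im \<zeta>" by auto
      have "norm (?C T) \<le> L2_norm (\<lambda>x. F (Complex x T)) * sqrt (pi / \<bar>Im (\<zeta> - of_real T * \<i>)\<bar>)"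
        by (rule cauchy_int_bound_L2[OF FL2]) (use T in auto)
      also have "\<dots> \<le> K * sqrt (pi / \<bar>Im (\<zeta> - of_real T * \<i>)\<bar>)"
        by (intro mult_right_mono K) (use T in auto)
      finally show ?case using T by simp
    qed
  qed
  moreover have "eventually (\<lambda>T. ?C T = ?C d - ?v) at_top"
    using eventually_gt_at_top[of "max d (Im \<zeta>)"] by eventually_elim (use rect in \<open>force simp: algebra_simps\<close>)
  then have "(?C \<longlongrightarrow> ?C d - ?v) at_top" by (rule tendsto_eventually)
  ultimately have "?C d - ?v = 0" by (intro tendsto_unique[of at_top ?C]) auto
  then show ?thesis by simp
qed

text \<open>The height \<open>d\<close> tends to 0. While \<open>d\<close> stays below half of
  \<open>\<bar>Im \<zeta>\<bar>\<close>, the shifted point keeps a fixed distance from the line, so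
  convergence in norm to \<open>f\<close> gives convergence of the Cauchy integrals.\<close>

lemma hardy_cauchy_int:
  assumes F: "hardy_class F" and b: "hardy_boundary F f" and f: "f \<in> L2" and lam: "Im \<zeta> \<noteq> 0"
  shows "cauchy_int f \<zeta> = (if Im \<zeta> < 0 then 0 else 2 * of_real pi * \<i> * F \<zeta>)" (is "_ = ?v")
proof -
  have FL2: "(\<lambda>x. F (Complex x y)) \<in> L2" if "y > 0" for y using F that by (simp add: hardy_class_def)
  let ?C = "\<lambda>d. cauchy_int (\<lambda>x. F (Complex x d)) (\<zeta> - of_real d * \<i>)"
  let ?N = "\<lambda>d. L2_norm (\<lambda>x. F (Complex x d) - f x)"
  have ev: "eventually (\<lambda>d. 0 < d \<and> d < \<bar>Im \<zeta>\<bar> / 2) (at_right 0)"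
    using eventually_at_right_real[of 0 "\<bar>Im \<zeta>\<bar> / 2"] lam by (auto elim: eventually_mono)
  have lim1: "((\<lambda>d. ?C d - cauchy_int f (\<zeta> - of_real d * \<i>)) \<longlongrightarrow> 0) (at_right 0)"
  proof (rule Lim_null_comparison)
    have "((\<lambda>d. ?N d * sqrt (pi / (\<bar>Im \<zeta>\<bar> / 2))) \<longlongrightarrow> 0 * sqrt (pi / (\<bar>Im \<zeta>\<bar> / 2))) (at_right 0)"
      using b unfolding hardy_boundary_def by (intro tendsto_mult tendsto_const)
    then show "((\<lambda>d. ?N d * sqrt (pi / (\<bar>Im \<zeta>\<bar> / 2))) \<longlongrightarrow> 0) (at_right 0)" by simp
    show "eventually (\<lambda>d. norm (?C d - cauchy_int f (\<zeta> - of_real d * \<i>)) \<le> ?N d * sqrt (pi / (\<bar>Im \<zeta>\<bar> / 2))) (at_right 0)"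
      using ev
    proof eventually_elim
      case (elim d)
      have Im: "\<bar>Im (\<zeta> - of_real d * \<i>)\<bar> \<ge> \<bar>Im \<zeta>\<bar> / 2" "Im (\<zeta> - of_real d * \<i>) \<noteq> 0"
        using elim by (auto simp: abs_if split: if_splits)
      have "?C d - cauchy_int f (\<zeta> - of_real d * \<i>) = cauchy_int (\<lambda>x. F (Complex x d) - f x) (\<zeta> - of_real d * \<i>)"
        using FL2[of d] f elim Im by (intro cauchy_int_diff[symmetric]) auto
      also have "norm \<dots> \<le> ?N d * sqrt (pi / \<bar>Im (\<zeta> - of_real d * \<i>)\<bar>)"
        using FL2[of d] f elim Im by (intro cauchy_int_bound_L2) auto
      also have "\<dots> \<le> ?N d * sqrt (pi / (\<bar>Im \<zeta>\<bar> / 2))"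
        using Im lam by (intro mult_left_mono real_sqrt_le_mono divide_left_mono) auto
      finally show ?case .
    qed
  qed
  have lim2: "((\<lambda>d. cauchy_int f (\<zeta> - of_real d * \<i>)) \<longlongrightarrow> cauchy_int f \<zeta>) (at_right 0)"
  proof -
    have "((\<lambda>d::real. \<zeta> - of_real d * \<i>) \<longlongrightarrow> \<zeta> - of_real 0 * \<i>) (at_right 0)"
      by (intro tendsto_intros)
    then show ?thesis
      using isCont_tendsto_compose[OF isCont_cauchy_int[OF cauchy_integrable_L2[OF f] lam]] by simp
  qed
  have "eventually (\<lambda>d. ?C d = ?v) (at_right 0)"
    using ev by eventually_elim (rule hardy_shift_cauchy[OF F], use lam in \<open>auto simp: abs_if split: if_splits\<close>)
  then have "(?C \<longlongrightarrow> ?v) (at_right 0)" by (rule tendsto_eventually)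
  moreover have "(?C \<longlongrightarrow> cauchy_int f \<zeta>) (at_right 0)"
    using tendsto_add[OF lim1 lim2] by simp
  ultimately show ?thesis by (intro tendsto_unique[of "at_right 0" ?C]) auto
qed

lemma hardy2_plus_cauchy_int:
  assumes "f \<in> hardy2_plus" "Im \<zeta> \<noteq> 0"
  shows "cauchy_int f \<zeta> = (if Im \<zeta> < 0 then 0 else 2 * of_real pi * \<i> * hardy_ext f \<zeta>)"
proof -
  have ex: "\<exists>F. hardy_class F \<and> hardy_boundary F f" and f: "f \<in> L2"
    using assms(1) by (auto simp: hardy2_plus_def)
  have "hardy_class (hardy_ext f) \<and> hardy_boundary (hardy_ext f) f"
    unfolding hardy_ext_def by (rule someI_ex[OF ex])
  then show ?thesis using hardy_cauchy_int f assms(2) by blast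
qed

lemma cauchy_int_cnj: "cauchy_int (\<lambda>x. cnj (f x)) \<mu> = cnj (cauchy_int f (cnj \<mu>))"
proof -
  have "cauchy_int (\<lambda>x. cnj (f x)) \<mu> = (LINT x|lborel. cnj (f x / (of_real x - cnj \<mu>)))"
    by (simp add: cauchy_int_def)
  also have "\<dots> = cnj (cauchy_int f (cnj \<mu>))" unfolding cauchy_int_def by (rule Bochner_Integration.integral_cnj)
  finally show ?thesis .
qed

text \<open>The bridge from Hardy functions defined by limits along horizontal lines to the
  description by Cauchy integrals; conjugation exchanges the half-planes.\<close>

lemma cnj_hardy_lower:
  assumes "f \<in> hardy2_plus"
  shows "(\<lambda>x. cnj (f x)) \<in> lower_hardy"
    and "Im \<mu> < 0 \<Longrightarrow> lower_ext (\<lambda>x. cnj (f x)) \<mu> = hardy_bar f \<mu>"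
proof -
  have "f \<in> L2" using assms by (simp add: hardy2_plus_def)
  then show "(\<lambda>x. cnj (f x)) \<in> lower_hardy"
    using hardy2_plus_cauchy_int[OF assms] by (auto simp: lower_hardy_def cauchy_int_cnj)
  show "Im \<mu> < 0 \<Longrightarrow> lower_ext (\<lambda>x. cnj (f x)) \<mu> = hardy_bar f \<mu>"
    using hardy2_plus_cauchy_int[OF assms, of "cnj \<mu>"]
    by (simp add: lower_ext_def cauchy_int_cnj hardy_bar_def)
qed

section \<open>The Friedrichs model\<close>

lemma L2_closed_subspace_AE:
  assumes S: "L2_closed_subspace S" and f: "f \<in> S" and g: "g \<in> borel_measurable borel"
    and ae: "AE x in lborel. f x = g x"
  shows "g \<in> S"
proof -
  have fL2: "f \<in> L2" using S f by (auto simp: L2_closed_subspace_def L2_subspace_def)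
  have gL2: "g \<in> L2" by (rule L2_AE_cong[OF fL2 g ae])
  have "L2_norm (\<lambda>x. g x - f x) = 0"
    by (subst L2_norm_eq_0_iff) (use fL2 gL2 ae in auto)
  then have "g \<in> L2_closure S" using f fL2 gL2 unfolding L2_closure_def by auto
  then show ?thesis using S by (auto simp: L2_closed_subspace_def)
qed

lemma L2_closed_subspace_limit:
  assumes S: "L2_closed_subspace S" and f: "f \<in> L2" and h: "\<And>n. h n \<in> S"
    and lim: "(\<lambda>n. L2_norm (\<lambda>x. f x - h n x)) \<longlonglongrightarrow> 0"
  shows "f \<in> S"
proof -
  have "f \<in> L2_closure S" unfolding L2_closure_def
  proof (intro CollectI conjI f allI impI)
    fix e :: real assume "e > 0"
    with lim have "eventually (\<lambda>n. L2_norm (\<lambda>x. f x - h n x) < e) sequentially"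
      by (intro order_tendstoD)
    then obtain n where "L2_norm (\<lambda>x. f x - h n x) < e" by (auto simp: eventually_sequentially)
    then show "\<exists>g\<in>S. g \<in> L2 \<and> L2_norm (\<lambda>x. f x - g x) < e"
      using h[of n] S by (intro bexI[of _ "h n"]) (auto simp: L2_closed_subspace_def L2_subspace_def)
  qed
  then show ?thesis using S by (auto simp: L2_closed_subspace_def)
qed

text \<open>Only the quotients are assumed square integrable, so that the constant function
  \<open>1\<close> is covered as well as \<open>\<psi>\<close>. The resolvent identity makes the
  difference small with \<open>m n - \<mu>\<close>.\<close>

lemma resolvent_L2_continuous:
  assumes h: "\<And>\<mu>. Im \<mu> \<noteq> 0 \<Longrightarrow> (\<lambda>x. h x / (of_real x - \<mu>)) \<in> L2"
    and mu: "Im \<mu> \<noteq> 0" and lim: "m \<longlonglongrightarrow> \<mu>" and m: "\<And>n. Im (m n) \<noteq> 0"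
  shows "(\<lambda>n. L2_norm (\<lambda>x. h x / (of_real x - \<mu>) - h x / (of_real x - m n))) \<longlonglongrightarrow> 0"
proof (rule Lim_null_comparison)
  let ?N = "L2_norm (\<lambda>x. h x / (of_real x - \<mu>))"
  have "(\<lambda>n. norm (m n - \<mu>) * (1 / \<bar>Im (m n)\<bar> * ?N)) \<longlonglongrightarrow> norm (\<mu> - \<mu>) * (1 / \<bar>Im \<mu>\<bar> * ?N)"
    using mu by (intro tendsto_intros lim) auto
  then show "(\<lambda>n. norm (m n - \<mu>) * (1 / \<bar>Im (m n)\<bar> * ?N)) \<longlonglongrightarrow> 0" by simp
  show "eventually (\<lambda>n. norm (L2_norm (\<lambda>x. h x / (of_real x - \<mu>) - h x / (of_real x - m n)))
      \<le> norm (m n - \<mu>) * (1 / \<bar>Im (m n)\<bar> * ?N)) sequentially"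
  proof (intro always_eventually allI)
    fix n
    have "L2_norm (\<lambda>x. h x / (of_real x - \<mu>) - h x / (of_real x - m n))
        = L2_norm (\<lambda>x. h x / (of_real x - m n) - h x / (of_real x - \<mu>))"
      by (rule L2_norm_minus_commute)
    also have "\<dots> = norm (m n - \<mu>) * L2_norm (\<lambda>x. (h x / (of_real x - \<mu>)) / (of_real x - m n))"
      unfolding resolvent_identity[OF mu m] by (rule L2_norm_cmult)
    also have "\<dots> \<le> norm (m n - \<mu>) * (1 / \<bar>Im (m n)\<bar> * ?N)"
      by (intro mult_left_mono L2_norm_divide_resolvent h mu m) auto
    finally show "norm (L2_norm (\<lambda>x. h x / (of_real x - \<mu>) - h x / (of_real x - m n)))
      \<le> norm (m n - \<mu>) * (1 / \<bar>Im (m n)\<bar> * ?N)" by simp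
  qed
qed

section \<open>The operator domain and the boundary functionals\<close>

lemma coef_eq:
  assumes "(\<lambda>x. of_real x * f x - c) \<in> L2"
  shows "coef f = c"
  unfolding coef_def
proof (rule the_equality)
  show "(\<lambda>x. of_real x * f x - c) \<in> L2" by (rule assms)
next
  fix d assume "(\<lambda>x. of_real x * f x - d) \<in> L2"
  from L2_diff[OF assms this] have "(\<lambda>x::real. d - c) \<in> L2" by simp
  then show "d = c" by (simp only: const_in_L2_iff) simp
qed

lemma mdomE:
  assumes "u \<in> mdom"
  shows "u \<in> L2" "(\<lambda>x. of_real x * u x - coef u) \<in> L2"
proof -
  obtain c where c: "(\<lambda>x. of_real x * u x - c) \<in> L2" and "u \<in> L2"
    using assms by (auto simp: mdom_def)
  then show "u \<in> L2" "(\<lambda>x. of_real x * u x - coef u) \<in> L2" using coef_eq[OF c] by auto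
qed

lemma quotient_L2:
  assumes "v \<in> L2" "Im \<mu> \<noteq> 0"
  shows "(\<lambda>x. (v x + c) / (of_real x - \<mu>)) \<in> L2"
  using L2_add[OF L2_divide_resolvent[OF assms] L2_cmult[OF resolvent_L2[OF assms(2)], of c]]
  by (simp add: add_divide_distrib)

text \<open>For \<open>u = (v + c) / (x - \<mu>)\<close> one has
  \<open>x * u - c = v + \<mu> * u\<close>, which is square integrable; this yields membership and
  coefficient together.\<close>

lemma quotient_mdom:
  assumes "v \<in> L2" "Im \<mu> \<noteq> 0"
  shows "(\<lambda>x. (v x + c) / (of_real x - \<mu>)) \<in> mdom" "coef (\<lambda>x. (v x + c) / (of_real x - \<mu>)) = c"
proof -
  let ?u = "\<lambda>x. (v x + c) / (of_real x - \<mu>)"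
  have u: "?u \<in> L2" by (rule quotient_L2[OF assms])
  have "of_real x * ?u x - c = v x + \<mu> * ?u x" for x
    using real_minus_nonzero[OF assms(2), of x] by (simp add: divide_simps) (simp add: algebra_simps)
  then have eq: "(\<lambda>x. of_real x * ?u x - c) = (\<lambda>x. v x + \<mu> * ?u x)" by auto
  have "(\<lambda>x. v x + \<mu> * ?u x) \<in> L2" using assms(1) u by (intro L2_add L2_cmult)
  then have *: "(\<lambda>x. of_real x * ?u x - c) \<in> L2" by (simp only: eq)
  show "coef ?u = c" by (rule coef_eq[OF *])
  show "?u \<in> mdom" unfolding mdom_def using * u by blast
qed

text \<open>The value of \<open>\<Gamma>\<^sub>1\<close> on the resolvent kernel; symmetrising the integrand shows that the limit exists,
  and its value \<open>\<plusminus>\<pi>\<i>\<close> is irrelevant because \<open>B\<close> may be chosen freely.\<close>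

definition pv_kernel :: "complex \<Rightarrow> complex" where
  "pv_kernel \<mu> = (LINT x|lborel. \<mu> * (1 / (of_real x - \<mu>) * (1 / (of_real x - (- \<mu>)))))"

lemma pv_kernel_tendsto:
  assumes "Im \<mu> \<noteq> 0"
  shows "((\<lambda>R. LINT x:{-R..R}|lborel. 1 / (of_real x - \<mu>)) \<longlongrightarrow> pv_kernel \<mu>) at_top"
proof -
  have m: "Im (- \<mu>) \<noteq> 0" using assms by simp
  let ?h = "\<lambda>x. \<mu> * (1 / (of_real x - \<mu>) * (1 / (of_real x - (- \<mu>))))"
  have int: "integrable lborel ?h"
    using L2_mult_integrable[OF resolvent_L2[OF assms] resolvent_L2[OF m]] by (rule integrable_mult_right)
  have cont: "continuous_on {-R..R} (\<lambda>x. 1 / (of_real x - \<nu>))" if "Im \<nu> \<noteq> 0" for \<nu> and R :: real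
    using real_minus_nonzero[OF that] by (intro continuous_intros) auto
  have si: "integrable lborel (\<lambda>x. indicator {-R..R} x *\<^sub>R (1 / (of_real x - \<nu>)))" if "Im \<nu> \<noteq> 0" for \<nu> and R :: real
    using borel_integrable_atLeastAtMost'[OF cont[OF that, of R]] by (simp add: set_integrable_def)
  have eq: "(LINT x:{-R..R}|lborel. 1 / (of_real x - \<mu>)) = (LINT x:{-R..R}|lborel. ?h x)" for R :: real
  proof -
    let ?k = "\<lambda>\<nu> x. indicator {-R..R} x *\<^sub>R (1 / (of_real x - \<nu>)) :: complex"
    have "(LINT x|lborel. ?k \<mu> x) = (LINT x|lborel. ?k \<mu> (- x))"
      using lborel_integral_real_affine[of "-1" "?k \<mu>" 0] by simp
    also have "(\<lambda>x. ?k \<mu> (- x)) = (\<lambda>x. - ?k (- \<mu>) x)"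
    proof
      fix x
      have "1 / (complex_of_real (- x) - \<mu>) = - (1 / (of_real x - (- \<mu>)))"
        by (simp add: minus_divide_right)
      moreover have "indicator {-R..R} (- x) = (indicator {-R..R} x :: real)" by (auto simp: indicator_def)
      ultimately show "?k \<mu> (- x) = - ?k (- \<mu>) x" by (simp only: scaleR_minus_right)
    qed
    finally have "(LINT x|lborel. ?k \<mu> x) = (LINT x|lborel. - ?k (- \<mu>) x)" .
    then have "2 * (LINT x|lborel. ?k \<mu> x) = (LINT x|lborel. ?k \<mu> x) + (LINT x|lborel. - ?k (- \<mu>) x)"
      by simp
    also have "\<dots> = (LINT x|lborel. ?k \<mu> x + - ?k (- \<mu>) x)"
      by (rule Bochner_Integration.integral_add[symmetric]) (use si[OF assms] si[OF m] in auto)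
    also have "(\<lambda>x. ?k \<mu> x + - ?k (- \<mu>) x) = (\<lambda>x. 2 * (indicator {-R..R} x *\<^sub>R ?h x))"
    proof
      fix x
      show "?k \<mu> x + - ?k (- \<mu>) x = 2 * (indicator {-R..R} x *\<^sub>R ?h x)"
        using real_minus_nonzero[OF assms, of x] real_minus_nonzero[OF m, of x]
        by (simp add: indicator_def divide_simps)
    qed
    also have "(LINT x|lborel. 2 * (indicator {-R..R} x *\<^sub>R ?h x)) = 2 * (LINT x|lborel. indicator {-R..R} x *\<^sub>R ?h x)"
      by (rule integral_mult_right_zero)
    finally show ?thesis by (simp add: set_lebesgue_integral_def)
  qed
  show ?thesis
    unfolding eq pv_kernel_def by (rule integral_symmetric_tendsto[OF int])
qed

lemma Gamma1_AE_cong: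
  assumes "u \<in> borel_measurable borel" "v \<in> borel_measurable borel" "AE x in lborel. u x = v x"
  shows "Gamma1 u = Gamma1 v"
proof -
  have [measurable]: "u \<in> borel_measurable borel" "v \<in> borel_measurable borel" using assms by auto
  have "(LINT x:{-R..R}|lborel. u x) = (LINT x:{-R..R}|lborel. v x)" for R
    unfolding set_lebesgue_integral_def
    by (intro integral_cong_AE) (use assms in \<open>auto elim: eventually_mono\<close>)
  then show ?thesis by (simp add: Gamma1_def)
qed

lemma Gamma1_quotient:
  assumes "v \<in> L2" "Im \<mu> \<noteq> 0"
  shows "Gamma1 (\<lambda>x. (v x + c) / (of_real x - \<mu>)) = cauchy_int v \<mu> + c * pv_kernel \<mu>"
proof -
  have int: "integrable lborel (\<lambda>x. v x / (of_real x - \<mu>))"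
    using assms by (rule L2_divide_resolvent_integrable)
  have cont: "continuous_on {-R..R} (\<lambda>x. 1 / (of_real x - \<mu>))" for R :: real
    using real_minus_nonzero[OF assms(2)] by (intro continuous_intros) auto
  have si: "set_integrable lborel {-R..R} (\<lambda>x. c * (1 / (of_real x - \<mu>)))" for R
    using borel_integrable_atLeastAtMost'[OF cont[of R]] by (intro set_integrable_mult_right) auto
  have eq: "(LINT x:{-R..R}|lborel. (v x + c) / (of_real x - \<mu>))
      = (LINT x:{-R..R}|lborel. v x / (of_real x - \<mu>)) + c * (LINT x:{-R..R}|lborel. 1 / (of_real x - \<mu>))" for R
  proof -
    have "(\<lambda>x. (v x + c) / (of_real x - \<mu>)) = (\<lambda>x. v x / (of_real x - \<mu>) + c * (1 / (of_real x - \<mu>)))"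
      by (simp add: add_divide_distrib)
    moreover have "set_integrable lborel {-R..R} (\<lambda>x. v x / (of_real x - \<mu>))"
      using int by (simp add: set_integrable_def integrable_mult_indicator)
    ultimately show ?thesis using si[of R] by (simp only: set_integral_add set_integral_mult_right)
  qed
  have "((\<lambda>R. LINT x:{-R..R}|lborel. (v x + c) / (of_real x - \<mu>)) \<longlongrightarrow> cauchy_int v \<mu> + c * pv_kernel \<mu>) at_top"
    unfolding eq cauchy_int_def
    by (intro tendsto_add tendsto_mult tendsto_const integral_symmetric_tendsto int pv_kernel_tendsto assms)
  then show ?thesis unfolding Gamma1_def by (intro tendsto_Lim) auto
qed

lemma Gamma1_integrable: "integrable lborel u \<Longrightarrow> Gamma1 u = (LINT x|lborel. u x)"
  unfolding Gamma1_def by (intro tendsto_Lim integral_symmetric_tendsto) auto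

section \<open>Solutions of the resolvent equation\<close>

locale friedrichs =
  fixes \<phi> \<psi> :: "real \<Rightarrow> complex"
  assumes phi: "\<phi> \<in> hardy2_plus" and psi: "\<psi> \<in> hardy2_plus"
begin

lemma phi_L2: "\<phi> \<in> L2" and psi_L2: "\<psi> \<in> L2"
  using phi psi by (auto simp: hardy2_plus_def)

lemma measurable_phi_psi [measurable]:
  "\<phi> \<in> borel_measurable borel" "\<psi> \<in> borel_measurable borel"
  "(\<lambda>x. cnj (\<phi> x)) \<in> borel_measurable borel"
  using phi_L2 psi_L2 L2_cnj[OF phi_L2] by (auto intro: L2_measurable)

abbreviation "D \<equiv> D_fun \<phi> \<psi>"
abbreviation "b \<equiv> cauchy_int (\<lambda>x. cnj (\<phi> x))"

lemma D_eq: "D \<mu> = 1 + cauchy_int (\<lambda>x. \<psi> x * cnj (\<phi> x)) \<mu>"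
  by (simp add: D_fun_def cauchy_int_def)

lemma b_upper: "Im \<mu> > 0 \<Longrightarrow> b \<mu> = 0"
  using lower_hardy_cauchy_int[OF cnj_hardy_lower(1)[OF phi]] .

lemma b_lower: "Im \<mu> < 0 \<Longrightarrow> b \<mu> = - (2 * of_real pi * \<i>) * hardy_bar \<phi> \<mu>"
  using cnj_hardy_lower(2)[OF phi] by (simp add: cauchy_int_lower_ext)

lemma psi_lower: "Im \<mu> < 0 \<Longrightarrow> cauchy_int \<psi> \<mu> = 0"
  using hardy2_plus_cauchy_int[OF psi, of \<mu>] by simp

text \<open>The two factors live in opposite half-planes. This relation uncouples the two linear
  equations for \<open>s\<close> and \<open>c\<close>, so that solving them for \<open>s\<close>
  only divides by \<open>D \<mu>\<close>.\<close>

lemma b_psi_zero: "Im \<mu> \<noteq> 0 \<Longrightarrow> b \<mu> * cauchy_int \<psi> \<mu> = 0"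
  by (cases "Im \<mu> > 0") (auto simp: b_upper psi_lower)

lemma product_integrable: "g \<in> L2 \<Longrightarrow> integrable lborel (\<lambda>x. g x * cnj (\<phi> x))"
  by (rule L2_inner_integrable[OF _ phi_L2])

lemma inner_quotient:
  assumes g: "g \<in> L2" and mu: "Im \<mu> \<noteq> 0"
  shows "L2_inner (\<lambda>x. (g x - s * \<psi> x + c) / (of_real x - \<mu>)) \<phi>
    = cauchy_int (\<lambda>x. g x * cnj (\<phi> x)) \<mu> + c * b \<mu> - s * (D \<mu> - 1)"
proof -
  have i: "integrable lborel (\<lambda>x. g x * cnj (\<phi> x) / (of_real x - \<mu>))"
    "integrable lborel (\<lambda>x. \<psi> x * cnj (\<phi> x) / (of_real x - \<mu>))"
    "integrable lborel (\<lambda>x. cnj (\<phi> x) / (of_real x - \<mu>))"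
    using cauchy_integrable_divide[OF cauchy_integrable_L1[OF product_integrable[OF g]] mu]
      cauchy_integrable_divide[OF cauchy_integrable_L1[OF product_integrable[OF psi_L2]] mu]
      L2_divide_resolvent_integrable[OF L2_cnj[OF phi_L2] mu] by auto
  have "L2_inner (\<lambda>x. (g x - s * \<psi> x + c) / (of_real x - \<mu>)) \<phi>
    = (LINT x|lborel. g x * cnj (\<phi> x) / (of_real x - \<mu>) - s * (\<psi> x * cnj (\<phi> x) / (of_real x - \<mu>))
        + c * (cnj (\<phi> x) / (of_real x - \<mu>)))"
    unfolding L2_inner_def
    by (intro Bochner_Integration.integral_cong refl)
       (simp add: diff_divide_distrib add_divide_distrib algebra_simps)
  also have "\<dots> = (LINT x|lborel. g x * cnj (\<phi> x) / (of_real x - \<mu>) - s * (\<psi> x * cnj (\<phi> x) / (of_real x - \<mu>)))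
        + (LINT x|lborel. c * (cnj (\<phi> x) / (of_real x - \<mu>)))"
    using i by (intro Bochner_Integration.integral_add Bochner_Integration.integrable_diff integrable_mult_right)
  also have "(LINT x|lborel. g x * cnj (\<phi> x) / (of_real x - \<mu>) - s * (\<psi> x * cnj (\<phi> x) / (of_real x - \<mu>)))
     = (LINT x|lborel. g x * cnj (\<phi> x) / (of_real x - \<mu>)) - (LINT x|lborel. s * (\<psi> x * cnj (\<phi> x) / (of_real x - \<mu>)))"
    using i by (intro Bochner_Integration.integral_diff integrable_mult_right)
  finally show ?thesis
    unfolding integral_mult_right_zero by (simp add: D_eq cauchy_int_def)
qed

text \<open>Solutions of \<open>(A - \<mu>) u = g\<close> are the functions \<open>(g - s \<psi> + c) / (x - \<mu>)\<close> with \<open>c = \<Gamma>\<^sub>2 u\<close> and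
  \<open>s = \<langle>u, \<phi>\<rangle>\<close>, subject to the consistency condition on \<open>s\<close>.\<close>

lemma solution_exists:
  fixes s c :: complex
  assumes g: "g \<in> L2" and mu: "Im \<mu> \<noteq> 0"
    and s: "s * D \<mu> = cauchy_int (\<lambda>x. g x * cnj (\<phi> x)) \<mu> + c * b \<mu>"
  defines "u \<equiv> \<lambda>x. (g x - s * \<psi> x + c) / (of_real x - \<mu>)"
  shows "u \<in> mdom" "coef u = c" "L2_inner u \<phi> = s" "Atilde \<phi> \<psi> u x - \<mu> * u x = g x"
    "Gamma1 u = cauchy_int g \<mu> - s * cauchy_int \<psi> \<mu> + c * pv_kernel \<mu>"
proof -
  have v: "(\<lambda>x. g x - s * \<psi> x) \<in> L2" using g psi_L2 by (intro L2_diff L2_cmult)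
  show "u \<in> mdom" and c: "coef u = c" unfolding u_def using quotient_mdom[OF v mu] by auto
  show s': "L2_inner u \<phi> = s"
    unfolding u_def inner_quotient[OF g mu] using s by (simp add: algebra_simps)
  show "Atilde \<phi> \<psi> u x - \<mu> * u x = g x"
    unfolding Atilde_def s' c using real_minus_nonzero[OF mu, of x]
    by (simp add: u_def divide_simps) (simp add: algebra_simps)
  show "Gamma1 u = cauchy_int g \<mu> - s * cauchy_int \<psi> \<mu> + c * pv_kernel \<mu>"
    unfolding u_def Gamma1_quotient[OF v mu]
    using g psi_L2 mu by (simp add: cauchy_int_diff cauchy_integrable_L2 L2_cmult cauchy_int_cmult)
qed

lemma solution_form:
  assumes u: "u \<in> mdom" and g: "g \<in> L2" and mu: "Im \<mu> \<noteq> 0"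
    and eq: "AE x in lborel. Atilde \<phi> \<psi> u x - \<mu> * u x = g x"
  defines "s \<equiv> L2_inner u \<phi>" and "c \<equiv> coef u"
  shows "AE x in lborel. u x = (g x - s * \<psi> x + c) / (of_real x - \<mu>)"
    "s * D \<mu> = cauchy_int (\<lambda>x. g x * cnj (\<phi> x)) \<mu> + c * b \<mu>"
    "Gamma1 u = cauchy_int g \<mu> - s * cauchy_int \<psi> \<mu> + c * pv_kernel \<mu>"
proof -
  let ?w = "\<lambda>x. (g x - s * \<psi> x + c) / (of_real x - \<mu>)"
  have v: "(\<lambda>x. g x - s * \<psi> x) \<in> L2" using g psi_L2 by (intro L2_diff L2_cmult)
  have uL2: "u \<in> L2" by (rule mdomE[OF u])
  have wL2: "?w \<in> L2" by (rule quotient_L2[OF v mu])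
  show ae: "AE x in lborel. u x = ?w x"
    using eq
  proof eventually_elim
    case (elim x)
    then have "(of_real x - \<mu>) * u x = g x - s * \<psi> x + c"
      by (simp add: Atilde_def s_def c_def algebra_simps)
    then show ?case using real_minus_nonzero[OF mu, of x] by (simp add: field_simps)
  qed
  have "s = L2_inner ?w \<phi>"
    unfolding s_def by (rule L2_inner_cong_AE[OF uL2 wL2[unfolded s_def] phi_L2 ae[unfolded s_def]])
  then show "s * D \<mu> = cauchy_int (\<lambda>x. g x * cnj (\<phi> x)) \<mu> + c * b \<mu>"
    unfolding inner_quotient[OF g mu] by (simp add: algebra_simps)
  have "Gamma1 u = Gamma1 ?w"
    by (rule Gamma1_AE_cong[OF L2_measurable[OF uL2] L2_measurable[OF wL2] ae])
  then show "Gamma1 u = cauchy_int g \<mu> - s * cauchy_int \<psi> \<mu> + c * pv_kernel \<mu>"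
    unfolding Gamma1_quotient[OF v mu]
    using g psi_L2 mu by (simp add: cauchy_int_diff cauchy_integrable_L2 L2_cmult cauchy_int_cmult)
qed

lemma Atilde_L2:
  assumes "u \<in> mdom"
  shows "(\<lambda>x. Atilde \<phi> \<psi> u x - l * u x) \<in> L2"
  unfolding Atilde_def by (intro L2_diff L2_add L2_cmult mdomE assms psi_L2)

text \<open>With this \<open>B\<close> the boundary condition becomes
  \<open>c = cauchy_int g \<mu> - s * cauchy_int \<psi> \<mu>\<close>. Inserted into the consistency
  condition, the term with \<open>b \<mu> * cauchy_int \<psi> \<mu>\<close> drops out and
  \<open>s\<close> is found by dividing by \<open>D \<mu>\<close>.\<close>

lemma resolvent_setI:
  assumes mu: "Im \<mu> \<noteq> 0" and D: "D \<mu> \<noteq> 0"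
  shows "\<mu> \<in> resolvent_set \<phi> \<psi> (pv_kernel \<mu> + 1)"
proof -
  let ?B = "pv_kernel \<mu> + 1"
  let ?a = "\<lambda>g. cauchy_int (\<lambda>x. g x * cnj (\<phi> x)) \<mu>"
  let ?\<beta> = "cauchy_int \<psi> \<mu>"
  have bb: "b \<mu> * ?\<beta> = 0" by (rule b_psi_zero[OF mu])
  have sol: "s = (?a g + b \<mu> * cauchy_int g \<mu>) / D \<mu>" "c = cauchy_int g \<mu> - s * ?\<beta>"
    if f: "f \<in> dom_AB ?B" and g: "g \<in> L2" and eq: "AE x in lborel. Atilde \<phi> \<psi> f x - \<mu> * f x = g x"
      and sc: "s = L2_inner f \<phi>" "c = coef f" for f g s c
  proof -
    have fm: "f \<in> mdom" and G: "Gamma1 f = ?B * c" using f sc by (auto simp: dom_AB_def Gamma2_def)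
    note F = solution_form[OF fm g mu eq, folded sc]
    show c: "c = cauchy_int g \<mu> - s * ?\<beta>" using F(3) G by (simp add: algebra_simps)
    have "c * b \<mu> = b \<mu> * cauchy_int g \<mu> - s * (b \<mu> * ?\<beta>)" unfolding c by (simp add: algebra_simps)
    then have "s * D \<mu> = ?a g + b \<mu> * cauchy_int g \<mu>" using F(2) bb by simp
    then show "s = (?a g + b \<mu> * cauchy_int g \<mu>) / D \<mu>" using D by (simp add: field_simps)
  qed
  have surj: "\<exists>f\<in>dom_AB ?B. AE x in lborel. Atilde \<phi> \<psi> f x - \<mu> * f x = g x" if g: "g \<in> L2" for g
  proof -
    define s where "s = (?a g + b \<mu> * cauchy_int g \<mu>) / D \<mu>"
    define c where "c = cauchy_int g \<mu> - s * ?\<beta>"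
    have "c * b \<mu> = b \<mu> * cauchy_int g \<mu> - s * (b \<mu> * ?\<beta>)" unfolding c_def by (simp add: algebra_simps)
    then have "c * b \<mu> = b \<mu> * cauchy_int g \<mu>" by (simp only: bb mult_zero_right diff_0_right)
    moreover have "s * D \<mu> = ?a g + b \<mu> * cauchy_int g \<mu>" using D by (simp add: s_def)
    ultimately have s: "s * D \<mu> = ?a g + c * b \<mu>" by (simp only:)
    note S = solution_exists[OF g mu s]
    show ?thesis
    proof (intro bexI AE_I2)
      have "Gamma1 (\<lambda>x. (g x - s * \<psi> x + c) / (of_real x - \<mu>)) = ?B * c"
        unfolding S(5) c_def[symmetric] by (simp add: algebra_simps)
      then show "(\<lambda>x. (g x - s * \<psi> x + c) / (of_real x - \<mu>)) \<in> dom_AB ?B"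
        using S(1) unfolding dom_AB_def Gamma2_def by (simp only: S(2) mem_Collect_eq simp_thms)
    qed (rule S(4))
  qed
  have inj: "AE x in lborel. f x = 0"
    if f: "f \<in> dom_AB ?B" and eq: "AE x in lborel. Atilde \<phi> \<psi> f x - \<mu> * f x = 0" for f
  proof -
    have z: "L2_inner f \<phi> = 0" "coef f = 0"
      using sol[OF f L2_zero eq refl refl] by (simp_all add: cauchy_int_def)
    have "f \<in> mdom" using f by (simp add: dom_AB_def)
    from solution_form(1)[OF this L2_zero mu eq] show ?thesis by (simp add: z)
  qed
  have bd: "\<exists>C. \<forall>f\<in>dom_AB ?B. L2_norm f \<le> C * L2_norm (\<lambda>x. Atilde \<phi> \<psi> f x - \<mu> * f x)"
  proof -
    let ?k = "1 / \<bar>Im \<mu>\<bar>"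
    \<comment> \<open>Per unit of the norm of \<open>g\<close>, \<open>Kg\<close> bounds its Cauchy
      integral, \<open>Ka\<close> that of \<open>g * cnj \<phi>\<close>, and \<open>Ks\<close> and
      \<open>Kc\<close> bound the resulting \<open>s\<close> and \<open>c\<close>.\<close>
    define Kg where "Kg = sqrt (pi / \<bar>Im \<mu>\<bar>)"
    define Ka where "Ka = L2_norm (\<lambda>x. cnj (\<phi> x) / (of_real x - \<mu>))"
    define Ks where "Ks = (Ka + norm (b \<mu>) * Kg) / norm (D \<mu>)"
    define Kc where "Kc = Kg + Ks * norm ?\<beta>"
    have nn0: "Kg \<ge> 0" "Ka \<ge> 0" "Ks \<ge> 0" by (simp_all add: Kg_def Ka_def Ks_def)
    then have nn: "Kg \<ge> 0" "Ks \<ge> 0" "Kc \<ge> 0" by (simp_all add: Kc_def)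
    have "L2_norm f \<le> (?k + Ks * (?k * L2_norm \<psi>) + Kc * Kg) * L2_norm (\<lambda>x. Atilde \<phi> \<psi> f x - \<mu> * f x)"
      if f: "f \<in> dom_AB ?B" for f
    proof -
      define g where "g x = Atilde \<phi> \<psi> f x - \<mu> * f x" for x
      have fm: "f \<in> mdom" using f by (simp add: dom_AB_def)
      have g: "g \<in> L2" unfolding g_def[abs_def] by (rule Atilde_L2[OF fm])
      have eq: "AE x in lborel. Atilde \<phi> \<psi> f x - \<mu> * f x = g x" by (simp add: g_def)
      define s where "s = L2_inner f \<phi>"
      define c where "c = coef f"
      note F = sol[OF f g eq s_def c_def]
      let ?n = "L2_norm g"
      have 1: "norm (cauchy_int g \<mu>) \<le> ?n * Kg" unfolding Kg_def by (rule cauchy_int_bound_L2[OF g mu])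
      have 2: "norm (?a g) \<le> ?n * Ka"
        using L2_norm_integral_le[OF g L2_divide_resolvent[OF L2_cnj[OF phi_L2] mu]]
        by (simp add: cauchy_int_def Ka_def)
      have 3: "norm s \<le> ?n * Ks"
      proof -
        have "norm s = norm (?a g + b \<mu> * cauchy_int g \<mu>) / norm (D \<mu>)" unfolding F(1) by (rule norm_divide)
        also have "norm (?a g + b \<mu> * cauchy_int g \<mu>) \<le> norm (?a g) + norm (b \<mu>) * norm (cauchy_int g \<mu>)"
          by (metis norm_mult norm_triangle_ineq)
        also have "\<dots> \<le> ?n * Ka + norm (b \<mu>) * (?n * Kg)"
          by (intro add_mono 2 mult_left_mono 1) auto
        also have "\<dots> / norm (D \<mu>) = ?n * Ks" by (simp add: Ks_def field_simps)
        finally show ?thesis by (simp add: divide_right_mono)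
      qed
      have 4: "norm c \<le> ?n * Kc"
      proof -
        have "norm c \<le> norm (cauchy_int g \<mu>) + norm s * norm ?\<beta>"
          unfolding F(2) by (metis norm_mult norm_triangle_ineq4)
        also have "\<dots> \<le> ?n * Kg + (?n * Ks) * norm ?\<beta>" by (intro add_mono 1 mult_right_mono 3) auto
        finally show ?thesis by (simp add: Kc_def algebra_simps)
      qed
      let ?f1 = "\<lambda>x. g x / (of_real x - \<mu>)" and ?f2 = "\<lambda>x. (- s) * (\<psi> x / (of_real x - \<mu>))"
        and ?f3 = "\<lambda>x. c * (1 / (of_real x - \<mu>))"
      have L: "?f1 \<in> L2" "?f2 \<in> L2" "?f3 \<in> L2"
        using g psi_L2 mu by (intro L2_cmult L2_divide_resolvent resolvent_L2; simp)+
      have "AE x in lborel. f x = (?f1 x + ?f2 x) + ?f3 x"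
        using solution_form(1)[OF fm g mu eq, folded s_def c_def]
        by eventually_elim (simp add: add_divide_distrib diff_divide_distrib)
      then have "L2_norm f = L2_norm (\<lambda>x. (?f1 x + ?f2 x) + ?f3 x)"
        by (intro L2_norm_AE_cong) (use L mdomE(1)[OF fm] in \<open>auto intro!: L2_measurable L2_add\<close>)
      also have "\<dots> \<le> (L2_norm ?f1 + L2_norm ?f2) + L2_norm ?f3"
        using L2_norm_triangle[OF L2_add[OF L(1,2)] L(3)] L2_norm_triangle[OF L(1,2)] by linarith
      also have "\<dots> \<le> (?k * ?n + (?n * Ks) * (?k * L2_norm \<psi>)) + (?n * Kc) * Kg"
        unfolding L2_norm_cmult Kg_def L2_norm_resolvent[OF mu] norm_minus_cancel
        by (intro add_mono mult_mono L2_norm_divide_resolvent g psi_L2 mu 3 4[unfolded Kg_def]) (use nn in auto)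
      finally show ?thesis unfolding g_def[symmetric] by (simp add: algebra_simps)
    qed
    then show ?thesis by blast
  qed
  show ?thesis unfolding resolvent_set_def using surj inj bd by blast
qed

end

text \<open>Three disjoint intervals near \<open>l\<close> suffice: two linear conditions leave a nontrivial combination.\<close>

lemma local_test_function:
  fixes h :: "real \<Rightarrow> complex"
  assumes h: "h \<in> L2" and e: "e > 0"
  obtains f where "f \<in> L2" "integrable lborel f" "\<And>x. \<bar>x - l\<bar> \<ge> e \<Longrightarrow> f x = 0"
    "(LINT x|lborel. f x) = 0" "(LINT x|lborel. f x * h x) = 0" "L2_norm f > 0"
proof -
  \<comment> \<open>Three adjacent intervals of length \<open>e / 4\<close> to the right of
    \<open>l\<close> stay within distance \<open>e\<close> of it.\<close>
  define d where "d = e / 4"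
  define I where "I k = {l + real k * d..<l + real (Suc k) * d}" for k
  define q where "q k = (LINT x|lborel. indicator (I k) x *\<^sub>R h x)" for k
  have d: "d > 0" using e by (simp add: d_def)
  have disj: "x \<notin> I j" if "x \<in> I k" "j < k" for x j k
  proof -
    have "real (Suc j) * d \<le> real k * d" using that(2) d by (intro mult_right_mono) auto
    then show ?thesis using that(1) by (auto simp: I_def)
  qed
  have near: "\<bar>x - l\<bar> < e" if "x \<in> I k" "k < 3" for x k
  proof -
    have "real (Suc k) * d \<le> 3 * d" using that(2) d by (intro mult_right_mono) auto
    moreover have "0 \<le> real k * d" using d by simp
    moreover have "l + real k * d \<le> x" "x < l + real (Suc k) * d" "4 * d = e"
      using that(1) by (auto simp: I_def d_def)
    ultimately show ?thesis using d by linarith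
  qed
  have hm [measurable]: "h \<in> borel_measurable borel" using h by (rule L2_measurable)
  have Im [measurable]: "I k \<in> sets borel" for k by (simp add: I_def)
  have eI: "emeasure lborel (I k) = ennreal d" for k
    unfolding I_def using d by (subst emeasure_lborel_Ico) (auto simp: algebra_simps)
  have iI: "integrable lborel (indicator (I k) :: real \<Rightarrow> real)" for k
    using eI[of k] by (intro integrable_real_indicator) auto
  have LI: "(LINT x|lborel. indicator (I k) x :: real) = d" for k
    using eI[of k] d by (simp add: measure_def)
  have indL2: "(\<lambda>x. complex_of_real (indicator (I k) x)) \<in> L2" for k
  proof (rule L2_I)
    have "(\<lambda>x. (norm (complex_of_real (indicator (I k) x)))\<^sup>2) = (indicator (I k) :: real \<Rightarrow> real)"
      by (auto simp: indicator_def)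
    then show "integrable lborel (\<lambda>x. (norm (complex_of_real (indicator (I k) x)))\<^sup>2)" using iI by simp
  qed measurable
  have ih: "integrable lborel (\<lambda>x. complex_of_real (indicator (I k) x) * h x)" for k
    by (rule L2_mult_integrable[OF indL2 h])
  have qk: "(LINT x|lborel. complex_of_real (indicator (I k) x) * h x) = q k" for k
    by (simp add: q_def scaleR_conv_of_real)
  \<comment> \<open>A nonzero vector with vanishing bilinear product against
    \<open>(1, 1, 1)\<close> and \<open>(q 0, q 1, q 2)\<close>: their cross product up to sign, or
    \<open>(1, -1, 0)\<close> if they are parallel.\<close>
  obtain a0 a1 a2 :: complex where a: "a0 + a1 + a2 = 0" "a0 * q 0 + a1 * q 1 + a2 * q 2 = 0"
    "a0 \<noteq> 0 \<or> a1 \<noteq> 0 \<or> a2 \<noteq> 0"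
  proof (cases "q 0 = q 1 \<and> q 1 = q 2")
    case True
    then show ?thesis using that[of 1 "-1" 0] by simp
  next
    case False
    show ?thesis
    proof (rule that[of "q 1 - q 2" "q 2 - q 0" "q 0 - q 1"])
      show "q 1 - q 2 \<noteq> 0 \<or> q 2 - q 0 \<noteq> 0 \<or> q 0 - q 1 \<noteq> 0" using False by auto
    qed (simp_all add: algebra_simps)
  qed
  let ?i = "\<lambda>k x. complex_of_real (indicator (I k) x)"
  define f where "f x = a0 * ?i 0 x + a1 * ?i 1 x + a2 * ?i 2 x" for x
  have fL2: "f \<in> L2" unfolding f_def[abs_def] by (intro L2_add L2_cmult indL2)
  have ic: "integrable lborel (?i k)" for k using iI[of k] by simp
  have fi: "integrable lborel f"
    unfolding f_def[abs_def] by (intro Bochner_Integration.integrable_add integrable_mult_right ic)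
  have i0: "(LINT x|lborel. ?i k x) = of_real d" for k
    using LI[of k] by simp
  have int0: "(LINT x|lborel. f x) = 0"
  proof -
    have "(LINT x|lborel. f x) = a0 * of_real d + a1 * of_real d + a2 * of_real d"
      unfolding f_def using ic by (simp only: Bochner_Integration.integral_add
          Bochner_Integration.integrable_add integrable_mult_right integral_mult_right_zero i0)
    also have "\<dots> = (a0 + a1 + a2) * of_real d" by (simp add: algebra_simps)
    finally show ?thesis using a(1) by simp
  qed
  have inth: "(LINT x|lborel. f x * h x) = 0"
  proof -
    have "(\<lambda>x. f x * h x) = (\<lambda>x. a0 * (?i 0 x * h x) + a1 * (?i 1 x * h x) + a2 * (?i 2 x * h x))"
      by (auto simp: f_def algebra_simps)
    then have "(LINT x|lborel. f x * h x) = (LINT x|lborel. a0 * (?i 0 x * h x) + a1 * (?i 1 x * h x) + a2 * (?i 2 x * h x))"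
      by simp
    also have "\<dots> = a0 * q 0 + a1 * q 1 + a2 * q 2"
      using ih by (simp only: Bochner_Integration.integral_add Bochner_Integration.integrable_add
          integrable_mult_right integral_mult_right_zero qk)
    finally show ?thesis using a(2) by simp
  qed
  have "L2_norm f \<noteq> 0"
  proof
    assume "L2_norm f = 0"
    then have ae: "AE x in lborel. f x = 0" using L2_norm_eq_0_iff[OF fL2] by simp
    have on: "f x = a0" if "x \<in> I 0" for x
      using disj[of x 1 0] disj[of x 2 0] that by (auto simp: f_def indicator_def)
    have on1: "f x = a1" if "x \<in> I 1" for x
      using disj[of x 1 0] disj[of x 2 1] that by (auto simp: f_def indicator_def)
    have on2: "f x = a2" if "x \<in> I 2" for x
      using disj[of x 2 0] disj[of x 2 1] that by (auto simp: f_def indicator_def)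
    have z: "\<exists>x\<in>I k. f x = 0" for k
    proof (rule ccontr)
      assume "\<not> (\<exists>x\<in>I k. f x = 0)"
      with ae have "AE x in lborel. x \<notin> I k" by (auto elim: eventually_mono)
      then have "emeasure lborel (I k) = 0" by (subst (asm) AE_iff_measurable[of "I k"]) auto
      then show False using eI[of k] d by simp
    qed
    from z[of 0] z[of 1] z[of 2] show False using on on1 on2 a(3) by metis
  qed
  moreover have "f x = 0" if "\<bar>x - l\<bar> \<ge> e" for x
    using near[of x 0] near[of x 1] near[of x 2] that by (auto simp: f_def indicator_def)
  ultimately show ?thesis using that[OF fL2 fi _ int0 inth] by (simp add: order_less_le)
qed

section \<open>The resolvent set and the kernel functions\<close>

context friedrichs
begin

text \<open>The test function has \<open>\<Gamma>_1 = \<Gamma>_2 = 0\<close>, hence lies in the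
  domain for every \<open>B\<close>. Being orthogonal to \<open>\<phi>\<close> and concentrated
  within \<open>e\<close> of \<open>l\<close>, it is an approximate eigenfunction: the operator
  minus \<open>l\<close> multiplies it by \<open>x - l\<close>. The value of \<open>e\<close> is
  chosen to contradict the resolvent bound \<open>C\<close>.\<close>

lemma real_notin_resolvent_set:
  fixes l :: real
  shows "of_real l \<notin> resolvent_set \<phi> \<psi> B"
proof
  assume "of_real l \<in> resolvent_set \<phi> \<psi> B"
  then obtain C where C: "\<And>f. f \<in> dom_AB B \<Longrightarrow>
      L2_norm f \<le> C * L2_norm (\<lambda>x. Atilde \<phi> \<psi> f x - of_real l * f x)"
    by (auto simp: resolvent_set_def)
  define e where "e = 1 / (2 * (\<bar>C\<bar> + 1))"
  have e: "e > 0" by (simp add: e_def add_nonneg_pos)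
  obtain f where f: "f \<in> L2" "integrable lborel f" "\<And>x. \<bar>x - l\<bar> \<ge> e \<Longrightarrow> f x = 0"
    "(LINT x|lborel. f x) = 0" "(LINT x|lborel. f x * cnj (\<phi> x)) = 0" "L2_norm f > 0"
    using local_test_function[OF L2_cnj[OF phi_L2] e, of l] by blast
  have [measurable]: "f \<in> borel_measurable borel" using f(1) by (rule L2_measurable)
  have le: "norm ((of_real x - of_real l) * f x) \<le> e * norm (f x)" for x
  proof (cases "\<bar>x - l\<bar> \<ge> e")
    case False
    then show ?thesis by (simp add: norm_mult mult_right_mono flip: of_real_diff)
  qed (simp add: f(3))
  have m: "(\<lambda>x. (of_real x - of_real l) * f x) \<in> borel_measurable borel" by measurable
  have L: "(\<lambda>x. (of_real x - of_real l) * f x) \<in> L2"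
    by (rule L2_bound[OF m f(1)]) (use le in auto)
  have "(\<lambda>x. of_real x * f x - 0) \<in> L2"
    using L2_add[OF L L2_cmult[OF f(1), of "of_real l"]] by (simp add: algebra_simps)
  then have cf: "coef f = 0" and "f \<in> mdom" using f(1) unfolding mdom_def by (blast intro: coef_eq)+
  then have dom: "f \<in> dom_AB B" using f by (simp add: dom_AB_def Gamma2_def Gamma1_integrable)
  have "L2_inner f \<phi> = 0" using f(5) by (simp add: L2_inner_def)
  then have "(\<lambda>x. Atilde \<phi> \<psi> f x - of_real l * f x) = (\<lambda>x. (of_real x - of_real l) * f x)"
    by (auto simp: Atilde_def cf algebra_simps)
  then have "L2_norm f \<le> C * L2_norm (\<lambda>x. (of_real x - of_real l) * f x)" using C[OF dom] by simp
  also have "\<dots> \<le> (\<bar>C\<bar> + 1) * (e * L2_norm f)"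
    using e by (intro mult_mono L2_norm_mono m f(1)) (use le in auto)
  also have "\<dots> = L2_norm f / 2"
  proof -
    have "\<bar>C\<bar> + 1 \<noteq> 0" by linarith
    moreover have "K * (1 / (2 * K) * N) = N / 2" if "K \<noteq> 0" for K N :: real using that by simp
    ultimately show ?thesis unfolding e_def by blast
  qed
  finally show False using f(6) by simp
qed

text \<open>If \<open>D \<mu> = 0\<close>, the homogeneous equations for \<open>s\<close> and
  \<open>c\<close> have a nontrivial solution and hence yield an element of the kernel. By
  injectivity it is null, so \<open>s * \<psi>\<close> equals the constant \<open>c\<close> almost
  everywhere. Square integrability gives \<open>c = 0\<close>, then \<open>\<psi> = 0\<close> almost
  everywhere, and so \<open>D \<mu> = 1\<close>.\<close>

lemma resolvent_setD:
  assumes "\<mu> \<in> resolvent_set \<phi> \<psi> B"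
  shows "Im \<mu> \<noteq> 0" "D \<mu> \<noteq> 0"
proof -
  show mu: "Im \<mu> \<noteq> 0"
  proof
    assume "Im \<mu> = 0"
    then have "\<mu> = of_real (Re \<mu>)" by (simp add: complex_eq_iff)
    with assms real_notin_resolvent_set show False by metis
  qed
  have inj: "AE x in lborel. f x = 0"
    if "f \<in> dom_AB B" "AE x in lborel. Atilde \<phi> \<psi> f x - \<mu> * f x = 0" for f
    using assms that by (auto simp: resolvent_set_def)
  show "D \<mu> \<noteq> 0"
  proof
    assume D0: "D \<mu> = 0"
    \<comment> \<open>In the upper half-plane the consistency condition is void and one equation for
      two unknowns remains. In the lower one \<open>c = 0\<close> and \<open>s = 1\<close> serve,
      since the Cauchy integral of \<open>\<psi>\<close> vanishes.\<close>
    obtain s c where sc: "c * b \<mu> = 0" "c * (pv_kernel \<mu> - B) = s * cauchy_int \<psi> \<mu>" "s \<noteq> 0 \<or> c \<noteq> 0"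
    proof (cases "Im \<mu> > 0")
      case True
      show ?thesis
      proof (cases "pv_kernel \<mu> - B = 0")
        case True2: True
        then show ?thesis using that[of 1 0] True by (simp add: b_upper)
      next
        case False
        then show ?thesis using that[of "cauchy_int \<psi> \<mu> / (pv_kernel \<mu> - B)" 1] True by (simp add: b_upper)
      qed
    next
      case False
      then show ?thesis using that[of 0 1] mu by (simp add: psi_lower)
    qed
    have s: "s * D \<mu> = cauchy_int (\<lambda>x. 0 * cnj (\<phi> x)) \<mu> + c * b \<mu>"
      using D0 sc(1) by (simp add: cauchy_int_def)
    let ?u = "\<lambda>x. (0 - s * \<psi> x + c) / (of_real x - \<mu>)"
    note S = solution_exists[OF L2_zero mu s]
    have "Gamma1 ?u = B * c" unfolding S(5) using sc(2) by (simp add: cauchy_int_def algebra_simps)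
    then have dom: "?u \<in> dom_AB B" using S(1) unfolding dom_AB_def Gamma2_def
      by (simp only: S(2) mem_Collect_eq simp_thms)
    have "AE x in lborel. ?u x = 0" by (rule inj[OF dom]) (use S(4) in auto)
    then have ae: "AE x in lborel. s * \<psi> x = c"
    proof eventually_elim
      case (elim x)
      then show ?case using real_minus_nonzero[OF mu, of x] by simp
    qed
    have "(\<lambda>x. c) \<in> L2" by (rule L2_AE_cong[OF L2_cmult[OF psi_L2, of s] _ ae]) simp
    then have c: "c = 0" by (simp add: const_in_L2_iff)
    with sc(3) ae have psi0: "AE x in lborel. \<psi> x = 0" by auto
    have "cauchy_int (\<lambda>x. \<psi> x * cnj (\<phi> x)) \<mu> = cauchy_int (\<lambda>x. 0) \<mu>"
      by (rule cauchy_int_cong_AE) (use psi0 in auto)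
    then show False using D0 by (simp add: D_eq cauchy_int_def)
  qed
qed

text \<open>The kernel element normalised by \<open>coef = 1\<close>, for
  \<open>D \<mu> \<noteq> 0\<close>. The leading \<open>0\<close> is the right-hand side
  \<open>g\<close> in the general solution formula.\<close>

definition kernel_fun :: "complex \<Rightarrow> real \<Rightarrow> complex" where
  "kernel_fun \<mu> = (\<lambda>x. (0 - b \<mu> / D \<mu> * \<psi> x + 1) / (of_real x - \<mu>))"

lemma kernel_solution:
  fixes a :: complex
  assumes mu: "Im \<mu> \<noteq> 0" and D: "D \<mu> \<noteq> 0"
  defines "u \<equiv> \<lambda>x. a * kernel_fun \<mu> x"
  shows "u \<in> mdom" "AE x in lborel. Atilde \<phi> \<psi> u x - \<mu> * u x = 0" "coef u = a" "Gamma1 u = a * pv_kernel \<mu>"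
proof -
  have eq: "u = (\<lambda>x. (0 - a * (b \<mu> / D \<mu>) * \<psi> x + a) / (of_real x - \<mu>))"
    by (auto simp: u_def kernel_fun_def algebra_simps)
  have s: "a * (b \<mu> / D \<mu>) * D \<mu> = cauchy_int (\<lambda>x. 0 * cnj (\<phi> x)) \<mu> + a * b \<mu>"
    using D by (simp add: cauchy_int_def)
  note S = solution_exists[OF L2_zero mu s]
  show "u \<in> mdom" "coef u = a" unfolding eq using S(1,2) by auto
  show "AE x in lborel. Atilde \<phi> \<psi> u x - \<mu> * u x = 0" unfolding eq using S(4) by auto
  have "a * (b \<mu> / D \<mu>) * cauchy_int \<psi> \<mu> = 0" using b_psi_zero[OF mu] by auto
  then show "Gamma1 u = a * pv_kernel \<mu>" unfolding eq S(5) by (simp add: cauchy_int_def)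
qed

text \<open>If \<open>pv_kernel \<mu> = B\<close>, then \<open>kernel_fun \<mu>\<close> would be a
  null element of the domain, and a multiple of \<open>\<psi>\<close> would be the constant 1.
  Otherwise the boundary condition fixes the factor; as the solution is a choice among
  representatives, only its class is determined.\<close>

lemma sol_op_form:
  assumes res: "\<mu> \<in> resolvent_set \<phi> \<psi> B"
  shows "pv_kernel \<mu> \<noteq> B" "sol_op \<phi> \<psi> \<mu> B f \<in> mdom"
    "AE x in lborel. sol_op \<phi> \<psi> \<mu> B f x = f / (pv_kernel \<mu> - B) * kernel_fun \<mu> x"
proof -
  note mu = resolvent_setD[OF res]
  show ne: "pv_kernel \<mu> \<noteq> B"
  proof
    assume B: "pv_kernel \<mu> = B"
    note K = kernel_solution[OF mu, of 1, simplified]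
    have dom: "kernel_fun \<mu> \<in> dom_AB B"
      using K by (simp add: dom_AB_def Gamma2_def B)
    have "AE x in lborel. kernel_fun \<mu> x = 0"
      using res dom K(2) by (auto simp: resolvent_set_def)
    then have ae: "AE x in lborel. b \<mu> / D \<mu> * \<psi> x = 1"
    proof eventually_elim
      case (elim x)
      then show ?case using real_minus_nonzero[OF mu(1), of x] by (simp add: kernel_fun_def)
    qed
    have "(\<lambda>x. 1) \<in> L2" by (rule L2_AE_cong[OF L2_cmult[OF psi_L2] _ ae]) simp
    then show False by (simp add: const_in_L2_iff)
  qed
  let ?P = "\<lambda>u. u \<in> mdom \<and> (AE x in lborel. Atilde \<phi> \<psi> u x - \<mu> * u x = 0) \<and> Gamma1 u - B * Gamma2 u = f"
  have ex: "\<exists>u. ?P u"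
  proof (intro exI conjI)
    let ?a = "f / (pv_kernel \<mu> - B)"
    note K = kernel_solution[OF mu, of ?a]
    show "(\<lambda>x. ?a * kernel_fun \<mu> x) \<in> mdom"
      "AE x in lborel. Atilde \<phi> \<psi> (\<lambda>x. ?a * kernel_fun \<mu> x) x - \<mu> * (?a * kernel_fun \<mu> x) = 0"
      by (rule K)+
    have "?a * pv_kernel \<mu> - B * ?a = ?a * (pv_kernel \<mu> - B)"
      by (simp only: right_diff_distrib mult.commute[of B])
    then show "Gamma1 (\<lambda>x. ?a * kernel_fun \<mu> x) - B * Gamma2 (\<lambda>x. ?a * kernel_fun \<mu> x) = f"
      unfolding Gamma2_def K using ne by simp
  qed
  define u where "u = sol_op \<phi> \<psi> \<mu> B f"
  have u: "u \<in> mdom" "AE x in lborel. Atilde \<phi> \<psi> u x - \<mu> * u x = 0" "Gamma1 u - B * coef u = f"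
    using someI_ex[OF ex] unfolding u_def sol_op_def Gamma2_def by blast+
  show "sol_op \<phi> \<psi> \<mu> B f \<in> mdom" using u(1) by (simp add: u_def)
  define s where "s = L2_inner u \<phi>"
  define c where "c = coef u"
  note F = solution_form[OF u(1) L2_zero mu(1) u(2), folded s_def c_def]
  have s: "s = c * (b \<mu> / D \<mu>)" using F(2) mu(2) by (simp add: cauchy_int_def field_simps)
  have "s * cauchy_int \<psi> \<mu> = 0" using b_psi_zero[OF mu(1)] unfolding s by auto
  then have "c * (pv_kernel \<mu> - B) = f" using u(3) F(3) by (simp add: cauchy_int_def c_def algebra_simps)
  then have c: "c = f / (pv_kernel \<mu> - B)" using ne by (simp add: field_simps)
  show "AE x in lborel. sol_op \<phi> \<psi> \<mu> B f x = f / (pv_kernel \<mu> - B) * kernel_fun \<mu> x"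
    unfolding u_def[symmetric] c[symmetric] using F(1)
    by eventually_elim (simp add: s kernel_fun_def algebra_simps)
qed

lemma D_holomorphic: "(\<And>\<mu>. \<mu> \<in> S \<Longrightarrow> Im \<mu> \<noteq> 0) \<Longrightarrow> D holomorphic_on S"
  unfolding D_eq[abs_def]
  by (intro holomorphic_intros cauchy_int_holomorphic cauchy_integrable_L1 product_integrable psi_L2)

lemma isCont_D: "Im \<mu> \<noteq> 0 \<Longrightarrow> isCont D \<mu>"
  unfolding D_eq[abs_def]
  by (intro continuous_intros isCont_cauchy_int cauchy_integrable_L1 product_integrable psi_L2)

text \<open>\<open>D - 1\<close> decays away from the line, so \<open>D\<close> is not identically
  zero on either half-plane and its zeros are isolated.\<close>

lemma D_nonzero_sequence:
  assumes mu: "Im \<mu> \<noteq> 0"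
  obtains m where "m \<longlonglongrightarrow> \<mu>" "\<And>n. Im (m n) * Im \<mu> > 0" "\<And>n. D (m n) \<noteq> 0"
proof (cases "D \<mu> = 0")
  case False
  then show ?thesis using mu by (intro that[of "\<lambda>_. \<mu>"]) (auto simp: zero_less_mult_iff)
next
  case True
  define S where "S = {w. Im w * Im \<mu> > 0}"
  have S: "open S" "connected S"
  proof -
    have "S = (if Im \<mu> > 0 then {w. Im w > 0} else {w. Im w < 0})"
      using mu by (auto simp: S_def zero_less_mult_iff)
    then show "open S" "connected S"
      by (auto simp: open_halfspace_Im_gt open_halfspace_Im_lt convex_halfspace_Im_gt convex_halfspace_Im_lt
          intro!: convex_connected)
  qed
  have hol: "D holomorphic_on S" by (rule D_holomorphic) (auto simp: S_def)
  define L where "L = (LINT x|lborel. norm (\<psi> x * cnj (\<phi> x)))"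
  have L: "L \<ge> 0" by (simp add: L_def)
  \<comment> \<open>At this height \<open>D\<close> differs from 1 by at most
    \<open>L / (L + 1)\<close>; the sign puts \<open>w\<close> into the half-plane of
    \<open>\<mu>\<close>.\<close>
  define w where "w = Complex 0 (sgn (Im \<mu>) * (L + 1))"
  have w: "w \<in> S" "\<bar>Im w\<bar> = L + 1" "Im w \<noteq> 0"
    using mu L by (auto simp: w_def S_def abs_mult sgn_if zero_less_mult_iff mult_less_0_iff)
  have "norm (cauchy_int (\<lambda>x. \<psi> x * cnj (\<phi> x)) w) \<le> L / \<bar>Im w\<bar>"
    unfolding L_def by (rule cauchy_int_bound_L1[OF product_integrable[OF psi_L2] w(3)])
  also have "\<dots> = L / (L + 1)" by (simp only: w(2))
  also have "\<dots> < 1" using L by simp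
  finally have "D w \<noteq> 0" unfolding D_eq by (metis add_eq_0_iff norm_minus_cancel norm_one less_irrefl)
  moreover have "\<mu> \<in> S" using mu by (auto simp: S_def zero_less_mult_iff)
  ultimately obtain r where r: "0 < r" "ball \<mu> r \<subseteq> S" "\<And>z. z \<in> ball \<mu> r - {\<mu>} \<Longrightarrow> D z \<noteq> 0"
    using isolated_zeros[OF hol S _ True w(1)] by metis
  define m where "m n = \<mu> + of_real (r / real (n + 2))" for n
  have mb: "m n \<in> ball \<mu> r - {\<mu>}" for n
  proof -
    have "\<mu> + of_real t \<in> ball \<mu> r - {\<mu>}" if "0 < t" "t < r" for t :: real
      using that by (auto simp: dist_norm)
    moreover have "0 < r / real (n + 2)" "r / real (n + 2) < r" using r(1) by (auto simp: field_simps add_pos_nonneg)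
    ultimately show ?thesis unfolding m_def by blast
  qed
  show ?thesis
  proof (rule that)
    have "(\<lambda>n. r / real (n + 2)) \<longlonglongrightarrow> 0" by real_asymp
    then have "(\<lambda>n. \<mu> + of_real (r / real (n + 2))) \<longlonglongrightarrow> \<mu> + of_real 0"
      by (intro tendsto_intros)
    then show "m \<longlonglongrightarrow> \<mu>" unfolding m_def[abs_def] by simp
    show "Im (m n) * Im \<mu> > 0" "D (m n) \<noteq> 0" for n
      using mb[of n] r(2,3) by (auto simp: S_def)
  qed
qed

section \<open>Generators of the detectable subspace\<close>

definition upper_gens :: "(real \<Rightarrow> complex) set" where
  "upper_gens = {\<lambda>x. 1 / (of_real x - \<mu>) | \<mu>. Im \<mu> > 0}"

text \<open>These are the kernel functions multiplied by \<open>D \<mu>\<close>, a form that still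
  makes sense at the zeros of \<open>D\<close>.\<close>

definition lower_gens :: "(real \<Rightarrow> complex) set" where
  "lower_gens = {\<lambda>x. (D \<mu> + 2 * of_real pi * \<i> * hardy_bar \<phi> \<mu> * \<psi> x) / (of_real x - \<mu>) | \<mu>. Im \<mu> < 0}"

lemma detectable_closed: "L2_closed_subspace (detectable \<phi> \<psi>)"
  unfolding detectable_def by (rule L2_closed_subspace_closed_span)

lemma kernel_fun_L2: "Im \<mu> \<noteq> 0 \<Longrightarrow> kernel_fun \<mu> \<in> L2"
  unfolding kernel_fun_def by (intro quotient_L2 L2_diff L2_cmult psi_L2 L2_zero)

lemma kernel_fun_detectable:
  assumes mu: "Im \<mu> \<noteq> 0" and D: "D \<mu> \<noteq> 0"
  shows "kernel_fun \<mu> \<in> detectable \<phi> \<psi>"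
proof -
  let ?B = "pv_kernel \<mu> + 1"
  have res: "\<mu> \<in> resolvent_set \<phi> \<psi> ?B" by (rule resolvent_setI[OF mu D])
  let ?s = "sol_op \<phi> \<psi> \<mu> ?B (-1)"
  have "?s \<in> detectable \<phi> \<psi>" unfolding detectable_def
    by (rule closed_span_superset) (use res mdomE(1)[OF sol_op_form(2)[OF res]] in auto)
  moreover have "AE x in lborel. ?s x = kernel_fun \<mu> x"
    using sol_op_form(3)[OF res, of "-1"] by simp
  ultimately show ?thesis
    using L2_closed_subspace_AE[OF detectable_closed _ L2_measurable[OF kernel_fun_L2[OF mu]]] by blast
qed

lemma kernel_fun_upper: "Im \<mu> > 0 \<Longrightarrow> kernel_fun \<mu> = (\<lambda>x. 1 / (of_real x - \<mu>))"
  by (simp add: kernel_fun_def b_upper)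

lemma kernel_fun_lower:
  assumes "Im \<mu> < 0" "D \<mu> \<noteq> 0"
  shows "D \<mu> * kernel_fun \<mu> x = (D \<mu> + 2 * of_real pi * \<i> * hardy_bar \<phi> \<mu> * \<psi> x) / (of_real x - \<mu>)"
proof -
  have "D \<mu> * (0 - b \<mu> / D \<mu> * \<psi> x + 1) = D \<mu> - b \<mu> * \<psi> x"
    using assms(2) by (simp add: algebra_simps)
  then show ?thesis
    unfolding kernel_fun_def times_divide_eq_right by (simp add: b_lower[OF assms(1)])
qed

text \<open>A zero of \<open>D\<close> belongs to no resolvent set, so its generator is approximated
  by those at nearby points where \<open>D\<close> does not vanish. The coefficients and the kernels
  both converge, the latter in norm.\<close>

lemma detectable_gens_subset: "upper_gens \<union> lower_gens \<subseteq> detectable \<phi> \<psi>"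
proof
  fix g assume "g \<in> upper_gens \<union> lower_gens"
  then consider \<mu> where "Im \<mu> > 0" "g = (\<lambda>x. 1 / (of_real x - \<mu>))"
    | \<mu> where "Im \<mu> < 0" "g = (\<lambda>x. (D \<mu> + 2 * of_real pi * \<i> * hardy_bar \<phi> \<mu> * \<psi> x) / (of_real x - \<mu>))"
    by (auto simp: upper_gens_def lower_gens_def)
  then show "g \<in> detectable \<phi> \<psi>"
  proof cases
    case 1
    then have mu: "Im \<mu> \<noteq> 0" by simp
    obtain m where m: "m \<longlonglongrightarrow> \<mu>" "\<And>n. Im (m n) * Im \<mu> > 0" "\<And>n. D (m n) \<noteq> 0"
      using D_nonzero_sequence[OF mu] by blast
    have Im: "Im (m n) > 0" for n using m(2)[of n] 1 by (simp add: zero_less_mult_iff)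
    show ?thesis unfolding 1(2)
    proof (rule L2_closed_subspace_limit[OF detectable_closed resolvent_L2[OF mu]])
      show "(\<lambda>x. 1 / (of_real x - m n)) \<in> detectable \<phi> \<psi>" for n
        using kernel_fun_detectable[of "m n"] Im[of n] m(3) by (simp add: kernel_fun_upper)
      show "(\<lambda>n. L2_norm (\<lambda>x. 1 / (of_real x - \<mu>) - 1 / (of_real x - m n))) \<longlonglongrightarrow> 0"
        by (rule resolvent_L2_continuous[OF resolvent_L2 mu m(1)]) (use Im in \<open>auto simp: less_imp_neq[symmetric]\<close>)
    qed
  next
    case 2
    then have mu: "Im \<mu> \<noteq> 0" by simp
    obtain m where m: "m \<longlonglongrightarrow> \<mu>" "\<And>n. Im (m n) * Im \<mu> > 0" "\<And>n. D (m n) \<noteq> 0"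
      using D_nonzero_sequence[OF mu] by blast
    have Im: "Im (m n) < 0" for n using m(2)[of n] 2 by (auto simp: zero_less_mult_iff)
    then have Im0: "Im (m n) \<noteq> 0" for n by (simp add: less_imp_neq)
    let ?K = "\<lambda>\<nu> x. 1 / (complex_of_real x - \<nu>)" and ?P = "\<lambda>\<nu> x. \<psi> x / (of_real x - \<nu>)"
    let ?h = "\<lambda>n x. D (m n) * kernel_fun (m n) x"
    have KL: "?K \<nu> \<in> L2" "?P \<nu> \<in> L2" if "Im \<nu> \<noteq> 0" for \<nu> using that psi_L2 by auto
    have gen: "(D \<nu> + 2 * of_real pi * \<i> * hardy_bar \<phi> \<nu> * \<psi> x) / (of_real x - \<nu>)
        = D \<nu> * ?K \<nu> x - b \<nu> * ?P \<nu> x" if "Im \<nu> < 0" for \<nu> x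
      using that by (simp add: b_lower add_divide_distrib)
    have gL2: "g \<in> L2" unfolding 2(2) gen[OF 2(1)] using KL[OF mu] by (intro L2_diff L2_cmult)
    have hK: "?h n x = D (m n) * ?K (m n) x - b (m n) * ?P (m n) x" for n x
      using kernel_fun_lower[OF Im m(3)] gen[OF Im] by simp
    show ?thesis
    proof (rule L2_closed_subspace_limit[OF detectable_closed gL2])
      show "?h n \<in> detectable \<phi> \<psi>" for n
        using kernel_fun_detectable[OF Im0 m(3)] detectable_closed
        by (auto simp: L2_closed_subspace_def L2_subspace_def)
      show "(\<lambda>n. L2_norm (\<lambda>x. g x - ?h n x)) \<longlonglongrightarrow> 0"
      proof (rule Lim_null_comparison)
        let ?e1 = "\<lambda>n. L2_norm (\<lambda>x. ?K \<mu> x - ?K (m n) x)" and ?e2 = "\<lambda>n. L2_norm (\<lambda>x. ?P \<mu> x - ?P (m n) x)"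
        let ?bd = "\<lambda>n. (norm (D \<mu> - D (m n)) * L2_norm (?K \<mu>) + norm (D (m n)) * ?e1 n)
          + (norm (b \<mu> - b (m n)) * L2_norm (?P \<mu>) + norm (b (m n)) * ?e2 n)"
        have e: "?e1 \<longlonglongrightarrow> 0" "?e2 \<longlonglongrightarrow> 0"
          by (rule resolvent_L2_continuous[OF _ mu m(1) Im0], rule KL, assumption)+
        have c: "(\<lambda>n. D (m n)) \<longlonglongrightarrow> D \<mu>" "(\<lambda>n. b (m n)) \<longlonglongrightarrow> b \<mu>"
          using isCont_tendsto_compose[OF isCont_D[OF mu] m(1)]
            isCont_tendsto_compose[OF isCont_cauchy_int[OF cauchy_integrable_L2[OF L2_cnj[OF phi_L2]] mu] m(1)] by auto
        have "?bd \<longlonglongrightarrow> (norm (D \<mu> - D \<mu>) * L2_norm (?K \<mu>) + norm (D \<mu>) * 0)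
          + (norm (b \<mu> - b \<mu>) * L2_norm (?P \<mu>) + norm (b \<mu>) * 0)"
          by (intro tendsto_intros e c)
        then show "?bd \<longlonglongrightarrow> 0" by simp
        have prod: "L2_norm (\<lambda>x. a * F x - a' * F' x) \<le> norm (a - a') * L2_norm F + norm a' * L2_norm (\<lambda>x. F x - F' x)"
          if "F \<in> L2" "F' \<in> L2" for a a' :: complex and F F'
        proof -
          have "L2_norm (\<lambda>x. a * F x - a' * F' x) = L2_norm (\<lambda>x. (a - a') * F x + a' * (F x - F' x))"
            by (simp add: algebra_simps)
          also have "\<dots> \<le> L2_norm (\<lambda>x. (a - a') * F x) + L2_norm (\<lambda>x. a' * (F x - F' x))"
            using that by (intro L2_norm_triangle L2_cmult L2_diff)
          finally show ?thesis by (simp add: L2_norm_cmult)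
        qed
        show "eventually (\<lambda>n. norm (L2_norm (\<lambda>x. g x - ?h n x)) \<le> ?bd n) sequentially"
        proof (intro always_eventually allI)
          fix n
          let ?a = "\<lambda>x. D \<mu> * ?K \<mu> x - D (m n) * ?K (m n) x" and ?c = "\<lambda>x. b \<mu> * ?P \<mu> x - b (m n) * ?P (m n) x"
          have "(\<lambda>x. g x - ?h n x) = (\<lambda>x. ?a x + (-1) * ?c x)"
            unfolding hK by (auto simp: 2(2) gen[OF 2(1)])
          then have "L2_norm (\<lambda>x. g x - ?h n x) = L2_norm (\<lambda>x. ?a x + (-1) * ?c x)" by simp
          also have "\<dots> \<le> L2_norm ?a + L2_norm (\<lambda>x. (-1) * ?c x)"
            using KL[OF mu] KL[OF Im0] by (intro L2_norm_triangle L2_diff L2_cmult)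
          also have "L2_norm (\<lambda>x. (-1) * ?c x) = L2_norm ?c" unfolding L2_norm_cmult by simp
          also have "L2_norm ?a + L2_norm ?c \<le> ?bd n"
            by (intro add_mono prod KL mu Im0)
          finally show "norm (L2_norm (\<lambda>x. g x - ?h n x)) \<le> ?bd n" by simp
        qed
      qed
    qed
  qed
qed

lemma upper_gens_L2: "upper_gens \<subseteq> L2"
  by (auto simp: upper_gens_def)

lemma lower_gens_L2: "lower_gens \<subseteq> L2"
proof -
  have "(\<lambda>x. (D \<mu> + 2 * of_real pi * \<i> * hardy_bar \<phi> \<mu> * \<psi> x) / (of_real x - \<mu>)) \<in> L2" if "Im \<mu> < 0" for \<mu>
    using quotient_L2[OF L2_cmult[OF psi_L2, of "2 * of_real pi * \<i> * hardy_bar \<phi> \<mu>"], of \<mu> "D \<mu>"] that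
    by (simp add: add.commute)
  then show ?thesis by (auto simp: lower_gens_def)
qed

text \<open>Both sides are closed subspaces, so generators suffice. Each value of a solution
  operator is almost everywhere a multiple of \<open>kernel_fun\<close>, which is an upper generator
  or a lower one divided by \<open>D \<mu>\<close>.\<close>

lemma detectable_eq:
  "detectable \<phi> \<psi> = L2_closure (fun_set_sum (closed_span upper_gens) (closed_span lower_gens))"
proof
  let ?S = "L2_closure (fun_set_sum (closed_span upper_gens) (closed_span lower_gens))"
  have cs: "L2_subspace (closed_span A)" for A
    using L2_closed_subspace_closed_span[of A] by (simp add: L2_closed_subspace_def)
  have S: "L2_closed_subspace ?S" by (intro L2_subspace_closure L2_subspace_sum cs)
  have sup: "closed_span upper_gens \<subseteq> ?S" "closed_span lower_gens \<subseteq> ?S"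
    by (rule closed_subspace_sum_superset[OF cs cs])+
  have smult: "(\<lambda>x. a * h x) \<in> ?S" if "h \<in> ?S" for a h
    using S that unfolding L2_closed_subspace_def L2_subspace_def by blast
  show "detectable \<phi> \<psi> \<subseteq> ?S"
    unfolding detectable_def
  proof (rule closed_span_subset[OF S], safe)
    fix B \<mu> f
    assume res: "\<mu> \<in> resolvent_set \<phi> \<psi> B"
    note mu = resolvent_setD[OF res]
    have "kernel_fun \<mu> \<in> ?S"
    proof (cases "Im \<mu> > 0")
      case True
      then have "kernel_fun \<mu> \<in> upper_gens" by (auto simp: kernel_fun_upper upper_gens_def)
      then have "kernel_fun \<mu> \<in> closed_span upper_gens" using upper_gens_L2 by (blast intro: closed_span_superset)
      then show ?thesis using sup by blast
    next
      case False
      then have neg: "Im \<mu> < 0" using mu by simp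
      have "(\<lambda>x. D \<mu> * kernel_fun \<mu> x) \<in> lower_gens"
        unfolding kernel_fun_lower[OF neg mu(2)] lower_gens_def using neg by blast
      then have "(\<lambda>x. D \<mu> * kernel_fun \<mu> x) \<in> closed_span lower_gens"
        using lower_gens_L2 by (blast intro: closed_span_superset)
      then have "(\<lambda>x. D \<mu> * kernel_fun \<mu> x) \<in> ?S" using sup by blast
      from smult[OF this, of "1 / D \<mu>"] show ?thesis using mu(2) by simp
    qed
    from smult[OF this, of "f / (pv_kernel \<mu> - B)"]
    show "sol_op \<phi> \<psi> \<mu> B f \<in> ?S"
    proof (rule L2_closed_subspace_AE[OF S])
      show "sol_op \<phi> \<psi> \<mu> B f \<in> borel_measurable borel"
        by (rule L2_measurable[OF mdomE(1)[OF sol_op_form(2)[OF res]]])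
      show "AE x in lborel. f / (pv_kernel \<mu> - B) * kernel_fun \<mu> x = sol_op \<phi> \<psi> \<mu> B f x"
        using sol_op_form(3)[OF res, of f] by eventually_elim simp
    qed
  qed
  have sub: "closed_span upper_gens \<subseteq> detectable \<phi> \<psi>" "closed_span lower_gens \<subseteq> detectable \<phi> \<psi>"
    by (rule closed_span_subset[OF detectable_closed], use detectable_gens_subset in blast)+
  have add: "(\<lambda>x. f x + g x) \<in> detectable \<phi> \<psi>"
    if "f \<in> detectable \<phi> \<psi>" "g \<in> detectable \<phi> \<psi>" for f g
    using detectable_closed that unfolding L2_closed_subspace_def L2_subspace_def by blast
  have "fun_set_sum (closed_span upper_gens) (closed_span lower_gens) \<subseteq> detectable \<phi> \<psi>"
    unfolding fun_set_sum_def using sub add by blast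
  from L2_closure_mono[OF this] show "?S \<subseteq> detectable \<phi> \<psi>"
    using detectable_closed by (auto simp: L2_closed_subspace_def)
qed

end

lemma continuous_eq_at:
  fixes f g :: "complex \<Rightarrow> complex"
  assumes "isCont f a" "isCont g a" "eventually (\<lambda>w. f w = g w) (at a)"
  shows "f a = g a"
proof -
  have "(g \<longlongrightarrow> f a) (at a)"
    by (rule Lim_transform_eventually[OF _ assms(3)]) (use assms(1) in \<open>simp add: isCont_def\<close>)
  moreover have "(g \<longlongrightarrow> g a) (at a)" using assms(2) by (simp add: isCont_def)
  ultimately show ?thesis using tendsto_unique[OF trivial_limit_at] by blast
qed

lemma eventually_Im_neg:
  assumes "Im a < 0"
  shows "eventually (\<lambda>w. Im w < 0) (at a)"
  using assms eventually_nhds_in_open[of "{w. Im w < 0}" a] open_halfspace_Im_lt[of 0]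
  by (auto simp: eventually_at_filter elim: eventually_mono)

lemma eventually_not_in_finite:
  assumes "finite A"
  shows "eventually (\<lambda>w. w \<notin> A) (at (a :: complex))"
proof -
  have "finite (A - {a})" using assms by simp
  then have "eventually (\<lambda>w. w \<in> - (A - {a})) (nhds a)"
    by (intro eventually_nhds_in_open open_Compl finite_imp_closed) auto
  then show ?thesis by (auto simp: eventually_at_filter elim: eventually_mono)
qed

lemma eventually_poly_nonzero:
  fixes p :: "complex poly"
  assumes "p \<noteq> 0"
  shows "eventually (\<lambda>w. poly p w \<noteq> 0) (at a)"
  using eventually_not_in_finite[OF poly_roots_finite[OF assms], of a] by simp

lemma poly_analytic_on: "poly r analytic_on S" for r :: "complex poly"
proof -
  have "poly r holomorphic_on UNIV"
    unfolding holomorphic_on_def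
    using poly_DERIV field_differentiable_def field_differentiable_at_within by blast
  then have "poly r analytic_on UNIV" by (simp add: analytic_on_open)
  then show ?thesis by (rule analytic_on_subset) simp
qed

section \<open>The orthogonal complement in terms of Cauchy integrals\<close>

context friedrichs
begin

text \<open>The functions orthogonal to \<open>g\<close> form a closed subspace, by continuity of
  the inner product, so it is enough to test generators.\<close>

lemma L2_orth_detectable_iff:
  "g \<in> L2_orth (detectable \<phi> \<psi>) \<longleftrightarrow> g \<in> L2 \<and> (\<forall>h\<in>upper_gens \<union> lower_gens. L2_inner h g = 0)"
proof safe
  assume "g \<in> L2_orth (detectable \<phi> \<psi>)"
  then show "g \<in> L2" by (simp add: L2_orth_def)
next
  fix h assume "g \<in> L2_orth (detectable \<phi> \<psi>)" "h \<in> upper_gens"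
  then show "L2_inner h g = 0" using detectable_gens_subset by (auto simp: L2_orth_def)
next
  fix h assume "g \<in> L2_orth (detectable \<phi> \<psi>)" "h \<in> lower_gens"
  then show "L2_inner h g = 0" using detectable_gens_subset by (auto simp: L2_orth_def)
next
  assume g: "g \<in> L2" and gens: "\<forall>h\<in>upper_gens \<union> lower_gens. L2_inner h g = 0"
  define T where "T = {h \<in> L2. L2_inner h g = 0}"
  have add: "(\<lambda>x. h x + k x) \<in> T" if "h \<in> T" "k \<in> T" for h k
  proof -
    have "L2_inner (\<lambda>x. h x + k x) g = L2_inner h g + L2_inner k g"
      using that g by (simp add: L2_inner_def T_def distrib_right L2_inner_integrable)
    then show ?thesis using that by (auto simp: T_def)
  qed
  have scale: "(\<lambda>x. a * h x) \<in> T" if "h \<in> T" for a h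
  proof -
    have "L2_inner (\<lambda>x. a * h x) g = a * L2_inner h g"
      unfolding L2_inner_def mult.assoc by (rule integral_mult_right_zero)
    then show ?thesis using that by (auto simp: T_def)
  qed
  have closed: "L2_closure T \<subseteq> T"
  proof
    fix h assume h: "h \<in> L2_closure T"
    then have hL2: "h \<in> L2" by (simp add: L2_closure_def)
    have "norm (L2_inner h g) \<le> e" if "e > 0" for e
    proof -
      have "e / (L2_norm g + 1) > 0" using that by (intro divide_pos_pos) (auto simp: add_nonneg_pos)
      then obtain k where k: "k \<in> T" "k \<in> L2" "L2_norm (\<lambda>x. h x - k x) < e / (L2_norm g + 1)"
        using h unfolding L2_closure_def by blast
      have "L2_inner h g = L2_inner (\<lambda>x. h x - k x) g"
        using k(1) by (simp add: L2_inner_diff_left[OF hL2 k(2) g] T_def)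
      also have "norm \<dots> \<le> L2_norm (\<lambda>x. h x - k x) * L2_norm g"
        using hL2 k(2) g by (intro L2_inner_bound L2_diff)
      also have "\<dots> \<le> (e / (L2_norm g + 1)) * (L2_norm g + 1)"
        using k(3) that by (intro mult_mono) auto
      also have "\<dots> = e"
      proof -
        have "L2_norm g + 1 \<noteq> 0" using L2_norm_nonneg[of g] by linarith
        then show ?thesis by simp
      qed
      finally show ?thesis .
    qed
    then have "norm (L2_inner h g) \<le> 0" by (rule field_le_epsilon) simp
    then show "h \<in> T" using hL2 by (simp add: T_def)
  qed
  have z: "(\<lambda>x. 0) \<in> T" by (simp add: T_def L2_inner_def)
  have T: "L2_closed_subspace T"
    unfolding L2_closed_subspace_def L2_subspace_def using add scale closed z by (auto simp: T_def)
  have "upper_gens \<subseteq> T" "lower_gens \<subseteq> T" using gens upper_gens_L2 lower_gens_L2 by (auto simp: T_def)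
  then have "closed_span upper_gens \<subseteq> T" "closed_span lower_gens \<subseteq> T"
    using closed_span_subset[OF T] by blast+
  then have "fun_set_sum (closed_span upper_gens) (closed_span lower_gens) \<subseteq> T"
    unfolding fun_set_sum_def using add by blast
  from L2_closure_mono[OF this] have "detectable \<phi> \<psi> \<subseteq> T"
    unfolding detectable_eq using closed by blast
  then show "g \<in> L2_orth (detectable \<phi> \<psi>)" using g by (auto simp: L2_orth_def T_def)
qed

text \<open>Against \<open>cnj w\<close>, inner products with the generators turn into Cauchy
  integrals. The upper generators express that \<open>w\<close> is a lower Hardy function, the lower
  ones give the equation.\<close>

lemma orth_detectable_cauchy:
  assumes w: "w \<in> L2"
  shows "(\<lambda>x. cnj (w x)) \<in> L2_orth (detectable \<phi> \<psi>) \<longleftrightarrow> w \<in> lower_hardy \<and>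
    (\<forall>\<mu>. Im \<mu> < 0 \<longrightarrow> D \<mu> * cauchy_int w \<mu>
      + 2 * of_real pi * \<i> * hardy_bar \<phi> \<mu> * cauchy_int (\<lambda>x. \<psi> x * w x) \<mu> = 0)"
proof -
  let ?g = "\<lambda>x. cnj (w x)"
  have up: "L2_inner (\<lambda>x. 1 / (of_real x - \<mu>)) ?g = cauchy_int w \<mu>" for \<mu>
    by (simp add: L2_inner_def cauchy_int_def)
  have low: "L2_inner (\<lambda>x. (D \<mu> + 2 * of_real pi * \<i> * hardy_bar \<phi> \<mu> * \<psi> x) / (of_real x - \<mu>)) ?g
    = D \<mu> * cauchy_int w \<mu> + 2 * of_real pi * \<i> * hardy_bar \<phi> \<mu> * cauchy_int (\<lambda>x. \<psi> x * w x) \<mu>"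
    if "Im \<mu> < 0" for \<mu>
  proof -
    let ?k = "2 * of_real pi * \<i> * hardy_bar \<phi> \<mu>"
    have mu: "Im \<mu> \<noteq> 0" using that by simp
    have i: "cauchy_integrable (\<lambda>x. D \<mu> * w x)" "cauchy_integrable (\<lambda>x. ?k * (\<psi> x * w x))"
      by (rule cauchy_integrable_L2[OF L2_cmult[OF w]],
          rule cauchy_integrable_L1[OF integrable_mult_right[OF L2_mult_integrable[OF psi_L2 w]]])
    have "L2_inner (\<lambda>x. (D \<mu> + ?k * \<psi> x) / (of_real x - \<mu>)) ?g
      = cauchy_int (\<lambda>x. D \<mu> * w x + ?k * (\<psi> x * w x)) \<mu>"
      unfolding L2_inner_def cauchy_int_def
      by (intro Bochner_Integration.integral_cong refl) (simp add: algebra_simps)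
    also have "\<dots> = cauchy_int (\<lambda>x. D \<mu> * w x) \<mu> + cauchy_int (\<lambda>x. ?k * (\<psi> x * w x)) \<mu>"
      by (rule cauchy_int_add[OF i mu])
    finally show ?thesis unfolding cauchy_int_cmult .
  qed
  show ?thesis
    unfolding L2_orth_detectable_iff
  proof safe
    assume *: "\<forall>h\<in>upper_gens \<union> lower_gens. L2_inner h ?g = 0"
    show "w \<in> lower_hardy"
      unfolding lower_hardy_def
    proof (intro CollectI conjI w allI impI)
      fix \<mu> :: complex assume "Im \<mu> > 0"
      then have "(\<lambda>x. 1 / (of_real x - \<mu>)) \<in> upper_gens" by (auto simp: upper_gens_def)
      from bspec[OF * UnI1[OF this]] show "cauchy_int w \<mu> = 0" unfolding up .
    qed
    fix \<mu> :: complex assume mu: "Im \<mu> < 0"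
    then have "(\<lambda>x. (D \<mu> + 2 * of_real pi * \<i> * hardy_bar \<phi> \<mu> * \<psi> x) / (of_real x - \<mu>)) \<in> lower_gens"
      by (auto simp: lower_gens_def)
    from bspec[OF * UnI2[OF this]] show "D \<mu> * cauchy_int w \<mu>
      + 2 * of_real pi * \<i> * hardy_bar \<phi> \<mu> * cauchy_int (\<lambda>x. \<psi> x * w x) \<mu> = 0"
      unfolding low[OF mu] .
  next
    show "?g \<in> L2" using w by (rule L2_cnj)
  next
    fix h assume wl: "w \<in> lower_hardy" and "h \<in> upper_gens"
    then obtain \<mu> where mu: "Im \<mu> > 0" and h: "h = (\<lambda>x. 1 / (of_real x - \<mu>))"
      by (auto simp: upper_gens_def)
    show "L2_inner h ?g = 0" unfolding h up by (rule lower_hardy_cauchy_int[OF wl mu])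
  next
    fix h assume a: "\<forall>\<mu>. Im \<mu> < 0 \<longrightarrow> D \<mu> * cauchy_int w \<mu>
      + 2 * of_real pi * \<i> * hardy_bar \<phi> \<mu> * cauchy_int (\<lambda>x. \<psi> x * w x) \<mu> = 0" and "h \<in> lower_gens"
    then obtain \<mu> where mu: "Im \<mu> < 0"
      and h: "h = (\<lambda>x. (D \<mu> + 2 * of_real pi * \<i> * hardy_bar \<phi> \<mu> * \<psi> x) / (of_real x - \<mu>))"
      by (auto simp: lower_gens_def)
    show "L2_inner h ?g = 0" unfolding h low[OF mu] using a mu by blast
  qed
qed

end

subsection \<open>Rational \<open>\<psi>\<close>\<close>

locale friedrichs_rational = friedrichs +
  fixes N :: nat and c z :: "nat \<Rightarrow> complex"
  assumes psi_AE: "AE x in lborel. \<psi> x = (\<Sum>j=1..N. c j / (of_real x - z j))"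
    and c_nz: "\<And>j. j \<in> {1..N} \<Longrightarrow> c j \<noteq> 0" and z_neg: "\<And>j. j \<in> {1..N} \<Longrightarrow> Im (z j) < 0"
    and z_inj: "inj_on z {1..N}"
begin

abbreviation "Z \<equiv> z ` {1..N}"

definition f where "f = (\<lambda>x. cnj (\<phi> x))"

abbreviation "F \<equiv> lower_ext f"

lemma f_lower: "f \<in> lower_hardy"
  unfolding f_def by (rule cnj_hardy_lower(1)[OF phi])

lemma F_eq: "Im \<mu> < 0 \<Longrightarrow> F \<mu> = hardy_bar \<phi> \<mu>"
  unfolding f_def by (rule cnj_hardy_lower(2)[OF phi])

lemma f_L2: "f \<in> L2" using f_lower by (rule lower_hardy_L2)

lemma F_isCont: "Im \<mu> < 0 \<Longrightarrow> isCont F \<mu>"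
  by (rule isCont_lower_ext[OF f_L2]) simp

lemma cauchy_int_psi_mult:
  assumes w: "w \<in> L2" and mu: "Im \<mu> \<noteq> 0" "\<mu> \<notin> Z"
  shows "cauchy_int (\<lambda>x. \<psi> x * w x) \<mu> = (\<Sum>j=1..N. c j * ((cauchy_int w \<mu> - cauchy_int w (z j)) / (\<mu> - z j)))"
proof -
  have [measurable]: "w \<in> borel_measurable borel" using w by (rule L2_measurable)
  have wz: "(\<lambda>x. w x / (of_real x - z j)) \<in> L2" if "j \<in> {1..N}" for j
    using w z_neg[OF that] by (intro L2_divide_resolvent) auto
  have "cauchy_int (\<lambda>x. \<psi> x * w x) \<mu> = cauchy_int (\<lambda>x. \<Sum>j=1..N. c j * (w x / (of_real x - z j))) \<mu>"
  proof (rule cauchy_int_cong_AE)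
    show "AE x in lborel. \<psi> x * w x = (\<Sum>j=1..N. c j * (w x / (of_real x - z j)))"
      using psi_AE by eventually_elim (simp add: sum_distrib_right)
  qed measurable
  also have "\<dots> = (\<Sum>j=1..N. cauchy_int (\<lambda>x. c j * (w x / (of_real x - z j))) \<mu>)"
    using wz mu by (intro cauchy_int_sum cauchy_integrable_L2 L2_cmult) auto
  also have "\<dots> = (\<Sum>j=1..N. c j * ((cauchy_int w \<mu> - cauchy_int w (z j)) / (\<mu> - z j)))"
  proof (rule sum.cong[OF refl])
    fix j assume j: "j \<in> {1..N}"
    have "cauchy_int (\<lambda>x. w x / (of_real x - z j)) \<mu> = (cauchy_int w \<mu> - cauchy_int w (z j)) / (\<mu> - z j)"
      by (rule cauchy_int_divide) (use w mu z_neg[OF j] j in auto)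
    then show "cauchy_int (\<lambda>x. c j * (w x / (of_real x - z j))) \<mu> = c j * ((cauchy_int w \<mu> - cauchy_int w (z j)) / (\<mu> - z j))"
      unfolding cauchy_int_cmult by simp
  qed
  finally show ?thesis .
qed

section \<open>The polynomials attached to a rational symbol\<close>

definition q :: "complex poly" where "q = (\<Prod>j=1..N. [:- z j, 1:])"
definition q_del :: "nat \<Rightarrow> complex poly" where "q_del k = (\<Prod>j\<in>{1..N} - {k}. [:- z j, 1:])"

text \<open>\<open>resid W / q\<close> is the partial fraction sum \<open>2 \<pi> \<i> (\<Sum>j. c j * W (z j) / (\<mu> - z j))\<close>.\<close>
definition resid :: "(complex \<Rightarrow> complex) \<Rightarrow> complex poly" where
  "resid W = (\<Sum>j=1..N. smult (2 * of_real pi * \<i> * c j * W (z j)) (q_del j))"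
definition p :: "complex poly" where "p = q + resid F"

lemma poly_q: "poly q \<mu> = (\<Prod>j=1..N. \<mu> - z j)"
  by (simp add: q_def poly_prod)

lemma poly_q_eq_0_iff: "poly q \<mu> = 0 \<longleftrightarrow> \<mu> \<in> Z"
  by (auto simp: poly_q)

lemma q_nz: "q \<noteq> 0" by (simp add: q_def)

lemma degree_q: "degree q = N"
  unfolding q_def by (subst degree_prod_sum_eq) auto

lemma q_del_split: "k \<in> {1..N} \<Longrightarrow> q = [:- z k, 1:] * q_del k"
  unfolding q_def q_del_def by (rule prod.remove) auto

lemma poly_q_split:
  assumes "k \<in> {1..N}"
  shows "poly q \<mu> = (\<mu> - z k) * poly (q_del k) \<mu>"
proof -
  have "poly q \<mu> = poly ([:- z k, 1:] * q_del k) \<mu>"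
    by (rule arg_cong[OF q_del_split[OF assms], of "\<lambda>p. poly p \<mu>"])
  then show ?thesis by (simp add: algebra_simps)
qed

lemma degree_q_del: "k \<in> {1..N} \<Longrightarrow> degree (q_del k) = N - 1"
  unfolding q_del_def by (subst degree_prod_sum_eq) auto

lemma q_del_self:
  assumes k: "k \<in> {1..N}"
  shows "poly (q_del k) (z k) \<noteq> 0"
proof
  assume "poly (q_del k) (z k) = 0"
  then have "(\<Prod>j\<in>{1..N} - {k}. z k - z j) = 0" by (simp add: q_del_def poly_prod)
  then have "\<exists>j\<in>{1..N} - {k}. z k - z j = 0" by (subst (asm) prod_zero_iff) auto
  then obtain j where "j \<in> {1..N} - {k}" "z k - z j = 0" by blast
  then have "j \<in> {1..N} - {k}" "z k = z j" by simp_all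
  then show False using inj_onD[OF z_inj, of k j] k by blast
qed

lemma q_del_other: "j \<in> {1..N} \<Longrightarrow> k \<in> {1..N} \<Longrightarrow> j \<noteq> k \<Longrightarrow> poly (q_del j) (z k) = 0"
  by (auto simp: q_del_def poly_prod)

text \<open>All other summands vanish at \<open>z k\<close>: \<open>resid W\<close> is a Lagrange
  interpolation polynomial for data proportional to the values \<open>W (z k)\<close>.\<close>

lemma poly_resid_z:
  assumes k: "k \<in> {1..N}"
  shows "poly (resid W) (z k) = 2 * of_real pi * \<i> * c k * W (z k) * poly (q_del k) (z k)"
proof -
  have "poly (resid W) (z k) = (\<Sum>j=1..N. 2 * of_real pi * \<i> * c j * W (z j) * poly (q_del j) (z k))"
    by (simp add: resid_def poly_sum)
  also have "\<dots> = (\<Sum>j\<in>{k}. 2 * of_real pi * \<i> * c j * W (z j) * poly (q_del j) (z k))"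
    by (rule sum.mono_neutral_right) (use k in \<open>auto simp: q_del_other\<close>)
  finally show ?thesis by simp
qed

lemma poly_resid:
  assumes "\<mu> \<notin> Z"
  shows "poly (resid W) \<mu> = poly q \<mu> * (2 * of_real pi * \<i> * (\<Sum>j=1..N. c j * W (z j) / (\<mu> - z j)))"
proof -
  have "poly (resid W) \<mu> = (\<Sum>j=1..N. 2 * of_real pi * \<i> * c j * W (z j) * poly (q_del j) \<mu>)"
    by (simp add: resid_def poly_sum)
  also have "\<dots> = (\<Sum>j=1..N. poly q \<mu> * (2 * of_real pi * \<i> * (c j * W (z j) / (\<mu> - z j))))"
  proof (rule sum.cong[OF refl])
    fix j assume j: "j \<in> {1..N}"
    then have "\<mu> - z j \<noteq> 0" using assms by auto
    then show "2 * of_real pi * \<i> * c j * W (z j) * poly (q_del j) \<mu>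
        = poly q \<mu> * (2 * of_real pi * \<i> * (c j * W (z j) / (\<mu> - z j)))"
      by (simp add: poly_q_split[OF j])
  qed
  finally show ?thesis by (simp add: sum_distrib_left)
qed

lemma resid_degree: "resid W = 0 \<or> degree (resid W) < N"
proof (cases "N = 0")
  case True
  then have "{1..N} = {}" by simp
  then show ?thesis unfolding resid_def by simp
next
  case False
  have "degree (resid W) \<le> N - 1"
    unfolding resid_def
    by (rule degree_sum_le) (auto intro: order_trans[OF degree_smult_le] simp: degree_q_del)
  then show ?thesis using False by auto
qed

lemma degree_p: "degree p = N" and p_nz: "p \<noteq> 0"
proof -
  have "degree p = N \<and> p \<noteq> 0"
  proof (cases "resid F = 0")
    case True
    then show ?thesis by (simp add: p_def degree_q q_nz)
  next
    case False
    then have "degree (resid F) < degree q" using resid_degree[of F] by (simp add: degree_q)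
    then have d: "degree p = N" unfolding p_def by (simp add: degree_add_eq_left degree_q)
    then show ?thesis using False resid_degree[of F] by auto
  qed
  then show "degree p = N" "p \<noteq> 0" by auto
qed

lemma poly_p_z: "k \<in> {1..N} \<Longrightarrow> poly p (z k) = 2 * of_real pi * \<i> * c k * F (z k) * poly (q_del k) (z k)"
  using poly_resid_z[of k F] poly_q_eq_0_iff[of "z k"] by (simp add: p_def)

lemma p_over_q:
  assumes "\<mu> \<notin> Z"
  shows "poly p \<mu> / poly q \<mu> = 1 + 2 * of_real pi * \<i> * (\<Sum>j=1..N. c j * F (z j) / (\<mu> - z j))"
proof -
  have "poly q \<mu> \<noteq> 0" using assms by (simp add: poly_q_eq_0_iff)
  then show ?thesis unfolding p_def poly_add poly_resid[OF assms] by (simp add: add_divide_distrib)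
qed

lemma upper_notin_Z: "Im \<mu> \<ge> 0 \<Longrightarrow> \<mu> \<notin> Z"
  using z_neg by fastforce

text \<open>In the upper half-plane the Cauchy integral of \<open>f\<close> vanishes, so the
  resolvent identity leaves only the constants coming from the poles \<open>z j\<close>.\<close>

lemma D_upper:
  assumes mu: "Im \<mu> > 0"
  shows "D \<mu> = poly p \<mu> / poly q \<mu>" "poly q \<mu> \<noteq> 0"
proof -
  have notZ: "\<mu> \<notin> Z" by (rule upper_notin_Z[OF less_imp_le[OF mu]])
  then show "poly q \<mu> \<noteq> 0" by (simp add: poly_q_eq_0_iff)
  have "D \<mu> = 1 + (\<Sum>j=1..N. c j * ((cauchy_int f \<mu> - cauchy_int f (z j)) / (\<mu> - z j)))"
    using cauchy_int_psi_mult[OF f_L2, of \<mu>] mu notZ by (simp add: D_eq f_def)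
  also have "(\<Sum>j=1..N. c j * ((cauchy_int f \<mu> - cauchy_int f (z j)) / (\<mu> - z j)))
    = (\<Sum>j=1..N. 2 * of_real pi * \<i> * (c j * F (z j) / (\<mu> - z j)))"
  proof (rule sum.cong[OF refl])
    fix j
    have "cauchy_int f (z j) = - (2 * of_real pi * \<i>) * F (z j)" by (rule cauchy_int_lower_ext)
    then show "c j * ((cauchy_int f \<mu> - cauchy_int f (z j)) / (\<mu> - z j))
        = 2 * of_real pi * \<i> * (c j * F (z j) / (\<mu> - z j))"
      by (simp add: lower_hardy_cauchy_int[OF f_lower mu])
  qed
  finally show "D \<mu> = poly p \<mu> / poly q \<mu>"
    unfolding p_over_q[OF notZ] by (simp add: sum_distrib_left)
qed

lemma orth_condition_off_Z:
  assumes w: "w \<in> L2" and mu: "Im \<mu> < 0" "\<mu> \<notin> Z"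
  shows "D \<mu> * cauchy_int w \<mu> + 2 * of_real pi * \<i> * hardy_bar \<phi> \<mu> * cauchy_int (\<lambda>x. \<psi> x * w x) \<mu> = 0
    \<longleftrightarrow> poly p \<mu> * lower_ext w \<mu> = poly (resid (lower_ext w)) \<mu> * F \<mu>"
proof -
  define k where "k = 2 * of_real pi * \<i>"
  \<comment> \<open>\<open>S\<close> is the value at \<open>\<mu>\<close> of the rational function
    \<open>\<psi>\<close>, and \<open>R W\<close> is the partial fraction sum with coefficients
    taken from \<open>W\<close> at the poles.\<close>
  define S where "S = (\<Sum>j=1..N. c j / (\<mu> - z j))"
  define R where "R W = (\<Sum>j=1..N. c j * W (z j) / (\<mu> - z j))" for W
  have k0: "k \<noteq> 0" by (simp add: k_def)
  have mu': "Im \<mu> \<noteq> 0" using mu by simp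
  have ci: "cauchy_int (\<lambda>x. \<psi> x * v x) \<mu> = - k * (S * lower_ext v \<mu> - R (lower_ext v))" if "v \<in> L2" for v
  proof -
    have "cauchy_int (\<lambda>x. \<psi> x * v x) \<mu>
        = (\<Sum>j=1..N. - k * (c j / (\<mu> - z j) * lower_ext v \<mu> - c j * lower_ext v (z j) / (\<mu> - z j)))"
      unfolding cauchy_int_psi_mult[OF that mu' mu(2)] cauchy_int_lower_ext[of v] k_def
      by (intro sum.cong refl) (simp add: diff_divide_distrib algebra_simps)
    also have "\<dots> = - k * (S * lower_ext v \<mu> - R (lower_ext v))"
      by (simp only: S_def R_def sum_distrib_left sum_distrib_right sum_subtractf right_diff_distrib)
    finally show ?thesis .
  qed
  have qnz: "poly q \<mu> \<noteq> 0" using mu by (simp add: poly_q_eq_0_iff)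
  have pq: "poly p \<mu> = poly q \<mu> * (1 + k * R F)"
    using p_over_q[OF mu(2)] qnz by (simp add: k_def R_def field_simps)
  have rq: "poly (resid (lower_ext w)) \<mu> = poly q \<mu> * (k * R (lower_ext w))"
    unfolding poly_resid[OF mu(2)] by (simp add: k_def R_def)
  have D: "D \<mu> = 1 - k * (S * F \<mu> - R F)" using ci[OF f_L2] by (simp add: D_eq f_def)
  \<comment> \<open>The two terms containing \<open>S * F \<mu> * lower_ext w \<mu>\<close> cancel;
    \<open>1 + k * R F\<close> is the continuation of \<open>D\<close> from above.\<close>
  have "D \<mu> * cauchy_int w \<mu> + k * F \<mu> * cauchy_int (\<lambda>x. \<psi> x * w x) \<mu>
    = - k * ((1 + k * R F) * lower_ext w \<mu> - k * R (lower_ext w) * F \<mu>)"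
    unfolding D ci[OF w] cauchy_int_lower_ext[of w \<mu>] k_def[symmetric] by (simp add: algebra_simps)
  then have "D \<mu> * cauchy_int w \<mu> + k * F \<mu> * cauchy_int (\<lambda>x. \<psi> x * w x) \<mu> = 0
    \<longleftrightarrow> (1 + k * R F) * lower_ext w \<mu> = k * R (lower_ext w) * F \<mu>" using k0 by simp
  also have "\<dots> \<longleftrightarrow> poly p \<mu> * lower_ext w \<mu> = poly (resid (lower_ext w)) \<mu> * F \<mu>"
    unfolding pq rq using qnz by (simp add: mult.assoc)
  finally show ?thesis by (simp add: k_def F_eq[OF mu(1)])
qed

text \<open>The two conditions are equivalent off the finite set \<open>Z\<close>, and the
  expressions required to vanish are continuous in the lower half-plane, so in either direction the
  points of \<open>Z\<close> are recovered as limits.\<close>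

lemma orth_detectable_iff:
  assumes w: "w \<in> L2"
  shows "(\<lambda>x. cnj (w x)) \<in> L2_orth (detectable \<phi> \<psi>) \<longleftrightarrow> w \<in> lower_hardy \<and>
    (\<forall>\<mu>. Im \<mu> < 0 \<longrightarrow> poly p \<mu> * lower_ext w \<mu> = poly (resid (lower_ext w)) \<mu> * F \<mu>)"
proof -
  define A where "A \<mu> = D \<mu> * cauchy_int w \<mu> + 2 * of_real pi * \<i> * F \<mu> * cauchy_int (\<lambda>x. \<psi> x * w x) \<mu>" for \<mu>
  define B where "B \<mu> = poly p \<mu> * lower_ext w \<mu> - poly (resid (lower_ext w)) \<mu> * F \<mu>" for \<mu>
  have off: "A \<mu> = 0 \<longleftrightarrow> B \<mu> = 0" if "Im \<mu> < 0" "\<mu> \<notin> Z" for \<mu>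
    using orth_condition_off_Z[OF w that] F_eq[OF that(1)] by (simp add: A_def B_def)
  have cA: "isCont A \<mu>" if "Im \<mu> < 0" for \<mu>
    unfolding A_def using that w
    by (intro continuous_intros isCont_D F_isCont isCont_cauchy_int cauchy_integrable_L2
        cauchy_integrable_L1 L2_mult_integrable psi_L2) auto
  have cB: "isCont B \<mu>" if "Im \<mu> < 0" for \<mu>
    unfolding B_def using that w by (intro continuous_intros F_isCont isCont_lower_ext poly_isCont) auto
  have ext: "\<forall>\<mu>. Im \<mu> < 0 \<longrightarrow> H \<mu> = 0"
    if "\<And>\<mu>. Im \<mu> < 0 \<Longrightarrow> \<mu> \<notin> Z \<Longrightarrow> H \<mu> = 0" "\<And>\<mu>. Im \<mu> < 0 \<Longrightarrow> isCont H \<mu>" for H :: "complex \<Rightarrow> complex"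
  proof (intro allI impI)
    fix \<mu> :: complex assume mu: "Im \<mu> < 0"
    have "eventually (\<lambda>w. H w = 0) (at \<mu>)"
      using eventually_Im_neg[OF mu] eventually_not_in_finite[of Z \<mu>, simplified]
      by eventually_elim (use that(1) in auto)
    then show "H \<mu> = 0" using continuous_eq_at[OF that(2)[OF mu], of "\<lambda>_. 0"] by simp
  qed
  have "(\<forall>\<mu>. Im \<mu> < 0 \<longrightarrow> A \<mu> = 0) \<longleftrightarrow> (\<forall>\<mu>. Im \<mu> < 0 \<longrightarrow> B \<mu> = 0)"
    using ext[of A] ext[of B] cA cB off by meson
  moreover have "(\<forall>\<mu>. Im \<mu> < 0 \<longrightarrow> D \<mu> * cauchy_int w \<mu>
      + 2 * of_real pi * \<i> * hardy_bar \<phi> \<mu> * cauchy_int (\<lambda>x. \<psi> x * w x) \<mu> = 0) \<longleftrightarrow> (\<forall>\<mu>. Im \<mu> < 0 \<longrightarrow> A \<mu> = 0)"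
    by (auto simp: A_def F_eq)
  ultimately show ?thesis unfolding orth_detectable_cauchy[OF w] by (simp add: B_def)
qed

subsection \<open>The continuation of \<open>D\<close>\<close>

text \<open>The identity theorem near \<open>\<i>\<close> makes the difference vanish once its
  singularities are removed. Hence \<open>G\<close> and \<open>H\<close> agree on punctured
  neighbourhoods of every point, and the normalisation (limit value, or 0 at a pole) settles the
  point itself.\<close>

lemma is_D_plus_unique:
  assumes G: "is_D_plus \<phi> \<psi> G" and H: "is_D_plus \<phi> \<psi> H"
  shows "G = H"
proof
  fix a
  have Gm: "G meromorphic_on UNIV" and Hm: "H meromorphic_on UNIV"
    using G H by (auto simp: is_D_plus_def nicely_meromorphic_on_def)
  define E where "E = (\<lambda>w. G w - H w)"
  have Em: "E meromorphic_on UNIV" unfolding E_def by (intro meromorphic_intros Gm Hm)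
  have Im_ev: "eventually (\<lambda>w. Im w > 0) (at \<i>)"
    using eventually_nhds_in_open[of "{w. Im w > 0}" \<i>] open_halfspace_Im_gt[of 0]
    by (auto simp: eventually_at_filter elim: eventually_mono)
  have "eventually (\<lambda>w. remove_sings E w = E w) (at \<i>)"
    by (rule eventually_remove_sings_eq_at)
       (use Em in \<open>auto intro: meromorphic_on_isolated_singularity meromorphic_on_subset\<close>)
  with Im_ev have "eventually (\<lambda>w. remove_sings E w = 0) (at \<i>)"
    by eventually_elim (use G H in \<open>auto simp: E_def is_D_plus_def\<close>)
  then have "frequently (\<lambda>w. remove_sings E w = 0) (at \<i>)"
    by (rule eventually_frequently[rotated]) simp
  from frequently_eq_meromorphic_imp_constant[OF this remove_sings_nicely_meromorphic[OF Em]]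
  have zero: "remove_sings E w = 0" for w by (simp add: connected_UNIV)
  have "eventually (\<lambda>w. remove_sings E w = E w) (at a)"
    by (rule eventually_remove_sings_eq_at)
       (use Em in \<open>auto intro: meromorphic_on_isolated_singularity meromorphic_on_subset\<close>)
  then have ev: "eventually (\<lambda>w. G w = H w) (at a)"
    unfolding zero by eventually_elim (simp add: E_def)
  have cases: "is_pole G a \<and> G a = 0 \<or> G \<midarrow>a\<rightarrow> G a" "is_pole H a \<and> H a = 0 \<or> H \<midarrow>a\<rightarrow> H a"
    using G H by (auto simp: is_D_plus_def nicely_meromorphic_on_def)
  have pole: "is_pole G a \<longleftrightarrow> is_pole H a" by (rule is_pole_cong[OF ev refl])
  have lim: "G \<midarrow>a\<rightarrow> L \<longleftrightarrow> H \<midarrow>a\<rightarrow> L" for L by (rule filterlim_cong[OF refl refl ev])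
  have nolim: "\<not> (G \<midarrow>a\<rightarrow> L)" if "is_pole G a" for L
    using that not_tendsto_and_filterlim_at_infinity[of "at a" G L] by (auto simp: is_pole_def)
  show "G a = H a"
  proof (cases "is_pole G a")
    case True
    then show ?thesis using cases nolim lim pole by auto
  next
    case False
    then have "G \<midarrow>a\<rightarrow> G a" "G \<midarrow>a\<rightarrow> H a" using cases pole lim by auto
    then show ?thesis using tendsto_unique[OF trivial_limit_at] by blast
  qed
qed

lemma rational_analytic: "\<mu> \<notin> Z \<Longrightarrow> (\<lambda>w. poly p w / poly q w) analytic_on {\<mu>}"
  by (intro analytic_intros poly_analytic_on) (auto simp: poly_q_eq_0_iff)

lemma is_D_plus_rational: "is_D_plus \<phi> \<psi> (remove_sings (\<lambda>w. poly p w / poly q w))"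
proof -
  have "(\<lambda>w. poly p w / poly q w) meromorphic_on UNIV"
    by (intro meromorphic_intros analytic_on_imp_meromorphic_on poly_analytic_on)
  then have "remove_sings (\<lambda>w. poly p w / poly q w) nicely_meromorphic_on UNIV"
    by (rule remove_sings_nicely_meromorphic)
  moreover have "remove_sings (\<lambda>w. poly p w / poly q w) \<mu> = D \<mu>" if "Im \<mu> > 0" for \<mu>
  proof -
    have "\<mu> \<notin> Z" by (rule upper_notin_Z[OF less_imp_le[OF that]])
    then show ?thesis using remove_sings_at_analytic[OF rational_analytic] D_upper[OF that] by simp
  qed
  ultimately show ?thesis by (simp add: is_D_plus_def)
qed

lemma D_plus_eq: "D_plus \<phi> \<psi> = remove_sings (\<lambda>w. poly p w / poly q w)"
  unfolding D_plus_def by (rule the_equality) (auto intro: is_D_plus_rational is_D_plus_unique)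

lemma D_plus_off_Z: "\<mu> \<notin> Z \<Longrightarrow> D_plus \<phi> \<psi> \<mu> = poly p \<mu> / poly q \<mu>"
  unfolding D_plus_eq by (rule remove_sings_at_analytic[OF rational_analytic])

lemma part_a:
  "(\<exists>p q :: complex poly. q \<noteq> 0 \<and>
      (\<forall>\<mu>. Im \<mu> > 0 \<longrightarrow> poly q \<mu> \<noteq> 0 \<and> D_fun \<phi> \<psi> \<mu> = poly p \<mu> / poly q \<mu>)) \<and>
   is_D_plus \<phi> \<psi> (D_plus \<phi> \<psi>) \<and>
   (\<forall>\<mu>. \<mu> \<notin> z ` {1..N} \<longrightarrow>
      D_plus \<phi> \<psi> \<mu> = 1 + 2 * of_real pi * \<i> * (\<Sum>j=1..N. c j * hardy_bar \<phi> (z j) / (\<mu> - z j)))"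
proof (intro conjI allI impI)
  show "\<exists>p q :: complex poly. q \<noteq> 0 \<and>
      (\<forall>\<mu>. Im \<mu> > 0 \<longrightarrow> poly q \<mu> \<noteq> 0 \<and> D_fun \<phi> \<psi> \<mu> = poly p \<mu> / poly q \<mu>)"
    using q_nz D_upper by blast
  show "is_D_plus \<phi> \<psi> (D_plus \<phi> \<psi>)" unfolding D_plus_eq by (rule is_D_plus_rational)
  fix \<mu> assume mu: "\<mu> \<notin> Z"
  have "(\<Sum>j=1..N. c j * hardy_bar \<phi> (z j) / (\<mu> - z j)) = (\<Sum>j=1..N. c j * F (z j) / (\<mu> - z j))"
    using F_eq z_neg by (intro sum.cong refl) simp
  then show "D_plus \<phi> \<psi> \<mu> = 1 + 2 * of_real pi * \<i> * (\<Sum>j=1..N. c j * hardy_bar \<phi> (z j) / (\<mu> - z j))"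
    unfolding D_plus_off_Z[OF mu] p_over_q[OF mu] by simp
qed

end

section \<open>The dimension formula\<close>

lemma tendsto_eventually_bounded:
  fixes h :: "complex \<Rightarrow> complex"
  assumes "(h \<longlongrightarrow> L) (at a)"
  shows "eventually (\<lambda>w. norm (h w) \<le> norm L + 1) (at a)"
proof -
  have "eventually (\<lambda>w. norm (h w) < norm L + 1) (at a)"
    by (rule order_tendstoD(2)[OF tendsto_norm[OF assms]]) simp
  then show ?thesis by eventually_elim simp
qed

text \<open>Split off the exact power \<open>k\<close> of the linear factor. If
  \<open>k < n\<close>, the bound forces the cofactor to vanish at \<open>a\<close>, against
  maximality of \<open>k\<close>.\<close>

lemma linear_power_dvd_of_bound:
  fixes r :: "complex poly"
  assumes bound: "eventually (\<lambda>w. norm (poly r w) \<le> K * norm (w - a) ^ n) (at a)"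
  shows "[:- a, 1:] ^ n dvd r"
proof (rule ccontr)
  assume ndvd: "\<not> [:- a, 1:] ^ n dvd r"
  then have r: "r \<noteq> 0" by auto
  define k where "k = order a r"
  have k: "k < n" using ndvd r by (simp add: order_divides k_def)
  obtain s where s: "r = [:- a, 1:] ^ k * s" "\<not> [:- a, 1:] dvd s"
    using order_decomp[OF r, of a] by (auto simp: k_def)
  have sa: "poly s a \<noteq> 0" using s(2) by (simp add: poly_eq_0_iff_dvd)
  have "(poly s \<longlongrightarrow> 0) (at a)"
  proof (rule Lim_null_comparison)
    have "((\<lambda>w. K * norm (w - a) ^ (n - k)) \<longlongrightarrow> K * norm (a - a) ^ (n - k)) (at a)"
      by (intro tendsto_intros)
    then show "((\<lambda>w. K * norm (w - a) ^ (n - k)) \<longlongrightarrow> 0) (at a)" using k by (simp add: power_0_left)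
    show "eventually (\<lambda>w. norm (poly s w) \<le> K * norm (w - a) ^ (n - k)) (at a)"
      using bound eventually_neq_at_within[of a a UNIV]
    proof eventually_elim
      case (elim w)
      have "norm (w - a) ^ k * norm (poly s w) \<le> K * norm (w - a) ^ n"
        using elim(1) by (simp add: s(1) poly_power norm_mult norm_power)
      also have "norm (w - a) ^ n = norm (w - a) ^ k * norm (w - a) ^ (n - k)"
        using k by (simp flip: power_add)
      finally have "norm (w - a) ^ k * norm (poly s w) \<le> norm (w - a) ^ k * (K * norm (w - a) ^ (n - k))"
        by (simp add: mult_ac)
      then show ?case using elim(2) by (simp add: mult_le_cancel_left_pos)
    qed
  qed
  moreover have "(poly s \<longlongrightarrow> poly s a) (at a)" using poly_isCont[of a s] by (simp add: isCont_def)
  ultimately show False using sa tendsto_unique[OF trivial_limit_at] by blast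
qed

definition root_prod :: "complex set \<Rightarrow> (complex \<Rightarrow> nat) \<Rightarrow> complex poly" where
  "root_prod A n = (\<Prod>a\<in>A. [:- a, 1:] ^ n a)"

lemma degree_root_prod: "degree (root_prod A n) = (\<Sum>a\<in>A. n a)"
  unfolding root_prod_def by (subst degree_prod_sum_eq) (auto simp: degree_linear_power)

lemma root_prod_nz: "root_prod A n \<noteq> 0"
  by (cases "finite A") (auto simp: root_prod_def)

lemma linear_power_dvd_root_prod: "finite A \<Longrightarrow> a \<in> A \<Longrightarrow> [:- a, 1:] ^ n a dvd root_prod A n"
  unfolding root_prod_def by (rule dvd_prodI)

text \<open>Splitting off a power of one linear factor leaves the root orders at all other points
  unchanged.\<close>

lemma root_prod_dvd:
  assumes "finite A" "\<And>a. a \<in> A \<Longrightarrow> [:- a, 1:] ^ n a dvd r"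
  shows "root_prod A n dvd r"
  using assms
proof (induction A arbitrary: r rule: finite_induct)
  case empty
  then show ?case by (simp add: root_prod_def)
next
  case (insert a A)
  obtain s where s: "r = [:- a, 1:] ^ n a * s" using insert.prems[of a] by (auto elim: dvdE)
  have "[:- b, 1:] ^ n b dvd s" if b: "b \<in> A" for b
  proof (cases "s = 0")
    case False
    have ne: "b \<noteq> a" using b insert.hyps by auto
    have r0: "r \<noteq> 0" using False s by simp
    have "order b r = order b ([:- a, 1:] ^ n a) + order b s"
      unfolding s by (rule order_mult) (use r0 s in simp)
    also have "order b ([:- a, 1:] ^ n a) = 0" by (rule order_0I) (use ne in \<open>simp add: poly_power\<close>)
    finally have "order b r = order b s" by simp
    moreover have "n b \<le> order b r" using insert.prems[of b] b r0 by (auto simp: order_divides)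
    ultimately show ?thesis using False by (simp add: order_divides)
  qed simp
  from insert.IH[OF this] have "root_prod A n dvd s" .
  then show ?case using insert.hyps unfolding s root_prod_def by (simp add: mult_dvd_mono)
qed

section \<open>Poles in the lower half-plane\<close>

context friedrichs_rational
begin

lemma eventually_regular:
  assumes "Im a < 0"
  shows "eventually (\<lambda>w. Im w < 0 \<and> w \<noteq> a \<and> w \<notin> Z \<and> poly p w \<noteq> 0 \<and> poly q w \<noteq> 0) (at a)"
  using eventually_Im_neg[OF assms] eventually_neq_at_within[of a a UNIV]
    eventually_not_in_finite[of Z a, simplified] eventually_poly_nonzero[OF p_nz, of a]
    eventually_poly_nonzero[OF q_nz, of a]
  by eventually_elim auto

lemma F_analytic:
  assumes "Im a < 0"
  shows "F analytic_on {a}"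
  using lower_ext_holomorphic[OF f_L2] assms open_halfspace_Im_lt[of 0]
  by (auto simp: analytic_at)

abbreviation "quotient_fun \<equiv> \<lambda>w. hardy_bar \<phi> w / D_plus \<phi> \<psi> w"

lemma quotient_fun_eq: "Im w < 0 \<Longrightarrow> w \<notin> Z \<Longrightarrow> quotient_fun w = F w * poly q w / poly p w"
  by (simp add: F_eq D_plus_off_Z)

lemma lower_pole_factor:
  assumes a: "a \<in> lower_poles \<phi> \<psi> Z"
  obtains h where "isCont h a" "h a \<noteq> 0" "lower_order \<phi> \<psi> a > 0"
    "eventually (\<lambda>w. F w * poly q w / poly p w = h w / (w - a) ^ lower_order \<phi> \<psi> a \<and> h w \<noteq> 0) (at a)"
proof -
  have a': "Im a < 0" "a \<notin> Z" "is_pole quotient_fun a" using a by (auto simp: lower_poles_def)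
  \<comment> \<open>All points of \<open>Z\<close> and all zeros of \<open>p\<close> other than
    \<open>a\<close> are removed, so that the quotient is holomorphic on
    \<open>S - {a}\<close>.\<close>
  define S where "S = {w. Im w < 0} - ((Z \<union> {w. poly p w = 0}) - {a})"
  have S: "open S" "a \<in> S"
    using a' poly_roots_finite[OF p_nz] unfolding S_def
    by (auto intro!: open_Diff open_halfspace_Im_lt finite_imp_closed)
  have "(\<lambda>w. F w * poly q w / poly p w) holomorphic_on S - {a}"
    by (intro holomorphic_intros holomorphic_on_subset[OF lower_ext_holomorphic[OF f_L2]]
        analytic_imp_holomorphic[OF poly_analytic_on]) (auto simp: S_def)
  then have hol: "quotient_fun holomorphic_on S - {a}"
    by (rule holomorphic_transform) (auto simp: S_def quotient_fun_eq)
  define h where "h = zor_poly quotient_fun a"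
  have z: "zorder quotient_fun a < 0" "h a \<noteq> 0"
    and "\<exists>r>0. cball a r \<subseteq> S \<and> h holomorphic_on cball a r \<and> (\<forall>w\<in>cball a r - {a}.
      quotient_fun w = h w / (w - a) ^ nat (- zorder quotient_fun a) \<and> h w \<noteq> 0)"
    using zorder_exist_pole[OF hol S a'(3)] by (auto simp: h_def)
  then obtain r where r: "r > 0" "h holomorphic_on cball a r"
    "\<And>w. w \<in> cball a r - {a} \<Longrightarrow> quotient_fun w = h w / (w - a) ^ lower_order \<phi> \<psi> a \<and> h w \<noteq> 0"
    unfolding lower_order_def by auto
  show ?thesis
  proof (rule that)
    have "h holomorphic_on ball a r" using r(2) by (rule holomorphic_on_subset) auto
    then have "continuous_on (ball a r) h" by (rule holomorphic_on_imp_continuous_on)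
    then show "isCont h a" using r(1) by (simp add: continuous_on_eq_continuous_at)
    show "h a \<noteq> 0" by (rule z)
    show "lower_order \<phi> \<psi> a > 0" using z(1) by (simp add: lower_order_def)
    have "eventually (\<lambda>w. w \<in> ball a r) (at a)"
      using r(1) eventually_nhds_in_open[of "ball a r" a] by (auto simp: eventually_at_filter elim: eventually_mono)
    then show "eventually (\<lambda>w. F w * poly q w / poly p w = h w / (w - a) ^ lower_order \<phi> \<psi> a \<and> h w \<noteq> 0) (at a)"
      using eventually_regular[OF a'(1)]
    proof eventually_elim
      case (elim w)
      then have "w \<in> cball a r - {a}" by auto
      from r(3)[OF this] elim(2) show ?case by (simp add: quotient_fun_eq)
    qed
  qed
qed

text \<open>A meromorphic quotient without a pole has a finite limit, and \<open>q\<close> does not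
  vanish at \<open>a\<close>, so that factor can be divided out.\<close>

lemma F_bounded_by_p:
  assumes a: "Im a < 0" "a \<notin> Z" "a \<notin> lower_poles \<phi> \<psi> Z"
  shows "\<exists>K. eventually (\<lambda>w. norm (F w) \<le> K * norm (poly p w)) (at a)"
proof -
  define H where "H = (\<lambda>w. F w * poly q w / poly p w)"
  have an: "(\<lambda>w. F w * poly q w) analytic_on {a}" "poly p analytic_on {a}"
    by (intro analytic_intros F_analytic a poly_analytic_on)+
  have ness: "not_essential H a" unfolding H_def
    by (intro not_essential_divide not_essential_analytic an isolated_singularity_at_analytic)
  have "eventually (\<lambda>w. quotient_fun w = H w) (at a)"
    using eventually_regular[OF a(1)] by eventually_elim (auto simp: H_def quotient_fun_eq)
  from is_pole_cong[OF this refl] have "\<not> is_pole H a" using a by (auto simp: lower_poles_def)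
  then obtain L where L: "(H \<longlongrightarrow> L) (at a)" using ness by (auto simp: not_essential_def)
  have qa: "poly q a \<noteq> 0" using a by (simp add: poly_q_eq_0_iff)
  have "((\<lambda>w. H w / poly q w) \<longlongrightarrow> L / poly q a) (at a)"
    using poly_isCont[of a q] qa by (intro tendsto_divide L) (auto simp: isCont_def)
  from tendsto_eventually_bounded[OF this]
  have "eventually (\<lambda>w. norm (F w) \<le> (norm (L / poly q a) + 1) * norm (poly p w)) (at a)"
    using eventually_regular[OF a(1)]
  proof eventually_elim
    case (elim w)
    then have "F w = (H w / poly q w) * poly p w" by (simp add: H_def)
    then show ?case using elim(1) by (metis norm_mult mult_right_mono norm_ge_zero)
  qed
  then show ?thesis by blast
qed

subsection \<open>Singularities on the real line\<close>

abbreviation "real_quot k x0 \<equiv> \<lambda>x. (of_real (x - x0)) ^ k * f x / poly p (of_real x)"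

lemma f_measurable [measurable]: "f \<in> borel_measurable borel"
  by (rule L2_measurable[OF f_L2])

text \<open>\<open>q\<close> has no real zeros, so both \<open>q\<close> and \<open>1 / q\<close>
  are bounded near a real point and \<open>D_plus\<close> may be replaced by its numerator.\<close>

lemma real_order_eq: "real_order \<phi> \<psi> x0 = (LEAST k. sq_integrable_near (real_quot k x0) x0)"
proof -
  have qr: "poly q (of_real x) \<noteq> 0" for x :: real
    unfolding poly_q_eq_0_iff by (rule upper_notin_Z) simp
  have eq: "(of_real (x - x0)) ^ k * cnj (\<phi> x) / D_plus \<phi> \<psi> (of_real x) = poly q (of_real x) * real_quot k x0 x" for k x
    using D_plus_off_Z[OF upper_notin_Z, of "of_real x"] by (simp add: f_def)
  have "sq_integrable_near (\<lambda>x. poly q (of_real x) * real_quot k x0 x) x0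
    \<longleftrightarrow> sq_integrable_near (real_quot k x0) x0" for k
  proof
    assume "sq_integrable_near (real_quot k x0) x0"
    then show "sq_integrable_near (\<lambda>x. poly q (of_real x) * real_quot k x0 x) x0"
      by (rule sq_integrable_near_mult) (auto intro: poly_isCont)
  next
    assume "sq_integrable_near (\<lambda>x. poly q (of_real x) * real_quot k x0 x) x0"
    then have "sq_integrable_near (\<lambda>x. (1 / poly q (of_real x)) * (poly q (of_real x) * real_quot k x0 x)) x0"
      by (rule sq_integrable_near_mult[where h="\<lambda>w. 1 / poly q w"])
         (use qr in \<open>auto intro!: continuous_intros poly_isCont\<close>)
    then show "sq_integrable_near (real_quot k x0) x0" using qr by simp
  qed
  then show ?thesis unfolding real_order_def eq by simp
qed

lemma real_quot_sq_integrable: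
  assumes v: "v \<in> L2" and s: "poly s (of_real x0) \<noteq> 0"
    and ae: "AE x in lborel. real_quot k x0 x = v x / poly s (of_real x)"
  shows "sq_integrable_near (real_quot k x0) x0"
proof -
  have cont: "isCont (\<lambda>w. 1 / poly s w) (of_real x0)"
    using s by (intro continuous_intros poly_isCont) auto
  obtain d where d: "d > 0" "\<And>x. \<bar>x - x0\<bar> < d \<Longrightarrow>
      norm (1 / poly s (of_real x)) \<le> norm (1 / poly s (of_real x0)) + 1"
    using isCont_bounded_near[OF cont] by blast
  show ?thesis
  proof (rule sq_integrable_near_bound[OF sq_integrable_near_L2[OF v] _ d(1)])
    show "real_quot k x0 \<in> borel_measurable borel" by measurable
    show "AE x in lborel. \<bar>x - x0\<bar> < d \<longrightarrow>
      norm (real_quot k x0 x) \<le> (norm (1 / poly s (of_real x0)) + 1) * norm (v x)"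
      using ae
    proof (eventually_elim, intro impI)
      fix x assume e: "real_quot k x0 x = v x / poly s (of_real x)" and x: "\<bar>x - x0\<bar> < d"
      have "real_quot k x0 x = (1 / poly s (of_real x)) * v x" unfolding e by simp
      then show "norm (real_quot k x0 x) \<le> (norm (1 / poly s (of_real x0)) + 1) * norm (v x)"
        using d(2)[OF x] by (simp only: norm_mult mult_right_mono norm_ge_zero)
    qed
  qed
qed

text \<open>A power equal to the order of the zero of \<open>p\<close> cancels it entirely. So the
  minimum defining \<open>real_order\<close> is attained and at most that order.\<close>

lemma real_quot_order_p: "sq_integrable_near (real_quot (order (of_real x0) p) x0) x0"
proof -
  define k where "k = order (of_real x0) p"
  obtain s where s: "p = [:- of_real x0, 1:] ^ k * s" "\<not> [:- of_real x0, 1:] dvd s"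
    using order_decomp[OF p_nz, of "of_real x0"] by (auto simp: k_def)
  have s0: "poly s (of_real x0) \<noteq> 0" using s(2) by (simp add: poly_eq_0_iff_dvd)
  show ?thesis unfolding k_def[symmetric]
  proof (rule real_quot_sq_integrable[OF f_L2 s0])
    show "AE x in lborel. real_quot k x0 x = f x / poly s (of_real x)"
      using AE_poly_nonzero[OF p_nz]
    proof eventually_elim
      case (elim x)
      have pw: "poly p (of_real x) = (of_real (x - x0)) ^ k * poly s (of_real x)"
        by (simp add: s(1) poly_power)
      then have X0: "(of_real (x - x0)) ^ k \<noteq> (0 :: complex)" using elim by auto
      show ?case unfolding pw by (rule nonzero_mult_divide_mult_cancel_left[OF X0])
    qed
  qed
qed

lemma real_quot_real_order: "sq_integrable_near (real_quot (real_order \<phi> \<psi> x0) x0) x0"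
  unfolding real_order_eq
  by (rule LeastI[where P="\<lambda>k. sq_integrable_near (real_quot k x0) x0", OF real_quot_order_p])

lemma real_order_le: "sq_integrable_near (real_quot k x0) x0 \<Longrightarrow> real_order \<phi> \<psi> x0 \<le> k"
  unfolding real_order_eq
  by (rule Least_le[where P="\<lambda>k. sq_integrable_near (real_quot k x0) x0"])

lemma real_order_dvd_p: "[:- of_real x0, 1:] ^ real_order \<phi> \<psi> x0 dvd p"
  using real_order_le[OF real_quot_order_p] p_nz by (simp add: order_divides)

text \<open>With \<open>k\<close> the order of \<open>r\<close> at the point, the quotient with
  exponent \<open>k\<close> equals \<open>w\<close> divided by a polynomial that is nonzero there,
  hence is square integrable nearby. Minimality bounds \<open>real_order\<close> by
  \<open>k\<close>.\<close>

lemma real_order_dvd: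
  assumes w: "w \<in> L2" and eq: "AE x in lborel. poly p (of_real x) * w x = poly r (of_real x) * f x"
  shows "[:- of_real x0, 1:] ^ real_order \<phi> \<psi> x0 dvd r"
proof (cases "r = 0")
  case False
  define k where "k = order (of_real x0) r"
  obtain s where s: "r = [:- of_real x0, 1:] ^ k * s" "\<not> [:- of_real x0, 1:] dvd s"
    using order_decomp[OF False, of "of_real x0"] by (auto simp: k_def)
  have s0: "poly s (of_real x0) \<noteq> 0" using s(2) by (simp add: poly_eq_0_iff_dvd)
  have "sq_integrable_near (real_quot k x0) x0"
  proof (rule real_quot_sq_integrable[OF w s0])
    show "AE x in lborel. real_quot k x0 x = w x / poly s (of_real x)"
      using AE_poly_nonzero[OF p_nz] AE_poly_nonzero[OF False] eq
    proof eventually_elim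
      case (elim x)
      have r: "poly r (of_real x) = (of_real (x - x0)) ^ k * poly s (of_real x)"
        by (simp add: s(1) poly_power)
      then have "poly s (of_real x) \<noteq> 0" using elim(2) by auto
      moreover have "poly p (of_real x) * w x = poly s (of_real x) * ((of_real (x - x0)) ^ k * f x)"
        using elim(3) unfolding r by (simp only: mult_ac)
      ultimately show ?case using elim(1) by (simp add: frac_eq_eq mult_ac del: of_real_diff)
    qed
  qed
  from real_order_le[OF this] show ?thesis using False by (simp add: order_divides k_def)
qed simp

end

subsection \<open>The zeros to be cancelled\<close>

locale friedrichs_limits = friedrichs_rational +
  assumes limits: "M0_limits_exist \<phi> \<psi> N c z"
begin

definition lim_quot :: "nat \<Rightarrow> complex" where
  "lim_quot k = Lim (at (z k)) (M0_quot \<phi> \<psi> (c k) (z k))"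

text \<open>The limit of \<open>F / p\<close> at \<open>z k\<close>: near that point
  \<open>M0_quot\<close> is \<open>F / p\<close> times a polynomial factor, whose value at
  \<open>z k\<close> is the denominator here.\<close>

definition ratio :: "nat \<Rightarrow> complex" where
  "ratio k = lim_quot k / (2 * of_real pi * \<i> * c k * poly (q_del k) (z k))"

lemma lim_quot_ratio:
  assumes "k \<in> {1..N}"
  shows "lim_quot k = 2 * of_real pi * \<i> * c k * poly (q_del k) (z k) * ratio k"
  using c_nz[OF assms] q_del_self[OF assms] by (simp add: ratio_def)

text \<open>\<open>M0_quot\<close> equals \<open>F / p\<close> times the factor \<open>?C\<close>,
  which is nonzero at \<open>z k\<close>. Where \<open>F\<close> does not vanish,
  \<open>p (z k) = ?C (z k) * F (z k)\<close> gives the limit 1; where it vanishes,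
  \<open>limits\<close> supplies the limit.\<close>

lemma ratio_tendsto:
  assumes k: "k \<in> {1..N}"
  shows "((\<lambda>w. F w / poly p w) \<longlongrightarrow> ratio k) (at (z k))" and "F (z k) \<noteq> 0 \<Longrightarrow> lim_quot k = 1"
proof -
  let ?C = "\<lambda>w. 2 * of_real pi * \<i> * c k * poly (q_del k) w"
  let ?M = "M0_quot \<phi> \<psi> (c k) (z k)"
  have zk: "Im (z k) < 0" by (rule z_neg[OF k])
  have C0: "?C (z k) \<noteq> 0" using c_nz[OF k] q_del_self[OF k] by simp
  have Ct: "(?C \<longlongrightarrow> ?C (z k)) (at (z k))"
    using poly_isCont[of "z k" "q_del k"] unfolding isCont_def by (intro tendsto_mult tendsto_const)
  have ev: "eventually (\<lambda>w. ?M w = ?C w * (F w / poly p w)) (at (z k))"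
    using eventually_regular[OF zk]
  proof eventually_elim
    case (elim w)
    have qw: "poly q w = (w - z k) * poly (q_del k) w" by (rule poly_q_split[OF k])
    have nz: "w - z k \<noteq> 0" "poly (q_del k) w \<noteq> 0" using elim qw by auto
    have w: "w \<notin> Z" "Im w < 0" using elim by blast+
    have gen: "X * Y * U / (V / (d * Q) * d) = X * U * Q * (Y / V)"
      if "d \<noteq> 0" "Q \<noteq> 0" "V \<noteq> 0" for X Y U V d Q :: complex
      using that by simp
    have "?M w = 2 * of_real pi * \<i> * F w * c k / (poly p w / ((w - z k) * poly (q_del k) w) * (w - z k))"
      unfolding M0_quot_def qw[symmetric] D_plus_off_Z[OF w(1)] F_eq[OF w(2)] by (rule refl)
    also have "\<dots> = ?C w * (F w / poly p w)" using nz elim by (intro gen) auto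
    finally show ?case .
  qed
  have conv: "((\<lambda>w. F w / poly p w) \<longlongrightarrow> L / ?C (z k)) (at (z k)) \<and> lim_quot k = L" if L: "(?M \<longlongrightarrow> L) (at (z k))" for L
  proof
    show "lim_quot k = L" unfolding lim_quot_def by (rule tendsto_Lim[OF trivial_limit_at L])
    have "((\<lambda>w. ?M w / ?C w) \<longlongrightarrow> L / ?C (z k)) (at (z k))" by (rule tendsto_divide[OF L Ct C0])
    moreover have "eventually (\<lambda>w. ?C w \<noteq> 0) (at (z k))" by (rule tendsto_imp_eventually_ne[OF Ct C0])
    with ev have "eventually (\<lambda>w. ?M w / ?C w = F w / poly p w) (at (z k))"
    proof eventually_elim
      case (elim w)
      show ?case unfolding elim(1) by (rule nonzero_mult_div_cancel_left[OF elim(2)])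
    qed
    ultimately show "((\<lambda>w. F w / poly p w) \<longlongrightarrow> L / ?C (z k)) (at (z k))"
      by (rule Lim_transform_eventually)
  qed
  have nz: "(?M \<longlongrightarrow> 1) (at (z k))" if F0: "F (z k) \<noteq> 0"
  proof -
    have pz: "poly p (z k) = ?C (z k) * F (z k)" unfolding poly_p_z[OF k] by (simp only: mult_ac)
    have pz0: "poly p (z k) \<noteq> 0" unfolding pz using C0 F0 by simp
    have "((\<lambda>w. ?C w * (F w / poly p w)) \<longlongrightarrow> ?C (z k) * (F (z k) / poly p (z k))) (at (z k))"
      using F_isCont[OF zk] poly_isCont[of "z k" p] pz0 unfolding isCont_def
      by (intro tendsto_mult[OF Ct] tendsto_divide)
    moreover have "?C (z k) * (F (z k) / poly p (z k)) = 1"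
      unfolding times_divide_eq_right pz[symmetric] by (rule divide_self[OF pz0])
    ultimately have "((\<lambda>w. ?C w * (F w / poly p w)) \<longlongrightarrow> 1) (at (z k))" by (simp only:)
    moreover have "eventually (\<lambda>w. ?C w * (F w / poly p w) = ?M w) (at (z k))"
      using ev by eventually_elim (rule sym)
    ultimately show ?thesis by (rule Lim_transform_eventually)
  qed
  have "\<exists>L. (?M \<longlongrightarrow> L) (at (z k))"
  proof (cases "F (z k) = 0")
    case True
    then show ?thesis using limits k F_eq[OF zk] by (auto simp: M0_limits_exist_def)
  next
    case False
    then show ?thesis using nz by blast
  qed
  then obtain L where L: "(?M \<longlongrightarrow> L) (at (z k))" by blast
  show "((\<lambda>w. F w / poly p w) \<longlongrightarrow> ratio k) (at (z k))"
    unfolding ratio_def using conv[OF L] by simp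
  show "F (z k) \<noteq> 0 \<Longrightarrow> lim_quot k = 1" using conv nz by blast
qed

text \<open>The vanishing of \<open>F\<close> at \<open>z j\<close> is implied, because elsewhere
  the limit is 1. So this is the index set counted by \<open>M0_number\<close>.\<close>

definition J where "J = {j \<in> {1..N}. lim_quot j \<noteq> 1}"

lemma J_zero: "j \<in> J \<Longrightarrow> F (z j) = 0" "j \<in> J \<Longrightarrow> j \<in> {1..N}"
  using ratio_tendsto(2) by (auto simp: J_def)

lemma card_J: "card J = M0_number \<phi> \<psi> N c z"
proof -
  have "J = {j \<in> {1..N}. hardy_bar \<phi> (z j) = 0 \<and> Lim (at (z j)) (M0_quot \<phi> \<psi> (c j) (z j)) \<noteq> 1}"
    using J_zero(1) F_eq z_neg by (auto simp: J_def lim_quot_def)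
  then show ?thesis by (simp add: M0_number_def)
qed

text \<open>Near \<open>z k\<close> one has \<open>W = r * (F / p)\<close>; pass to the limit. The
  left-hand side is the value of \<open>resid W\<close> at \<open>z k\<close>, so it is
  \<open>lim_quot k\<close> times that of \<open>r\<close>.\<close>

lemma value_at_z:
  assumes k: "k \<in> {1..N}" and W: "isCont W (z k)"
    and eq: "\<And>w. Im w < 0 \<Longrightarrow> poly p w * W w = poly r w * F w"
  shows "2 * of_real pi * \<i> * c k * W (z k) * poly (q_del k) (z k) = lim_quot k * poly r (z k)"
proof -
  have "((\<lambda>w. poly r w * (F w / poly p w)) \<longlongrightarrow> poly r (z k) * ratio k) (at (z k))"
    using poly_isCont[of "z k" r] unfolding isCont_def by (intro tendsto_mult ratio_tendsto k)
  moreover have "eventually (\<lambda>w. poly r w * (F w / poly p w) = W w) (at (z k))"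
    using eventually_regular[OF z_neg[OF k]]
  proof eventually_elim
    case (elim w)
    have "poly r w * (F w / poly p w) = poly p w * W w / poly p w"
      using eq[of w] elim by simp
    then show ?case using elim by simp
  qed
  ultimately have "(W \<longlongrightarrow> poly r (z k) * ratio k) (at (z k))" by (rule Lim_transform_eventually)
  then have "W (z k) = poly r (z k) * ratio k"
    using W tendsto_unique[OF trivial_limit_at] unfolding isCont_def by blast
  then show ?thesis unfolding lim_quot_ratio[OF k] by simp
qed

section \<open>The polynomial of the zeros to be cancelled\<close>

definition A where "A = lower_poles \<phi> \<psi> Z \<union> of_real ` real_poles \<phi> \<psi> \<union> z ` J"

definition mult where "mult a = (if a \<in> lower_poles \<phi> \<psi> Z then lower_order \<phi> \<psi> a
    else if Im a = 0 then real_order \<phi> \<psi> (Re a) else 1)"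

lemma mult_lower: "a \<in> lower_poles \<phi> \<psi> Z \<Longrightarrow> mult a = lower_order \<phi> \<psi> a"
  by (simp add: mult_def)

lemma mult_real: "mult (of_real x) = real_order \<phi> \<psi> x"
  by (simp add: mult_def lower_poles_def)

lemma mult_z: "j \<in> {1..N} \<Longrightarrow> mult (z j) = 1"
  using z_neg[of j] by (auto simp: mult_def lower_poles_def)

text \<open>Inserting the local form of the pole into the equation gives
  \<open>r = (W * q / h) * (w - a) ^ mult a\<close> near \<open>a\<close>, with a bounded first
  factor since \<open>W\<close> is continuous there.\<close>

lemma lower_dvd:
  assumes a: "a \<in> lower_poles \<phi> \<psi> Z" and W: "isCont W a"
    and eq: "eventually (\<lambda>w. poly p w * W w = poly r w * F w) (at a)"
  shows "[:- a, 1:] ^ mult a dvd r"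
proof -
  have a': "Im a < 0" "a \<notin> Z" using a by (auto simp: lower_poles_def)
  obtain h where h: "isCont h a" "h a \<noteq> 0"
    "eventually (\<lambda>w. F w * poly q w / poly p w = h w / (w - a) ^ lower_order \<phi> \<psi> a \<and> h w \<noteq> 0) (at a)"
    by (rule lower_pole_factor[OF a])
  have "isCont (\<lambda>w. W w * poly q w / h w) a" using W h by (intro continuous_intros poly_isCont)
  then have "((\<lambda>w. W w * poly q w / h w) \<longlongrightarrow> W a * poly q a / h a) (at a)" by (simp add: isCont_def)
  from tendsto_eventually_bounded[OF this]
  have "eventually (\<lambda>w. norm (poly r w) \<le> (norm (W a * poly q a / h a) + 1) * norm (w - a) ^ mult a) (at a)"
    using h(3) eq eventually_regular[OF a'(1)]
  proof eventually_elim
    case (elim w)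
    have wa: "(w - a) ^ mult a \<noteq> 0" using elim by simp
    have "F w * poly q w * (w - a) ^ mult a = h w * poly p w"
      using elim(2) elim(4) wa by (simp add: frac_eq_eq mult_lower[OF a])
    then have "poly r w * h w * poly p w = poly r w * (F w * poly q w * (w - a) ^ mult a)" by simp
    also have "\<dots> = (W w * poly q w * (w - a) ^ mult a) * poly p w"
      using elim(3) by (simp add: mult_ac)
    finally have "poly r w * h w = W w * poly q w * (w - a) ^ mult a" using elim(4) by simp
    then have "poly r w = (W w * poly q w * (w - a) ^ mult a) / h w"
      using elim(2) by (metis nonzero_mult_div_cancel_right)
    then have "poly r w = (W w * poly q w / h w) * (w - a) ^ mult a" by simp
    then have "norm (poly r w) = norm (W w * poly q w / h w) * norm (w - a) ^ mult a"
      by (simp only: norm_mult norm_power)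
    then show ?case using elim(1) by (simp only: mult_right_mono zero_le_power norm_ge_zero)
  qed
  then show ?thesis by (rule linear_power_dvd_of_bound)
qed

lemma mult_dvd_p:
  assumes "a \<in> A"
  shows "[:- a, 1:] ^ mult a dvd p"
  using assms unfolding A_def
proof (elim UnE imageE)
  assume a: "a \<in> lower_poles \<phi> \<psi> Z"
  then have "Im a < 0" by (simp add: lower_poles_def)
  \<comment> \<open>For \<open>W = F\<close> and \<open>r = p\<close> the required equation is an
    identity.\<close>
  then show ?thesis by (intro lower_dvd[OF a F_isCont] always_eventually allI refl)
next
  fix x assume "a = of_real x" "x \<in> real_poles \<phi> \<psi>"
  then show ?thesis using real_order_dvd_p by (simp add: mult_real)
next
  fix j assume a: "a = z j" and j: "j \<in> J"
  have "poly p (z j) = 0" using poly_p_z[OF J_zero(2)[OF j]] J_zero(1)[OF j] by simp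
  then show ?thesis using mult_z[OF J_zero(2)[OF j]] by (simp add: a poly_eq_0_iff_dvd)
qed

lemma mult_pos: "a \<in> A \<Longrightarrow> mult a > 0"
  unfolding A_def
proof (elim UnE imageE)
  assume a: "a \<in> lower_poles \<phi> \<psi> Z"
  from lower_pole_factor[OF a] show "mult a > 0" unfolding mult_lower[OF a] by blast
next
  fix x assume "a = of_real x" "x \<in> real_poles \<phi> \<psi>"
  then show "mult a > 0" by (simp add: mult_real real_poles_def)
next
  fix j assume "a = z j" "j \<in> J"
  then show "mult a > 0" using mult_z J_zero(2) by simp
qed

lemma A_root:
  assumes "a \<in> A"
  shows "poly p a = 0"
proof -
  have "[:- a, 1:] dvd [:- a, 1:] ^ mult a" using mult_pos[OF assms] by (intro dvd_power) simp
  then have "[:- a, 1:] dvd p" using mult_dvd_p[OF assms] by (rule dvd_trans)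
  then show ?thesis by (simp add: poly_eq_0_iff_dvd)
qed

lemma finite_A: "finite A"
  by (rule finite_subset[OF _ poly_roots_finite[OF p_nz]]) (use A_root in auto)

lemma finite_poles: "finite (lower_poles \<phi> \<psi> Z)" "finite (real_poles \<phi> \<psi>)"
proof -
  show "finite (lower_poles \<phi> \<psi> Z)" by (rule finite_subset[OF _ finite_A]) (auto simp: A_def)
  have "finite ((of_real :: real \<Rightarrow> complex) ` real_poles \<phi> \<psi>)"
    by (rule finite_subset[OF _ finite_A]) (auto simp: A_def)
  then show "finite (real_poles \<phi> \<psi>)" by (rule finite_imageD) (auto intro: inj_onI)
qed

definition m where "m = root_prod A mult"

lemma m_nz: "m \<noteq> 0" by (simp add: m_def root_prod_nz)

lemma degree_m: "degree m = (\<Sum>\<mu>\<in>lower_poles \<phi> \<psi> Z. lower_order \<phi> \<psi> \<mu>)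
    + (\<Sum>x\<in>real_poles \<phi> \<psi>. real_order \<phi> \<psi> x) + M0_number \<phi> \<psi> N c z"
proof -
  have finJ: "finite J" by (simp add: J_def)
  have injJ: "inj_on z J" by (rule inj_on_subset[OF z_inj]) (auto simp: J_def)
  have disj: "lower_poles \<phi> \<psi> Z \<inter> of_real ` real_poles \<phi> \<psi> = {}"
    "(lower_poles \<phi> \<psi> Z \<union> of_real ` real_poles \<phi> \<psi>) \<inter> z ` J = {}"
    using z_neg J_zero(2) by (fastforce simp: lower_poles_def)+
  have "degree m = (\<Sum>a\<in>lower_poles \<phi> \<psi> Z. mult a) + (\<Sum>a\<in>of_real ` real_poles \<phi> \<psi>. mult a) + (\<Sum>a\<in>z ` J. mult a)"
    unfolding m_def degree_root_prod A_def using disj finite_poles finJ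
    by (simp add: sum.union_disjoint)
  also have "(\<Sum>a\<in>of_real ` real_poles \<phi> \<psi>. mult a) = (\<Sum>x\<in>real_poles \<phi> \<psi>. real_order \<phi> \<psi> x)"
    by (subst sum.reindex) (auto simp: mult_real intro: inj_onI)
  also have "(\<Sum>a\<in>z ` J. mult a) = (\<Sum>j\<in>J. 1)"
    unfolding sum.reindex[OF injJ] by (rule sum.cong) (simp_all add: mult_z[OF J_zero(2)])
  finally show ?thesis by (simp add: mult_lower card_J)
qed

lemma m_dvd_p: "m dvd p"
  unfolding m_def by (rule root_prod_dvd[OF finite_A mult_dvd_p])

lemma power_dvd_m: "a \<in> A \<Longrightarrow> [:- a, 1:] ^ mult a dvd m"
  unfolding m_def by (rule linear_power_dvd_root_prod[OF finite_A])

text \<open>Regularity of \<open>W\<close> gives the zeros at lower poles, square integrability of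
  its boundary function those on the line, and self-consistency of \<open>resid\<close> those at the
  points \<open>z j\<close>.\<close>

lemma m_dvd_resid:
  assumes w: "w \<in> lower_hardy"
    and eq: "\<And>\<mu>. Im \<mu> < 0 \<Longrightarrow> poly p \<mu> * lower_ext w \<mu> = poly (resid (lower_ext w)) \<mu> * F \<mu>"
  shows "m dvd resid (lower_ext w)"
  unfolding m_def
proof (rule root_prod_dvd[OF finite_A])
  let ?W = "lower_ext w"
  have wL2: "w \<in> L2" using w by (rule lower_hardy_L2)
  have contW: "isCont ?W a" if "Im a < 0" for a using that by (intro isCont_lower_ext wL2) auto
  fix a assume "a \<in> A"
  then show "[:- a, 1:] ^ mult a dvd resid ?W"
    unfolding A_def
  proof (elim UnE imageE)
    assume a: "a \<in> lower_poles \<phi> \<psi> Z"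
    then have neg: "Im a < 0" by (simp add: lower_poles_def)
    have "eventually (\<lambda>\<mu>. poly p \<mu> * ?W \<mu> = poly (resid ?W) \<mu> * F \<mu>) (at a)"
      using eventually_Im_neg[OF neg] by eventually_elim (rule eq)
    then show ?thesis by (rule lower_dvd[OF a contW[OF neg]])
  next
    fix x assume "a = of_real x" "x \<in> real_poles \<phi> \<psi>"
    then show ?thesis
      using real_order_dvd[OF wL2 boundary_identity[OF f_lower w eq], of x] by (simp add: mult_real)
  next
    fix j assume a: "a = z j" and j: "j \<in> J"
    note k = J_zero(2)[OF j]
    \<comment> \<open>The value equals itself times a number different from 1, hence is
      zero.\<close>
    have "poly (resid ?W) (z j) = lim_quot j * poly (resid ?W) (z j)"
      using value_at_z[OF k contW[OF z_neg[OF k]] eq] poly_resid_z[OF k, of ?W] by simp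
    then have "poly (resid ?W) (z j) = 0" using j by (simp add: J_def)
    then show ?thesis using mult_z[OF k] by (simp add: a poly_eq_0_iff_dvd)
  qed
qed

text \<open>The part of \<open>p\<close> by which \<open>f\<close> may be divided inside the class.
  Its degree is the dimension sought: the complement consists of the conjugates of
  \<open>s f / t\<close> with \<open>s\<close> zero or of degree below that of
  \<open>t\<close>.\<close>

definition t where "t = p div m"

lemma p_eq: "p = m * t" using m_dvd_p by (simp add: t_def)

lemma t_nz: "t \<noteq> 0" using p_eq p_nz by auto

lemma degree_t: "degree m + degree t = N"
  using degree_mult_eq[OF m_nz t_nz] degree_p p_eq by simp

text \<open>At a lower pole the power in \<open>m\<close> cancels the pole of \<open>F / p\<close>.
  At the points of \<open>Z\<close> the limit \<open>ratio\<close> is finite, and elsewhere there is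
  no pole; in these cases \<open>F\<close> is bounded by \<open>p\<close>, and \<open>m\<close> is
  locally bounded.\<close>

lemma F_bounded_by_t:
  assumes a: "Im a < 0"
  shows "\<exists>K. eventually (\<lambda>w. norm (F w) \<le> K * norm (poly t w)) (at a)"
proof (cases "a \<in> lower_poles \<phi> \<psi> Z")
  case True
  then have aZ: "a \<notin> Z" by (simp add: lower_poles_def)
  obtain h where h: "isCont h a"
    "eventually (\<lambda>w. F w * poly q w / poly p w = h w / (w - a) ^ lower_order \<phi> \<psi> a \<and> h w \<noteq> 0) (at a)"
    by (rule lower_pole_factor[OF True])
  obtain m' where m': "m = [:- a, 1:] ^ mult a * m'"
    using power_dvd_m[of a] True by (auto simp: A_def elim: dvdE)
  have "isCont (\<lambda>w. h w * poly m' w / poly q w) a"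
    using h aZ by (intro continuous_intros poly_isCont) (auto simp: poly_q_eq_0_iff)
  then have "((\<lambda>w. h w * poly m' w / poly q w) \<longlongrightarrow> h a * poly m' a / poly q a) (at a)" by (simp add: isCont_def)
  from tendsto_eventually_bounded[OF this]
  have "eventually (\<lambda>w. norm (F w) \<le> (norm (h a * poly m' a / poly q a) + 1) * norm (poly t w)) (at a)"
    using h(2) eventually_regular[OF a]
  proof eventually_elim
    case (elim w)
    have pw: "poly p w = (w - a) ^ mult a * poly m' w * poly t w"
      by (simp add: p_eq m' poly_power)
    have wa: "(w - a) ^ mult a \<noteq> 0" using elim by simp
    have "F w * poly q w * (w - a) ^ mult a = h w * poly p w"
      using elim(2) elim(3) wa by (simp add: frac_eq_eq mult_lower[OF True])
    then have "F w * poly q w * (w - a) ^ mult a = (h w * poly m' w * poly t w) * (w - a) ^ mult a"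
      unfolding pw by (simp add: mult_ac)
    then have "F w * poly q w = h w * poly m' w * poly t w" by (rule mult_right_cancel[OF wa, THEN iffD1])
    then have "F w = (h w * poly m' w * poly t w) / poly q w"
      using elim(3) by (metis nonzero_mult_div_cancel_right)
    then have "F w = (h w * poly m' w / poly q w) * poly t w" by simp
    then have "norm (F w) = norm (h w * poly m' w / poly q w) * norm (poly t w)" by (simp only: norm_mult)
    then show ?case using elim(1) by (simp only: mult_right_mono norm_ge_zero)
  qed
  then show ?thesis by blast
next
  case False
  have "\<exists>K. eventually (\<lambda>w. norm (F w) \<le> K * norm (poly p w)) (at a)"
  proof (cases "a \<in> Z")
    case True
    then obtain k where k: "k \<in> {1..N}" "a = z k" by blast
    from tendsto_eventually_bounded[OF ratio_tendsto(1)[OF k(1)]]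
    have "eventually (\<lambda>w. norm (F w) \<le> (norm (ratio k) + 1) * norm (poly p w)) (at (z k))"
      using eventually_regular[OF z_neg[OF k(1)]]
      by eventually_elim (auto simp: norm_divide divide_simps split: if_splits)
    then show ?thesis unfolding k(2) by blast
  next
    case False2: False
    show ?thesis by (rule F_bounded_by_p[OF a False2 False])
  qed
  then obtain K where K: "eventually (\<lambda>w. norm (F w) \<le> K * norm (poly p w)) (at a)" by blast
  have "(poly m \<longlongrightarrow> poly m a) (at a)" using poly_isCont[of a m] by (simp add: isCont_def)
  from tendsto_eventually_bounded[OF this] K
  have "eventually (\<lambda>w. norm (F w) \<le> (\<bar>K\<bar> * (norm (poly m a) + 1)) * norm (poly t w)) (at a)"
  proof eventually_elim
    case (elim w)
    have "norm (F w) \<le> \<bar>K\<bar> * (norm (poly m w) * norm (poly t w))"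
      using order_trans[OF elim(2) mult_right_mono[OF abs_ge_self norm_ge_zero]]
      by (simp only: p_eq poly_mult norm_mult)
    also have "\<dots> \<le> \<bar>K\<bar> * ((norm (poly m a) + 1) * norm (poly t w))"
      using elim(1) by (intro mult_left_mono mult_right_mono) auto
    finally show ?case by (simp add: mult.assoc)
  qed
  then show ?thesis by blast
qed

text \<open>\<open>m\<close> contains \<open>x - x0\<close> to the power \<open>real_order\<close>,
  so \<open>f / t\<close> is, up to a null set, the square integrable quotient times a bounded
  cofactor.\<close>

lemma sq_integrable_near_t: "sq_integrable_near (\<lambda>x. f x / poly t (of_real x)) x0"
proof -
  let ?n = "real_order \<phi> \<psi> x0"
  have "[:- of_real x0, 1:] ^ ?n dvd m"
  proof (cases "?n = 0")
    case False
    then have "of_real x0 \<in> A" by (auto simp: A_def real_poles_def)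
    then show ?thesis using power_dvd_m mult_real by metis
  qed simp
  then obtain m' where m': "m = [:- of_real x0, 1:] ^ ?n * m'" by (auto elim: dvdE)
  obtain d where d: "d > 0" "\<And>x. \<bar>x - x0\<bar> < d \<Longrightarrow> norm (poly m' (of_real x)) \<le> norm (poly m' (of_real x0)) + 1"
    using isCont_bounded_near[where h="poly m'" and a=x0] by (auto intro: poly_isCont)
  show ?thesis
  proof (rule sq_integrable_near_bound[OF real_quot_real_order[of x0] _ d(1)])
    show "(\<lambda>x. f x / poly t (of_real x)) \<in> borel_measurable borel" by measurable
    show "AE x in lborel. \<bar>x - x0\<bar> < d \<longrightarrow> norm (f x / poly t (of_real x))
      \<le> (norm (poly m' (of_real x0)) + 1) * norm (real_quot ?n x0 x)"
      using AE_poly_nonzero[OF p_nz]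
    proof (eventually_elim, intro impI)
      fix x assume nz: "poly p (complex_of_real x) \<noteq> 0" and x: "\<bar>x - x0\<bar> < d"
      have pw: "poly p (of_real x) = of_real (x - x0) ^ ?n * poly m' (of_real x) * poly t (of_real x)"
        by (simp add: p_eq m' poly_power)
      have gen: "u / T = M * (X * u / (X * M * T))" if "X \<noteq> 0" "M \<noteq> 0" for u T M X :: complex
        using that by simp
      have "f x / poly t (of_real x) = poly m' (of_real x) * real_quot ?n x0 x"
        unfolding pw by (rule gen) (use nz pw in auto)
      then show "norm (f x / poly t (of_real x)) \<le> (norm (poly m' (of_real x0)) + 1) * norm (real_quot ?n x0 x)"
        using d(2)[OF x] by (simp only: norm_mult mult_right_mono norm_ge_zero)
    qed
  qed
qed

section \<open>Explicit description of the orthogonal complement\<close>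

lemma element_lower_hardy:
  assumes "degree s \<le> degree t"
  defines "e \<equiv> \<lambda>x. poly s (of_real x) * f x / poly t (of_real x)"
  shows "e \<in> lower_hardy" "\<And>\<mu>. Im \<mu> < 0 \<Longrightarrow> poly t \<mu> * lower_ext e \<mu> = poly s \<mu> * F \<mu>"
proof -
  let ?d = "degree t"
  let ?g = "\<lambda>x. (of_real x - \<i>) ^ ?d * f x / poly t (of_real x)"
  have g: "?g \<in> lower_hardy" "\<And>\<mu>. Im \<mu> < 0 \<Longrightarrow> poly t \<mu> * lower_ext ?g \<mu> = (\<mu> - \<i>) ^ ?d * F \<mu>"
    using lower_hardy_poly_divide[OF f_lower t_nz F_bounded_by_t sq_integrable_near_t] by blast+
  \<comment> \<open>The numerator \<open>(x - \<i>) ^ ?d\<close> introduced by the division is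
    exchanged for \<open>s\<close>.\<close>
  have e: "e = (\<lambda>x. poly s (of_real x) * ?g x / (of_real x - \<i>) ^ ?d)"
    unfolding e_def using real_minus_nonzero[of \<i>] by auto
  have *: "e \<in> lower_hardy" "\<And>\<mu>. Im \<mu> < 0 \<Longrightarrow> lower_ext e \<mu> = poly s \<mu> * lower_ext ?g \<mu> / (\<mu> - \<i>) ^ ?d"
    using poly_lower_hardy[OF g(1) assms(1)] unfolding e by blast+
  show "e \<in> lower_hardy" by (rule *)
  fix \<mu> :: complex assume mu: "Im \<mu> < 0"
  have "\<mu> - \<i> \<noteq> 0" using mu by (auto simp: complex_eq_iff)
  then have "poly t \<mu> * lower_ext e \<mu> = poly s \<mu> * (poly t \<mu> * lower_ext ?g \<mu>) / (\<mu> - \<i>) ^ ?d"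
    unfolding *(2)[OF mu] by simp
  also have "\<dots> = poly s \<mu> * F \<mu>" unfolding g(2)[OF mu] using \<open>\<mu> - \<i> \<noteq> 0\<close> by simp
  finally show "poly t \<mu> * lower_ext e \<mu> = poly s \<mu> * F \<mu>" .
qed

text \<open>The extension satisfies \<open>p E = (m s) F\<close>; it remains to see that
  \<open>m s\<close> is the polynomial computed from \<open>E\<close>. Both have degree below
  \<open>N\<close>, and at each \<open>z k\<close> either the limit is 1 or \<open>m\<close>
  vanishes, so they agree at \<open>N\<close> distinct points.\<close>

lemma element_orth:
  assumes s: "degree s < degree t"
  shows "(\<lambda>x. cnj (poly s (of_real x) * f x / poly t (of_real x))) \<in> L2_orth (detectable \<phi> \<psi>)"
proof -
  let ?e = "\<lambda>x. poly s (of_real x) * f x / poly t (of_real x)"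
  let ?E = "lower_ext ?e"
  have e: "?e \<in> lower_hardy" "\<And>\<mu>. Im \<mu> < 0 \<Longrightarrow> poly t \<mu> * ?E \<mu> = poly s \<mu> * F \<mu>"
    using element_lower_hardy[of s] s by auto
  have eL2: "?e \<in> L2" using e(1) by (rule lower_hardy_L2)
  have eq: "poly p \<mu> * ?E \<mu> = poly (m * s) \<mu> * F \<mu>" if "Im \<mu> < 0" for \<mu>
    using e(2)[OF that] by (simp add: p_eq mult.assoc)
  have "resid ?E = m * s"
  proof (rule poly_eqI_degree[where A=Z])
    have cZ: "card Z = N" using card_image[OF z_inj] by simp
    have N: "N > 0" using s degree_t by simp
    show "degree (resid ?E) < card Z" unfolding cZ using resid_degree[of ?E] N by auto
    have "degree (m * s) \<le> degree m + degree s" by (rule degree_mult_le)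
    then show "degree (m * s) < card Z" unfolding cZ using s degree_t by linarith
    fix a assume "a \<in> Z"
    then obtain k where k: "k \<in> {1..N}" "a = z k" by blast
    have cont: "isCont ?E (z k)" using z_neg[OF k(1)] by (intro isCont_lower_ext eL2) auto
    have "poly (resid ?E) (z k) = lim_quot k * poly (m * s) (z k)"
      unfolding poly_resid_z[OF k(1)] by (rule value_at_z[OF k(1) cont eq])
    also have "\<dots> = poly (m * s) (z k)"
    proof (cases "k \<in> J")
      case True
      then have "[:- z k, 1:] dvd m" using power_dvd_m[of "z k"] mult_z[OF k(1)] by (auto simp: A_def)
      then have "poly m (z k) = 0" by (simp add: poly_eq_0_iff_dvd)
      then show ?thesis by simp
    next
      case False
      then show ?thesis using k by (simp add: J_def)
    qed
    finally show "poly (resid ?E) a = poly (m * s) a" by (simp add: k(2))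
  qed
  then show ?thesis using orth_detectable_iff[OF eL2] e(1) eq by simp
qed

text \<open>Divisibility by \<open>m\<close> writes \<open>resid\<close> as \<open>m * s\<close>,
  the degree bound passes to \<open>s\<close>, and the boundary identity can be divided by
  \<open>p\<close> away from its finitely many zeros.\<close>

lemma orth_element:
  assumes g: "g \<in> L2_orth (detectable \<phi> \<psi>)"
  obtains s where "s = 0 \<or> degree s < degree t"
    "AE x in lborel. cnj (g x) = poly s (of_real x) * f x / poly t (of_real x)"
proof -
  let ?w = "\<lambda>x. cnj (g x)"
  have gL2: "g \<in> L2" using g by (simp add: L2_orth_def)
  have wL2: "?w \<in> L2" using gL2 by (rule L2_cnj)
  have w: "?w \<in> lower_hardy"
    and eq: "\<And>\<mu>. Im \<mu> < 0 \<Longrightarrow> poly p \<mu> * lower_ext ?w \<mu> = poly (resid (lower_ext ?w)) \<mu> * F \<mu>"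
    using orth_detectable_iff[OF wL2] g by simp_all
  obtain s where s: "resid (lower_ext ?w) = m * s" using m_dvd_resid[OF w eq] by (auto elim: dvdE)
  show ?thesis
  proof (rule that)
    show "s = 0 \<or> degree s < degree t"
    proof (cases "s = 0")
      case False
      then have "degree (m * s) = degree m + degree s" "m * s \<noteq> 0"
        using m_nz by (auto simp: degree_mult_eq)
      then show ?thesis using resid_degree[of "lower_ext ?w"] degree_t unfolding s by auto
    qed simp
    have "AE x in lborel. poly p (of_real x) * ?w x = poly (resid (lower_ext ?w)) (of_real x) * f x"
      by (rule boundary_identity[OF f_lower w]) (erule eq)
    then show "AE x in lborel. ?w x = poly s (of_real x) * f x / poly t (of_real x)"
      using AE_poly_nonzero[OF p_nz]
    proof eventually_elim
      case (elim x)
      have "poly m (of_real x) \<noteq> 0" "poly t (of_real x) \<noteq> 0" using elim(2) by (auto simp: p_eq)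
      moreover have "poly m (of_real x) * (poly t (of_real x) * ?w x) = poly m (of_real x) * (poly s (of_real x) * f x)"
        using elim(1) unfolding s p_eq poly_mult by (simp only: mult.assoc)
      ultimately show ?case by (simp add: field_simps)
    qed
  qed
qed

text \<open>All limits are then \<open>0 \<noteq> 1\<close>, so \<open>m\<close> has full degree.\<close>

lemma f_zero_imp_degree:
  assumes "AE x in lborel. f x = 0"
  shows "degree t = 0"
proof -
  have F0: "F w = 0" for w
    using cauchy_int_cong_AE[OF f_measurable _ assms, of w] by (simp add: lower_ext_def cauchy_int_def)
  have "J = {1..N}"
  proof -
    have "lim_quot k = 0" if k: "k \<in> {1..N}" for k
    proof -
      have "((\<lambda>w. 0) \<longlongrightarrow> ratio k) (at (z k))" using ratio_tendsto(1)[OF k] by (simp add: F0)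
      then have "ratio k = 0" by (simp add: tendsto_const_iff)
      then show ?thesis using lim_quot_ratio[OF k] by simp
    qed
    then show ?thesis by (auto simp: J_def)
  qed
  then have "M0_number \<phi> \<psi> N c z = N" using card_J by simp
  then show ?thesis using degree_m degree_t by simp
qed

lemma has_dimension: "has_L2_dim (L2_orth (detectable \<phi> \<psi>)) (degree t)"
proof -
  let ?d = "degree t"
  define e where "e i = (\<lambda>x. cnj (poly (monom 1 i) (of_real x) * f x / poly t (of_real x)))" for i
  \<comment> \<open>The basis consists of conjugates, so the coefficients of the polynomial are
    conjugated.\<close>
  have lin: "(\<Sum>i<?d. a i * e i x) = cnj (poly (\<Sum>i<?d. monom (cnj (a i)) i) (of_real x) * f x / poly t (of_real x))" for a x
  proof -
    let ?y = "f x / poly t (of_real x)"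
    have "poly (\<Sum>i<?d. monom (cnj (a i)) i) (of_real x) * ?y = (\<Sum>i<?d. cnj (a i) * (of_real x ^ i * ?y))"
      by (simp only: poly_sum poly_monom sum_distrib_right mult.assoc)
    then have "cnj (poly (\<Sum>i<?d. monom (cnj (a i)) i) (of_real x) * ?y) = (\<Sum>i<?d. a i * cnj (of_real x ^ i * ?y))"
      by (simp only: cnj_sum complex_cnj_mult complex_cnj_cnj)
    then show ?thesis by (simp add: e_def poly_monom)
  qed
  show ?thesis
    unfolding has_L2_dim_def
  proof (intro exI[of _ e] conjI allI impI ballI)
    fix i assume "i < ?d"
    then show "e i \<in> L2_orth (detectable \<phi> \<psi>)"
      unfolding e_def by (intro element_orth) (simp add: degree_monom_eq)
  next
    fix a i assume ae: "AE x in lborel. (\<Sum>i<?d. a i * e i x) = 0" and i: "i < ?d"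
    define s where "s = (\<Sum>i<?d. monom (cnj (a i)) i)"
    \<comment> \<open>A nontrivial relation would force \<open>f = 0\<close> almost everywhere,
      since \<open>s\<close> and \<open>t\<close> have finitely many zeros; but then
      \<open>t\<close> has degree 0 and no index \<open>i\<close> exists.\<close>
    have "s = 0"
    proof (rule ccontr)
      assume "s \<noteq> 0"
      have "AE x in lborel. f x = 0"
        using ae AE_poly_nonzero[OF \<open>s \<noteq> 0\<close>] AE_poly_nonzero[OF t_nz]
        by eventually_elim (auto simp: lin s_def[symmetric])
      from f_zero_imp_degree[OF this] i show False by simp
    qed
    then have "coeff s i = 0" by simp
    moreover have "coeff s i = cnj (a i)"
      using i by (simp add: s_def coeff_sum)
    ultimately show "a i = 0" by simp
  next
    fix g assume "g \<in> L2_orth (detectable \<phi> \<psi>)"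
    then obtain s where s: "s = 0 \<or> degree s < ?d"
      "AE x in lborel. cnj (g x) = poly s (of_real x) * f x / poly t (of_real x)"
      by (rule orth_element)
    have ss: "(\<Sum>i<?d. monom (coeff s i) i) = s"
    proof (rule poly_eqI)
      fix n
      show "coeff (\<Sum>i<?d. monom (coeff s i) i) n = coeff s n"
        using s(1) by (auto simp: coeff_sum coeff_eq_0)
    qed
    show "\<exists>a. AE x in lborel. g x = (\<Sum>i<?d. a i * e i x)"
    proof (intro exI[of _ "\<lambda>i. cnj (coeff s i)"])
      show "AE x in lborel. g x = (\<Sum>i<?d. cnj (coeff s i) * e i x)"
        using s(2)
      proof eventually_elim
        case (elim x)
        have "(\<Sum>i<?d. cnj (coeff s i) * e i x) = cnj (cnj (g x))"
          unfolding lin elim by (simp add: ss)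
        then show ?case by simp
      qed
    qed
  qed
qed

lemma part_b:
  "finite (lower_poles \<phi> \<psi> Z) \<and> finite (real_poles \<phi> \<psi>) \<and>
   (\<exists>d. has_L2_dim (L2_orth (detectable \<phi> \<psi>)) d \<and>
      int d = int N
        - int (\<Sum>\<mu>\<in>lower_poles \<phi> \<psi> Z. lower_order \<phi> \<psi> \<mu>)
        - int (\<Sum>x\<in>real_poles \<phi> \<psi>. real_order \<phi> \<psi> x)
        - int (M0_number \<phi> \<psi> N c z))"
proof (intro conjI finite_poles exI[of _ "degree t"] has_dimension)
  have "degree t + ((\<Sum>\<mu>\<in>lower_poles \<phi> \<psi> Z. lower_order \<phi> \<psi> \<mu>)
    + (\<Sum>x\<in>real_poles \<phi> \<psi>. real_order \<phi> \<psi> x) + M0_number \<phi> \<psi> N c z) = N"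
    using degree_m degree_t by simp
  then show "int (degree t) = int N
        - int (\<Sum>\<mu>\<in>lower_poles \<phi> \<psi> Z. lower_order \<phi> \<psi> \<mu>)
        - int (\<Sum>x\<in>real_poles \<phi> \<psi>. real_order \<phi> \<psi> x)
        - int (M0_number \<phi> \<psi> N c z)" by linarith
qed

end

theorem theorem5p6:
  fixes \<phi> \<psi> :: "real \<Rightarrow> complex"
  assumes "\<phi> \<in> hardy2_plus" and "\<psi> \<in> hardy2_plus"
  shows "detectable \<phi> \<psi> =
      L2_closure (fun_set_sum
        (closed_span {\<lambda>x. 1 / (of_real x - \<mu>) | \<mu>. Im \<mu> > 0})
        (closed_span {\<lambda>x. (D_fun \<phi> \<psi> \<mu> + 2 * of_real pi * \<i> * hardy_bar \<phi> \<mu> * \<psi> x) / (of_real x - \<mu>)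
                     | \<mu>. Im \<mu> < 0}))
    \<and> (\<forall>(N::nat) (c :: nat \<Rightarrow> complex) (z :: nat \<Rightarrow> complex).
        (AE x in lborel. \<psi> x = (\<Sum>j=1..N. c j / (of_real x - z j))) \<and>
        (\<forall>j\<in>{1..N}. c j \<noteq> 0 \<and> Im (z j) < 0) \<and>
        (\<forall>i\<in>{1..N}. \<forall>j\<in>{1..N}. i \<noteq> j \<longrightarrow> z i \<noteq> z j) \<longrightarrow>
        \<comment> \<open>(a)\<close>
        ((\<exists>p q :: complex poly. q \<noteq> 0 \<and>
            (\<forall>\<mu>. Im \<mu> > 0 \<longrightarrow> poly q \<mu> \<noteq> 0 \<and> D_fun \<phi> \<psi> \<mu> = poly p \<mu> / poly q \<mu>)) \<and>
         is_D_plus \<phi> \<psi> (D_plus \<phi> \<psi>) \<and>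
         (\<forall>\<mu>. \<mu> \<notin> z ` {1..N} \<longrightarrow>
            D_plus \<phi> \<psi> \<mu> = 1 + 2 * of_real pi * \<i> * (\<Sum>j=1..N. c j * hardy_bar \<phi> (z j) / (\<mu> - z j)))) \<and>
        \<comment> \<open>(b)\<close>
        (M0_limits_exist \<phi> \<psi> N c z \<longrightarrow>
         finite (lower_poles \<phi> \<psi> (z ` {1..N})) \<and> finite (real_poles \<phi> \<psi>) \<and>
         (\<exists>d. has_L2_dim (L2_orth (detectable \<phi> \<psi>)) d \<and>
            int d = int N
              - int (\<Sum>\<mu>\<in>lower_poles \<phi> \<psi> (z ` {1..N}). lower_order \<phi> \<psi> \<mu>)
              - int (\<Sum>x\<in>real_poles \<phi> \<psi>. real_order \<phi> \<psi> x)
              - int (M0_number \<phi> \<psi> N c z))))"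
proof -
  interpret friedrichs \<phi> \<psi> using assms by unfold_locales
  show ?thesis
  proof (intro conjI[OF detectable_eq[unfolded upper_gens_def lower_gens_def]] allI impI, elim conjE)
    fix N :: nat and c z :: "nat \<Rightarrow> complex"
    assume h: "AE x in lborel. \<psi> x = (\<Sum>j=1..N. c j / (of_real x - z j))"
      "\<forall>j\<in>{1..N}. c j \<noteq> 0 \<and> Im (z j) < 0"
      "\<forall>i\<in>{1..N}. \<forall>j\<in>{1..N}. i \<noteq> j \<longrightarrow> z i \<noteq> z j"
    interpret friedrichs_rational \<phi> \<psi> N c z
      by unfold_locales (use h in \<open>auto simp: inj_on_def\<close>)
    have b: "finite (lower_poles \<phi> \<psi> (z ` {1..N})) \<and> finite (real_poles \<phi> \<psi>) \<and>
         (\<exists>d. has_L2_dim (L2_orth (detectable \<phi> \<psi>)) d \<and>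
            int d = int N
              - int (\<Sum>\<mu>\<in>lower_poles \<phi> \<psi> (z ` {1..N}). lower_order \<phi> \<psi> \<mu>)
              - int (\<Sum>x\<in>real_poles \<phi> \<psi>. real_order \<phi> \<psi> x)
              - int (M0_number \<phi> \<psi> N c z))" if "M0_limits_exist \<phi> \<psi> N c z"
    proof -
      interpret friedrichs_limits \<phi> \<psi> N c z using that by unfold_locales
      show ?thesis by (rule part_b)
    qed
    show "((\<exists>p q :: complex poly. q \<noteq> 0 \<and>
            (\<forall>\<mu>. Im \<mu> > 0 \<longrightarrow> poly q \<mu> \<noteq> 0 \<and> D_fun \<phi> \<psi> \<mu> = poly p \<mu> / poly q \<mu>)) \<and>
         is_D_plus \<phi> \<psi> (D_plus \<phi> \<psi>) \<and>
         (\<forall>\<mu>. \<mu> \<notin> z ` {1..N} \<longrightarrow>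
            D_plus \<phi> \<psi> \<mu> = 1 + 2 * of_real pi * \<i> * (\<Sum>j=1..N. c j * hardy_bar \<phi> (z j) / (\<mu> - z j)))) \<and>
        (M0_limits_exist \<phi> \<psi> N c z \<longrightarrow>
         finite (lower_poles \<phi> \<psi> (z ` {1..N})) \<and> finite (real_poles \<phi> \<psi>) \<and>
         (\<exists>d. has_L2_dim (L2_orth (detectable \<phi> \<psi>)) d \<and>
            int d = int N
              - int (\<Sum>\<mu>\<in>lower_poles \<phi> \<psi> (z ` {1..N}). lower_order \<phi> \<psi> \<mu>)
              - int (\<Sum>x\<in>real_poles \<phi> \<psi>. real_order \<phi> \<psi> x)
              - int (M0_number \<phi> \<psi> N c z)))"
      by (intro conjI[OF part_a] impI b)
  qed
qed

end
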